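(* Assume the setting, notation and assumptions (A1)-(A4), (M1)-(M2) described in the context (finite discrete $\mathcal X_t$; lower semicontinuous costs bounded from below; $G(x_t,y_t,\cdot)$ nondecreasing; Markovian kernels). Then, proceeding backward in time, for every $t\in\{0,\dots,T-1\}$ there exists a Borel measurable optimizer $(x_t,y_t)\mapsto\pi^*(dx_{t+1},dy_{t+1}\mid x_t,y_t)$ for the extended dynamic programming equation (DP), or equivalently for its reduced form (DP'). Moreover, the transport plan $\pi^*$ obtained by concatenating these kernels, $$\pi^*(dx_{t+1:T},dy_{t+1:T}\mid x_t,y_t)=\prod_{s=t}^{T-1}\pi^*(dx_{s+1},dy_{s+1}\mid x_s,y_s),$$ is an equilibrium transport. The value function $V_t(x_t,y_t)$ in (DP) is Borel measurable in $(x_t,y_t)$. Moreover, there exists a Polish topology on $\mathcal X_t\times\mathcal Y_t$, finer than $\mathcal T_{\mathcal X_t}\times\mathcal T_{\mathcal Y_t}$, under which $\pi^*(dx_{t+1},dy_{t+1}\mid x_t,y_t)$ is continuous in $(x_t,y_t)$ and $V_t(x_t,y_t)$ is lower semicontinuous in $(x_t,y_t)$.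
   Context: **Spaces.** $T\ge 1$ is the finite number of periods. For $t\in\{1,\dots,T\}$, $\mathcal X_t$ and $\mathcal Y_t$ are closed subsets of $\mathbb R^d$, equipped with Polish topologies $\mathcal T_{\mathcal X_t},\mathcal T_{\mathcal Y_t}$; $\mathcal X_0,\mathcal Y_0$ are singletons (the initial state is fixed). Products carry product topologies; $\mathcal X=\mathcal X_1\times\dots\times\mathcal X_T$, $\mathcal Y=\mathcal Y_1\times\dots\times\mathcal Y_T$; $x_{s:t}=(x_s,\dots,x_t)$. $\mathcal P(\mathcal S)$ is the set of Borel probability measures on a Polish space $\mathcal S$, with the usual weak topology (generated by integration against bounded continuous functions); $\mathbb R$ has its usual topology. $\Pi(\alpha,\beta)$ is the set of couplings of $\alpha$ and $\beta$. **Measures and bicausality.** $\mu\in\mathcal P(\mathcal X)$, $\nu\in\mathcal P(\mathcal Y)$, with regular conditional kernels $\mu(dx_{t+1}\mid x_{1:t})$, $\nu(dy_{t+1}\mid y_{1:t})$; for $t=0$ these are the first marginals of $\mu$ and $\nu$. A plan $\pi\in\Pi(\mu,\nu)$ with successive kernels $\pi(dx_{t+1},dy_{t+1}\mid x_{1:t},y_{1:t})$ is bicausal iff its first kernel couples the first marginals of $\mu,\nu$ and, for each $t=1,\dots,T-1$ and $\pi$-a.e. $(x_{1:t},y_{1:t})$, $\pi(dx_{t+1},dy_{t+1}\mid x_{1:t},y_{1:t})\in\Pi(\mu(dx_{t+1}\mid x_{1:t}),\nu(dy_{t+1}\mid y_{1:t}))$. **Assumptions on the measures.** For each $t\in\{1,\dots,T-1\}$: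 (M1) the kernels of $\mu,\nu$ are Markovian, denoted $\mu(dx_{t+1}\mid x_t)$, $\nu(dy_{t+1}\mid y_t)$; (M2) $y_t\mapsto\nu(dy_{t+1}\mid y_t)\in\mathcal P(\mathcal Y_{t+1})$ is Borel measurable. **Assumptions on the costs.** (A1) For each $t\in\{1,\dots,T\}$, $\mathcal X_t$ is a non-empty finite set with the discrete topology. (A2) For each $k\in\{1,\dots,T\}$, $i\in\{0,\dots,T\}$, $c_k(x_i,y_i,x_k,y_k)$ is a real-valued function on $\mathcal X_i\times\mathcal Y_i\times\mathcal X_k\times\mathcal Y_k$ that is lower semicontinuous and bounded from below (so for $i=k$, $(x_k,y_k)\mapsto c_k(x_k,y_k,x_k,y_k)$ is lower semicontinuous and bounded from below). (A3) $h:\mathcal X_T\times\mathcal Y_T\to\mathbb R$ is lower semicontinuous and bounded from below. (A4) For each $t\in\{0,\dots,T\}$, $G(x_t,y_t,g):\mathcal X_t\times\mathcal Y_t\times\mathbb R\to\mathbb R$ is lower semicontinuous, and $G(x_t,y_t,\cdot)$ is nondecreasing for each $(x_t,y_t)$. **Objective.** $$J(x_t,y_t;\pi)=\int\sum_{k=t+1}^T c_k(x_t,y_t,x_k,y_k)\,\pi(dx_{t+1:T},dy_{t+1:T}\mid x_t,y_t)+G\Big(x_t,y_t,\int h(x_T,y_T)\,\pi(dx_T,dy_T\mid x_t,y_t)\Big).$$ **Equilibrium transport.** A bicausal plan $\pi^*$ with successive kernels $\pi^*(dx_{s+1},dy_{s+1}\mid x_s,y_s)$ is an equilibrium transport if for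 every $t=0,\dots,T-1$ and $\pi^*$-a.e. path $(x_{1:t},y_{1:t})$, $$\inf_{\gamma\in\Pi(\mu(dx_{t+1}\mid x_t),\nu(dy_{t+1}\mid y_t))}J(x_t,y_t;\pi^{t,\gamma})=J(x_t,y_t;\pi^{t,*}),$$ where $\pi^{t,\gamma}=\gamma(dx_{t+1},dy_{t+1})\prod_{s=t+1}^{T-1}\pi^*(dx_{s+1},dy_{s+1}\mid x_s,y_s)$ and $\pi^{t,*}=\prod_{s=t}^{T-1}\pi^*(dx_{s+1},dy_{s+1}\mid x_s,y_s)$. **Extended dynamic programming equation (DP).** $V_T(x_T,y_T)=G(x_T,y_T,h(x_T,y_T))$ and, for $t=T-1,\dots,0$, $$\begin{aligned}V_t(x_t,y_t)=\inf_{\gamma\in\Pi(\mu(dx_{t+1}\mid x_t),\nu(dy_{t+1}\mid y_t))}\Big[&\int\big(c_{t+1}(x_t,y_t,x_{t+1},y_{t+1})+V_{t+1}(x_{t+1},y_{t+1})\big)d\gamma-\int G(x_{t+1},y_{t+1},g_{t+1}(x_{t+1},y_{t+1}))d\gamma\\&+G\Big(x_t,y_t,\int g_{t+1}(x_{t+1},y_{t+1})d\gamma\Big)-\int\sum_{k=t+2}^T b_k(x_{t+1},y_{t+1},x_{t+1},y_{t+1})d\gamma\\&+\int\sum_{k=t+2}^T b_k(x_t,y_t,x_{t+1},y_{t+1})d\gamma\Big],\end{aligned}$$ where $d\gamma=\gamma(dx_{t+1},dy_{t+1})$, $\pi^*(dx_{s+1},dy_{s+1}\mid x_s,y_s)$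 denotes an optimizer at time $s$ (already chosen for all $s>t$), $\pi^*(dx_k,dy_k\mid x_{t+1},y_{t+1})$ is the marginal on $(x_k,y_k)$ of the concatenation of these kernels, $g_T=h$, and $$g_{t+1}(x_{t+1},y_{t+1})=\int h(x_T,y_T)\,\pi^*(dx_T,dy_T\mid x_{t+1},y_{t+1}),\qquad b_k(w,v,x_{t+1},y_{t+1})=\int c_k(w,v,x_k,y_k)\,\pi^*(dx_k,dy_k\mid x_{t+1},y_{t+1})$$ for $t\in\{0,\dots,T-2\}$, $k\in\{t+2,\dots,T\}$, $w\in\mathcal X_i$, $v\in\mathcal Y_i$, $i\in\{0,\dots,t+1\}$. **Reduced form (DP').** $$V_t(x_t,y_t)=\inf_{\gamma}\Big[\int c_{t+1}(x_t,y_t,x_{t+1},y_{t+1})d\gamma+G\Big(x_t,y_t,\int g_{t+1}(x_{t+1},y_{t+1})d\gamma\Big)+\int\sum_{k=t+2}^T b_k(x_t,y_t,x_{t+1},y_{t+1})d\gamma\Big],$$ with the infimum over the same set of $\gamma$. Borel measurability and continuity of $\pi^*(dx_{t+1},dy_{t+1}\mid x_t,y_t)$ refer to it as a map from $\mathcal X_t\times\mathcal Y_t$ to $\mathcal P(\mathcal X_{t+1}\times\mathcal Y_{t+1})$ with the weak topology.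
   Formalization: Integrals of costs and h may be +∞, so J and V_t are extended-real and G(x,y,·) is extended by its supremum at +∞; in (DP) the terms at time t+1 alone are put under one integral with ∞−∞=0, which agrees with the separate integrals whenever those are defined. *)

theory Defs
  imports "HOL-Probability.Probability"
begin

section \<open>Polish topologies, Borel probability measures, couplings\<close>

definition polish_topology :: "'a topology \<Rightarrow> bool" where
  "polish_topology S \<longleftrightarrow>
     completely_metrizable_space S \<and>
     (\<exists>D. countable D \<and> D \<subseteq> topspace S \<and> S closure_of D = topspace S)"

definition finer_topology :: "'a topology \<Rightarrow> 'a topology \<Rightarrow> bool" where
  "finer_topology S R \<longleftrightarrow> topspace S = topspace R \<and> (\<forall>U. openin R U \<longrightarrow> openin S U)"

definition lsc_on :: "'a topology \<Rightarrow> ('a \<Rightarrow> 'b::linorder) \<Rightarrow> bool" where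
  "lsc_on S f \<longleftrightarrow> (\<forall>a. openin S {x \<in> topspace S. a < f x})"

definition borel_of :: "'a topology \<Rightarrow> 'a measure" where
  "borel_of S = sigma (topspace S) {U. openin S U}"

definition probs :: "'a topology \<Rightarrow> 'a measure set" where
  "probs S = {M. prob_space M \<and> sets M = sets (borel_of S)}"

definition weak_topology :: "'a topology \<Rightarrow> 'a measure topology" where
  "weak_topology S = topology_generated_by
     {{M \<in> probs S. (\<integral>x. f x \<partial>M) \<in> U} | f U.
        continuous_map S euclideanreal f \<and> bounded (f ` topspace S) \<and> open U}"

definition couplings ::
  "'a topology \<Rightarrow> 'b topology \<Rightarrow> 'a measure \<Rightarrow> 'b measure \<Rightarrow> ('a \<times> 'b) measure set" where
  "couplings S R \<alpha> \<beta> = {\<gamma> \<in> probs (prod_topology S R).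
     distr \<gamma> (borel_of S) fst = \<alpha> \<and> distr \<gamma> (borel_of R) snd = \<beta>}"

text \<open>\<open>\<kappa>\<close> is a regular conditional distribution under \<open>M\<close> of the \<open>N\<close>-valued variable \<open>W\<close> given
  the \<open>H\<close>-valued variable \<open>U\<close>.\<close>

definition regular_cond_kernel ::
  "'o measure \<Rightarrow> 'h measure \<Rightarrow> 's measure \<Rightarrow> ('o \<Rightarrow> 'h) \<Rightarrow> ('o \<Rightarrow> 's) \<Rightarrow> ('h \<Rightarrow> 's measure) \<Rightarrow> bool"
where
  "regular_cond_kernel M H N U W \<kappa> \<longleftrightarrow>
     \<kappa> \<in> H \<rightarrow>\<^sub>M prob_algebra N \<and>
     (\<forall>A\<in>sets H. \<forall>B\<in>sets N.
        emeasure M {\<omega> \<in> space M. U \<omega> \<in> A \<and> W \<omega> \<in> B} =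
        (\<integral>\<^sup>+ u. emeasure (\<kappa> u) B * indicator A u \<partial>distr M H U))"

section \<open>Extended integrals\<close>

text \<open>The costs are only bounded from below, so their integrals may equal \<open>\<infinity>\<close>.  The following
  integral is the usual one for functions bounded from below under a probability measure
  (the second term is then finite).\<close>

definition ext_integral :: "'a measure \<Rightarrow> ('a \<Rightarrow> ereal) \<Rightarrow> ereal" where
  "ext_integral M f =
     enn2ereal (\<integral>\<^sup>+ x. e2ennreal (f x) \<partial>M) - enn2ereal (\<integral>\<^sup>+ x. e2ennreal (- f x) \<partial>M)"

text \<open>Subtraction with \<open>\<infinity> - \<infinity> = 0\<close> (the library's \<open>ereal\<close> subtraction gives \<open>\<infinity>\<close>).\<close>

definition cancel_diff :: "ereal \<Rightarrow> ereal \<Rightarrow> ereal" where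
  "cancel_diff a b = (if a = \<infinity> \<and> b = \<infinity> then 0 else a - b)"

lemma ext_integral_integrable:
  assumes "integrable M f"
  shows "ext_integral M (\<lambda>x. ereal (f x)) = ereal (\<integral>x. f x \<partial>M)"
proof -
  have fin: "(\<integral>\<^sup>+ x. ennreal (f x) \<partial>M) < \<top>" "(\<integral>\<^sup>+ x. ennreal (- f x) \<partial>M) < \<top>"
    using assms by (auto simp: real_integrable_def top.not_eq_extremum)
  have "enn2ereal y = ereal (enn2real y)" if "y < \<top>" for y
    using that by (cases y) (auto simp: enn2ereal_ennreal)
  then show ?thesis
    using fin by (simp add: ext_integral_def real_lebesgue_integral_def[OF assms])
qed

lemma ext_integral_cong:
  assumes "\<And>x. x \<in> space M \<Longrightarrow> f x = g x"
  shows "ext_integral M f = ext_integral M g"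
  using assms unfolding ext_integral_def by (simp cong: nn_integral_cong)

section \<open>Time-inconsistent bicausal transport problems with Markovian marginals\<close>

type_synonym 'd state = "(real^'d) \<times> (real^'d)"
type_synonym 'd path = "nat \<Rightarrow> real^'d"

text \<open>The spaces \<open>\<X>\<^sub>t\<close>, \<open>\<Y>\<^sub>t\<close> are the carriers \<open>topspace (TX P t)\<close>, \<open>topspace (TY P t)\<close>.
  The kernels \<open>kmu P t\<close>, \<open>knu P t\<close> are \<open>\<mu>(dx\<^bsub>t+1\<^esub> | x\<^sub>t)\<close>, \<open>\<nu>(dy\<^bsub>t+1\<^esub> | y\<^sub>t)\<close>.
  The function \<open>cost P i k (x, y) (x', y')\<close> is \<open>c\<^sub>k(x, y, x', y')\<close> on
  \<open>\<X>\<^sub>i \<times> \<Y>\<^sub>i \<times> \<X>\<^sub>k \<times> \<Y>\<^sub>k\<close>; the index \<open>i\<close> is explicit because these spaces may overlap as sets.\<close>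

record ('d::finite) problem =
  horizon :: nat
  TX :: "nat \<Rightarrow> (real^'d) topology"
  TY :: "nat \<Rightarrow> (real^'d) topology"
  x0 :: "real^'d"
  y0 :: "real^'d"
  mu :: "'d path measure"
  nu :: "'d path measure"
  kmu :: "nat \<Rightarrow> real^'d \<Rightarrow> (real^'d) measure"
  knu :: "nat \<Rightarrow> real^'d \<Rightarrow> (real^'d) measure"
  cost :: "nat \<Rightarrow> nat \<Rightarrow> 'd state \<Rightarrow> 'd state \<Rightarrow> real"
  hfun :: "'d state \<Rightarrow> real"
  Gfun :: "nat \<Rightarrow> 'd state \<Rightarrow> real \<Rightarrow> real"

abbreviation ZT :: "('d::finite) problem \<Rightarrow> nat \<Rightarrow> 'd state topology" where
  "ZT P t \<equiv> prod_topology (TX P t) (TY P t)"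

text \<open>Paths \<open>x\<^bsub>s+1:t\<^esub>\<close> are extensional functions on \<open>{s<..t}\<close>.\<close>

abbreviation XP :: "('d::finite) problem \<Rightarrow> nat \<Rightarrow> nat \<Rightarrow> 'd path topology" where
  "XP P s t \<equiv> product_topology (TX P) {s<..t}"

abbreviation YP :: "('d::finite) problem \<Rightarrow> nat \<Rightarrow> nat \<Rightarrow> 'd path topology" where
  "YP P s t \<equiv> product_topology (TY P) {s<..t}"

abbreviation ZP :: "('d::finite) problem \<Rightarrow> nat \<Rightarrow> nat \<Rightarrow> ('d path \<times> 'd path) topology" where
  "ZP P s t \<equiv> prod_topology (XP P s t) (YP P s t)"

definition at_time :: "real^'d \<Rightarrow> ('d::finite) path \<Rightarrow> nat \<Rightarrow> real^'d" where
  "at_time s0 xs t = (if t = 0 then s0 else xs t)"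

definition setting :: "('d::finite) problem \<Rightarrow> bool" where
  "setting P \<longleftrightarrow>
     horizon P \<ge> 1 \<and>
     (\<forall>t\<in>{1..horizon P}. closed (topspace (TX P t)) \<and> closed (topspace (TY P t)) \<and>
        polish_topology (TX P t) \<and> polish_topology (TY P t)) \<and>
     topspace (TX P 0) = {x0 P} \<and> topspace (TY P 0) = {y0 P} \<and>
     mu P \<in> probs (XP P 0 (horizon P)) \<and> nu P \<in> probs (YP P 0 (horizon P))"

definition asm_M1 :: "('d::finite) problem \<Rightarrow> bool" where
  "asm_M1 P \<longleftrightarrow> (\<forall>t<horizon P.
     regular_cond_kernel (mu P) (borel_of (XP P 0 t)) (borel_of (TX P (Suc t)))
       (\<lambda>xs. restrict xs {0<..t}) (\<lambda>xs. xs (Suc t)) (\<lambda>xs. kmu P t (at_time (x0 P) xs t)) \<and>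
     regular_cond_kernel (nu P) (borel_of (YP P 0 t)) (borel_of (TY P (Suc t)))
       (\<lambda>ys. restrict ys {0<..t}) (\<lambda>ys. ys (Suc t)) (\<lambda>ys. knu P t (at_time (y0 P) ys t)))"

definition asm_M2 :: "('d::finite) problem \<Rightarrow> bool" where
  "asm_M2 P \<longleftrightarrow> (\<forall>t\<in>{1..<horizon P}.
     knu P t \<in> borel_of (TY P t) \<rightarrow>\<^sub>M borel_of (weak_topology (TY P (Suc t))))"

definition asm_A1 :: "('d::finite) problem \<Rightarrow> bool" where
  "asm_A1 P \<longleftrightarrow> (\<forall>t\<in>{1..horizon P}.
     finite (topspace (TX P t)) \<and> topspace (TX P t) \<noteq> {} \<and>
     TX P t = discrete_topology (topspace (TX P t)))"

definition asm_A2 :: "('d::finite) problem \<Rightarrow> bool" where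
  "asm_A2 P \<longleftrightarrow> (\<forall>k\<in>{1..horizon P}. \<forall>i\<in>{0..horizon P}.
     lsc_on (prod_topology (ZT P i) (ZT P k)) (\<lambda>(z, w). cost P i k z w) \<and>
     bdd_below ((\<lambda>(z, w). cost P i k z w) ` (topspace (ZT P i) \<times> topspace (ZT P k))))"

definition asm_A3 :: "('d::finite) problem \<Rightarrow> bool" where
  "asm_A3 P \<longleftrightarrow> lsc_on (ZT P (horizon P)) (hfun P) \<and>
     bdd_below (hfun P ` topspace (ZT P (horizon P)))"

definition asm_A4 :: "('d::finite) problem \<Rightarrow> bool" where
  "asm_A4 P \<longleftrightarrow> (\<forall>t\<in>{0..horizon P}.
     lsc_on (prod_topology (ZT P t) euclideanreal) (\<lambda>(z, r). Gfun P t z r) \<and>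
     (\<forall>z\<in>topspace (ZT P t). mono (Gfun P t z)))"

text \<open>Monotone extension of \<open>G(x\<^sub>t, y\<^sub>t, \<cdot>)\<close> to the extended reals: \<open>\<integral> h\<close> may be \<open>\<infinity>\<close>.\<close>

definition Gext :: "('d::finite) problem \<Rightarrow> nat \<Rightarrow> 'd state \<Rightarrow> ereal \<Rightarrow> ereal" where
  "Gext P t z g = (case g of ereal r \<Rightarrow> ereal (Gfun P t z r)
     | PInfty \<Rightarrow> (SUP r. ereal (Gfun P t z r)) | MInfty \<Rightarrow> (INF r. ereal (Gfun P t z r)))"

section \<open>Bicausal plans, concatenation of kernels, equilibrium transports\<close>

text \<open>Here \<open>\<kappa>\<mu>\<close>, \<open>\<kappa>\<nu>\<close> are the conditional kernels of the marginals given the whole history;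
  \<open>t = 0\<close> is the condition on the first kernel.\<close>

definition bicausal ::
  "('d::finite) problem \<Rightarrow> (nat \<Rightarrow> 'd path \<Rightarrow> (real^'d) measure) \<Rightarrow>
     (nat \<Rightarrow> 'd path \<Rightarrow> (real^'d) measure) \<Rightarrow> ('d path \<times> 'd path) measure \<Rightarrow> bool" where
  "bicausal P \<kappa>\<mu> \<kappa>\<nu> Q \<longleftrightarrow>
     Q \<in> couplings (XP P 0 (horizon P)) (YP P 0 (horizon P)) (mu P) (nu P) \<and>
     (\<forall>t<horizon P. \<exists>\<kappa>.
        regular_cond_kernel Q (borel_of (ZP P 0 t)) (borel_of (ZT P (Suc t)))
          (\<lambda>(xs, ys). (restrict xs {0<..t}, restrict ys {0<..t}))
          (\<lambda>(xs, ys). (xs (Suc t), ys (Suc t))) \<kappa> \<and>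
        (AE (xs, ys) in Q.
           \<kappa> (restrict xs {0<..t}, restrict ys {0<..t}) \<in>
             couplings (TX P (Suc t)) (TY P (Suc t))
               (\<kappa>\<mu> t (restrict xs {0<..t})) (\<kappa>\<nu> t (restrict ys {0<..t}))))"

text \<open>A family of transition kernels: \<open>p t (x, y)\<close> is \<open>\<pi>(dx\<^bsub>t+1\<^esub>, dy\<^bsub>t+1\<^esub> | x, y)\<close>.\<close>

type_synonym 'd kernels = "nat \<Rightarrow> 'd state \<Rightarrow> 'd state measure"

definition borel_kernel :: "('d::finite) problem \<Rightarrow> nat \<Rightarrow> ('d state \<Rightarrow> 'd state measure) \<Rightarrow> bool" where
  "borel_kernel P t q \<longleftrightarrow> q \<in> borel_of (ZT P t) \<rightarrow>\<^sub>M borel_of (weak_topology (ZT P (Suc t)))"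

definition admissible :: "('d::finite) problem \<Rightarrow> nat \<Rightarrow> 'd state \<Rightarrow> 'd state measure set" where
  "admissible P t z =
     couplings (TX P (Suc t)) (TY P (Suc t)) (kmu P t (fst z)) (knu P t (snd z))"

text \<open>\<open>prepend P t \<gamma> K\<close> is the law of a path on \<open>{t<..T}\<close> whose state at time \<open>t + 1\<close> is drawn
  from \<open>\<gamma>\<close> and whose continuation on \<open>{t + 1<..T}\<close> is drawn from \<open>K\<close> at that state.\<close>

definition prepend ::
  "('d::finite) problem \<Rightarrow> nat \<Rightarrow> 'd state measure \<Rightarrow> ('d state \<Rightarrow> ('d path \<times> 'd path) measure) \<Rightarrow>
     ('d path \<times> 'd path) measure" where
  "prepend P t \<gamma> K = bind \<gamma> (\<lambda>w. distr (K w) (borel_of (ZP P t (horizon P)))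
     (\<lambda>(xs, ys). (xs(Suc t := fst w), ys(Suc t := snd w))))"

text \<open>The concatenation \<open>\<pi>(dx\<^bsub>t+1:T\<^esub>, dy\<^bsub>t+1:T\<^esub> | z) = \<Prod>\<^bsub>s=t..T-1\<^esub> p s\<close> started in state \<open>z\<close> at
  time \<open>t\<close>; at \<open>t = T\<close> it is the point mass at the empty path.\<close>

function concat_kernels ::
  "('d::finite) problem \<Rightarrow> 'd kernels \<Rightarrow> nat \<Rightarrow> 'd state \<Rightarrow> ('d path \<times> 'd path) measure" where
  "concat_kernels P p t =
     (if t < horizon P
      then (\<lambda>z. prepend P t (p t z) (concat_kernels P p (Suc t)))
      else (\<lambda>z. return (borel_of (ZP P t t)) (\<lambda>_. undefined, \<lambda>_. undefined)))"
  by auto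
termination by (relation "Wellfounded.measure (\<lambda>(P, p, t). horizon P - t)") auto

declare concat_kernels.simps [simp del]

text \<open>The path law \<open>\<pi>\<^bsup>t,\<gamma>\<^esup>\<close>: first step \<open>\<gamma>\<close>, then the kernels \<open>p\<close>.\<close>

definition deviate ::
  "('d::finite) problem \<Rightarrow> 'd kernels \<Rightarrow> nat \<Rightarrow> 'd state measure \<Rightarrow> ('d path \<times> 'd path) measure" where
  "deviate P p t \<gamma> = prepend P t \<gamma> (concat_kernels P p (Suc t))"

definition marginal_at ::
  "('d::finite) problem \<Rightarrow> nat \<Rightarrow> ('d path \<times> 'd path) measure \<Rightarrow> 'd state measure" where
  "marginal_at P k Q = distr Q (borel_of (ZT P k)) (\<lambda>(xs, ys). (xs k, ys k))"

definition objective ::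
  "('d::finite) problem \<Rightarrow> nat \<Rightarrow> 'd state \<Rightarrow> ('d path \<times> 'd path) measure \<Rightarrow> ereal" where
  "objective P t z Q =
     ext_integral Q (\<lambda>(xs, ys). ereal (\<Sum>k=t+1..horizon P. cost P t k z (xs k, ys k))) +
     Gext P t z (ext_integral (marginal_at P (horizon P) Q) (\<lambda>w. ereal (hfun P w)))"

text \<open>\<open>Q\<close> is an equilibrium transport with successive Markovian kernels \<open>p\<close>.\<close>

definition equilibrium_transport ::
  "('d::finite) problem \<Rightarrow> 'd kernels \<Rightarrow> ('d path \<times> 'd path) measure \<Rightarrow> bool" where
  "equilibrium_transport P p Q \<longleftrightarrow>
     bicausal P (\<lambda>t xs. kmu P t (at_time (x0 P) xs t)) (\<lambda>t ys. knu P t (at_time (y0 P) ys t)) Q \<and>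
     (\<forall>t<horizon P.
        regular_cond_kernel Q (borel_of (ZP P 0 t)) (borel_of (ZT P (Suc t)))
          (\<lambda>(xs, ys). (restrict xs {0<..t}, restrict ys {0<..t}))
          (\<lambda>(xs, ys). (xs (Suc t), ys (Suc t)))
          (\<lambda>(xs, ys). p t (at_time (x0 P) xs t, at_time (y0 P) ys t))) \<and>
     (\<forall>t<horizon P. AE (xs, ys) in Q.
        (let z = (at_time (x0 P) xs t, at_time (y0 P) ys t) in
           (INF \<gamma>\<in>admissible P t z. objective P t z (deviate P p t \<gamma>)) =
           objective P t z (concat_kernels P p t z)))"

section \<open>The extended dynamic programming equation\<close>

definition g_fun :: "('d::finite) problem \<Rightarrow> 'd kernels \<Rightarrow> nat \<Rightarrow> 'd state \<Rightarrow> ereal" where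
  "g_fun P p t z =
     (if t = horizon P then ereal (hfun P z)
      else ext_integral (marginal_at P (horizon P) (concat_kernels P p t z))
             (\<lambda>w. ereal (hfun P w)))"

text \<open>\<open>b_fun P p k i v s z\<close> is \<open>b\<^sub>k(v, z)\<close> for a state \<open>v\<close> at time \<open>i\<close> and a state \<open>z\<close> at time
  \<open>s < k\<close>.\<close>

definition b_fun ::
  "('d::finite) problem \<Rightarrow> 'd kernels \<Rightarrow> nat \<Rightarrow> nat \<Rightarrow> 'd state \<Rightarrow> nat \<Rightarrow> 'd state \<Rightarrow> ereal" where
  "b_fun P p k i v s z =
     ext_integral (marginal_at P k (concat_kernels P p s z)) (\<lambda>w. ereal (cost P i k v w))"

text \<open>The bracket of the extended dynamic programming equation, \<open>V\<close> being the value function at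
  time \<open>t + 1\<close>.  Without integrability assumptions its separate integrals may combine to
  \<open>\<infinity> - \<infinity>\<close>; therefore the terms evaluated at \<open>(x\<^bsub>t+1\<^esub>, y\<^bsub>t+1\<^esub>)\<close> only are collected
  in one integral, with \<open>\<infinity> - \<infinity> = 0\<close> inside.  The lemma \<open>dp_bracket_separate\<close> below recovers
  the form with separate integrals whenever the collected terms are finite and integrable.\<close>

definition dp_bracket ::
  "('d::finite) problem \<Rightarrow> 'd kernels \<Rightarrow> ('d state \<Rightarrow> ereal) \<Rightarrow> nat \<Rightarrow> 'd state \<Rightarrow>
     'd state measure \<Rightarrow> ereal" where
  "dp_bracket P p V t z \<gamma> =
     ext_integral \<gamma> (\<lambda>w. ereal (cost P t (t+1) z w) +
       cancel_diff (V w)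
         (Gext P (t+1) w (g_fun P p (t+1) w) + (\<Sum>k=t+2..horizon P. b_fun P p k (t+1) w (t+1) w))) +
     Gext P t z (ext_integral \<gamma> (g_fun P p (t+1))) +
     ext_integral \<gamma> (\<lambda>w. \<Sum>k=t+2..horizon P. b_fun P p k t z (t+1) w)"

definition reduced_bracket ::
  "('d::finite) problem \<Rightarrow> 'd kernels \<Rightarrow> nat \<Rightarrow> 'd state \<Rightarrow> 'd state measure \<Rightarrow> ereal" where
  "reduced_bracket P p t z \<gamma> =
     ext_integral \<gamma> (\<lambda>w. ereal (cost P t (t+1) z w)) +
     Gext P t z (ext_integral \<gamma> (g_fun P p (t+1))) +
     ext_integral \<gamma> (\<lambda>w. \<Sum>k=t+2..horizon P. b_fun P p k t z (t+1) w)"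

lemma dp_bracket_separate:
  fixes P :: "('d::finite) problem"
  assumes c: "integrable \<gamma> (cost P t (t+1) z)"
    and V: "\<And>w. w \<in> space \<gamma> \<Longrightarrow> V w = ereal (v w)" "integrable \<gamma> v"
    and G: "\<And>w. w \<in> space \<gamma> \<Longrightarrow> Gext P (t+1) w (g_fun P p (t+1) w) = ereal (a w)"
      "integrable \<gamma> a"
    and b: "\<And>w. w \<in> space \<gamma> \<Longrightarrow>
        (\<Sum>k=t+2..horizon P. b_fun P p k (t+1) w (t+1) w) = ereal (s w)"
      "integrable \<gamma> s"
  shows "dp_bracket P p V t z \<gamma> =
      ext_integral \<gamma> (\<lambda>w. ereal (cost P t (t+1) z w) + V w)
      - ext_integral \<gamma> (\<lambda>w. Gext P (t+1) w (g_fun P p (t+1) w))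
      + Gext P t z (ext_integral \<gamma> (g_fun P p (t+1)))
      - ext_integral \<gamma> (\<lambda>w. \<Sum>k=t+2..horizon P. b_fun P p k (t+1) w (t+1) w)
      + ext_integral \<gamma> (\<lambda>w. \<Sum>k=t+2..horizon P. b_fun P p k t z (t+1) w)"
proof -
  let ?c = "cost P t (t+1) z"
  have 1: "ext_integral \<gamma> (\<lambda>w. ereal (?c w) + cancel_diff (V w)
         (Gext P (t+1) w (g_fun P p (t+1) w) + (\<Sum>k=t+2..horizon P. b_fun P p k (t+1) w (t+1) w)))
      = ereal ((\<integral>w. ?c w \<partial>\<gamma>) + (\<integral>w. v w \<partial>\<gamma>) - (\<integral>w. a w \<partial>\<gamma>) - (\<integral>w. s w \<partial>\<gamma>))"
  proof -
    have "ext_integral \<gamma> (\<lambda>w. ereal (?c w) + cancel_diff (V w)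
         (Gext P (t+1) w (g_fun P p (t+1) w) + (\<Sum>k=t+2..horizon P. b_fun P p k (t+1) w (t+1) w)))
      = ext_integral \<gamma> (\<lambda>w. ereal (?c w + v w - a w - s w))"
      by (rule ext_integral_cong)
        (simp only: V(1) G(1) b(1), simp add: cancel_diff_def algebra_simps)
    also have "\<dots> = ereal (\<integral>w. ?c w + v w - a w - s w \<partial>\<gamma>)"
      using c V(2) G(2) b(2) by (intro ext_integral_integrable) auto
    also have "(\<integral>w. ?c w + v w - a w - s w \<partial>\<gamma>)
        = (\<integral>w. ?c w \<partial>\<gamma>) + (\<integral>w. v w \<partial>\<gamma>) - (\<integral>w. a w \<partial>\<gamma>) - (\<integral>w. s w \<partial>\<gamma>)"
      using c V(2) G(2) b(2) by simp
    finally show ?thesis .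
  qed
  have "ext_integral \<gamma> (\<lambda>w. ereal (?c w) + V w) = ext_integral \<gamma> (\<lambda>w. ereal (?c w + v w))"
    by (rule ext_integral_cong) (simp add: V(1))
  also have "\<dots> = ereal ((\<integral>w. ?c w \<partial>\<gamma>) + (\<integral>w. v w \<partial>\<gamma>))"
    using c V(2) by (subst ext_integral_integrable) auto
  finally have 2: "ext_integral \<gamma> (\<lambda>w. ereal (?c w) + V w)
      = ereal ((\<integral>w. ?c w \<partial>\<gamma>) + (\<integral>w. v w \<partial>\<gamma>))" .
  have "ext_integral \<gamma> (\<lambda>w. Gext P (t+1) w (g_fun P p (t+1) w))
      = ext_integral \<gamma> (\<lambda>w. ereal (a w))"
    by (rule ext_integral_cong) (rule G(1))
  then have 3: "ext_integral \<gamma> (\<lambda>w. Gext P (t+1) w (g_fun P p (t+1) w)) = ereal (\<integral>w. a w \<partial>\<gamma>)"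
    by (simp only: ext_integral_integrable[OF G(2)])
  have "ext_integral \<gamma> (\<lambda>w. \<Sum>k=t+2..horizon P. b_fun P p k (t+1) w (t+1) w)
      = ext_integral \<gamma> (\<lambda>w. ereal (s w))"
    by (rule ext_integral_cong) (rule b(1))
  then have 4: "ext_integral \<gamma> (\<lambda>w. \<Sum>k=t+2..horizon P. b_fun P p k (t+1) w (t+1) w)
      = ereal (\<integral>w. s w \<partial>\<gamma>)"
    by (simp only: ext_integral_integrable[OF b(2)])
  have alg: "ereal (A - B - C) + Y + W = ereal A - ereal B + Y - ereal C + W"
    for A B C and Y W :: ereal
    by (cases Y; cases W) auto
  show ?thesis
    unfolding dp_bracket_def 1 2 3 4 by (rule alg)
qed

function dp_value :: "('d::finite) problem \<Rightarrow> 'd kernels \<Rightarrow> nat \<Rightarrow> 'd state \<Rightarrow> ereal" where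
  "dp_value P p t =
     (if t < horizon P
      then (\<lambda>z. INF \<gamma>\<in>admissible P t z. dp_bracket P p (dp_value P p (Suc t)) t z \<gamma>)
      else (\<lambda>z. ereal (Gfun P t z (hfun P z))))"
  by auto
termination by (relation "Wellfounded.measure (\<lambda>(P, p, t). horizon P - t)") auto

declare dp_value.simps [simp del]

definition reduced_value :: "('d::finite) problem \<Rightarrow> 'd kernels \<Rightarrow> nat \<Rightarrow> 'd state \<Rightarrow> ereal" where
  "reduced_value P p t z = (INF \<gamma>\<in>admissible P t z. reduced_bracket P p t z \<gamma>)"

text \<open>\<open>q\<close> is an optimizer at time \<open>t\<close>, the kernels \<open>p s\<close> being chosen at the times \<open>s > t\<close>.
  The values \<open>p s\<close> for \<open>s \<le> t\<close> are irrelevant.\<close>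

definition dp_optimizer ::
  "('d::finite) problem \<Rightarrow> 'd kernels \<Rightarrow> nat \<Rightarrow> ('d state \<Rightarrow> 'd state measure) \<Rightarrow> bool" where
  "dp_optimizer P p t q \<longleftrightarrow> (\<forall>z\<in>topspace (ZT P t).
     q z \<in> admissible P t z \<and>
     dp_bracket P p (dp_value P p (Suc t)) t z (q z) = dp_value P p t z)"

definition reduced_optimizer ::
  "('d::finite) problem \<Rightarrow> 'd kernels \<Rightarrow> nat \<Rightarrow> ('d state \<Rightarrow> 'd state measure) \<Rightarrow> bool" where
  "reduced_optimizer P p t q \<longleftrightarrow> (\<forall>z\<in>topspace (ZT P t).
     q z \<in> admissible P t z \<and>
     reduced_bracket P p t z (q z) = reduced_value P p t z)"

end

theory Submission
  imports Defs
begin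

text \<open>Since every \<open>\<X>\<^sub>t\<close> is finite, all couplings of \<open>\<mu>(\<cdot>|x)\<close> and \<open>\<nu>(\<cdot>|y)\<close> are dominated by a
multiple of the product of the counting measure and \<open>\<nu>(\<cdot>|y)\<close>. By a diagonal argument over a countable
generating algebra they are sequentially compact for setwise convergence, along which lower semicontinuous
integrands that are bounded from below satisfy a Fatou inequality; this gives minimizers. For a
measurable selection, near-minimizers are taken from a countable family of densities (normalized clipped
rational combinations of indicators), and a cluster point is formed measurably by taking
inferior limits of the values on one generating set after the other.

At an optimizer \<open>V\<^sub>t(x, y) = G(x, y, g\<^sub>t(x, y)) + (\<Sum>k. b\<^sub>k(x, y, x, y))\<close>, so the terms at \<open>t + 1\<close> in
(DP) cancel and leave (DP'). By Fubini the bracket in (DP') is the objective of the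
one-step deviation, hence the concatenation of the optimizers is an equilibrium.

For the topology, a Borel map into a second countable regular space becomes continuous after
refining a Polish topology so that countably many Borel sets become open.\<close>

section \<open>Polish topologies and their refinements\<close>

text \<open>The obstacle is a loss of regularity in the backward step: \<open>g_fun\<close> and
  \<open>b_fun\<close> integrate against kernels that were selected Borel measurably, so as
  functions of the next state they are only known to be Borel, and weak limits of couplings need not
  pass through such integrands. Setwise limits do, for every nonnegative Borel integrand; this is
  why domination, and not tightness, carries the compactness argument. Integrals may be infinite.
  All costs and h share one lower bound, so each extended integral is a nonnegative integral minus a
  constant. Minimization is carried out for nonnegative integrands; the constants are moved into G
  or added to the value, where they do not affect the minimizers. The marginal constraints are
  encoded as countably many prescribed masses. A limit measure is in turn identified by its masses
  on a countable generator, which is what makes its choice measurable. That the concatenated plan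
  has the marginals \<mu> and \<nu> follows from uniqueness of the law of a Markov chain with given
  kernels.\<close>

lemma second_countableI_subbase:
  assumes "countable S" "\<And>V. V \<in> S \<Longrightarrow> openin T V"
    and sub: "\<And>U x. openin T U \<Longrightarrow> x \<in> U \<Longrightarrow>
      \<exists>F. finite F \<and> F \<subseteq> S \<and> x \<in> \<Inter>F \<inter> topspace T \<and> \<Inter>F \<inter> topspace T \<subseteq> U"
  shows "second_countable T"
  unfolding second_countable_def
proof (intro exI conjI)
  \<comment> \<open>Cutting with the carrier makes the empty family contribute
    \<open>topspace T\<close> and not \<open>UNIV\<close>.\<close>
  let ?B = "(\<lambda>F. \<Inter>F \<inter> topspace T) ` {F. finite F \<and> F \<subseteq> S}"
  show "countable ?B"
    using assms(1) by (intro countable_image countable_Collect_finite_subset)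
  show "\<forall>V\<in>?B. openin T V"
  proof clarify
    fix F assume F: "finite F" "F \<subseteq> S"
    show "openin T (\<Inter>F \<inter> topspace T)"
    proof (cases "F = {}")
      case False
      then show ?thesis
        using F assms(2) by (intro openin_Int openin_Inter) auto
    qed simp
  qed
  show "\<forall>U x. openin T U \<and> x \<in> U \<longrightarrow> (\<exists>V\<in>?B. x \<in> V \<and> V \<subseteq> U)"
  proof clarify
    fix U x assume "openin T U" "x \<in> U"
    from sub[OF this] obtain F where "finite F" "F \<subseteq> S" "x \<in> \<Inter>F \<inter> topspace T"
      "\<Inter>F \<inter> topspace T \<subseteq> U"
      by blast
    then show "\<exists>V\<in>?B. x \<in> V \<and> V \<subseteq> U"
      by (intro bexI[of _ "\<Inter>F \<inter> topspace T"] imageI) auto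
  qed
qed

lemma separable_metrizable_imp_second_countable:
  assumes "metrizable_space X" "countable D" "D \<subseteq> topspace X" "X closure_of D = topspace X"
  shows "second_countable X"
proof -
  obtain M d where m: "Metric_space M d" and X: "X = Metric_space.mtopology M d"
    using assms(1) unfolding metrizable_space_def by blast
  interpret Metric_space M d by fact
  let ?B = "(\<lambda>(y, n). mball y (1 / real (Suc n))) ` (D \<times> UNIV)"
  show ?thesis
    unfolding second_countable_def
  proof (intro exI conjI)
    show "countable ?B"
      using assms(2) by auto
    show "\<forall>V\<in>?B. openin X V"
      using X by auto
    show "\<forall>U x. openin X U \<and> x \<in> U \<longrightarrow> (\<exists>V\<in>?B. x \<in> V \<and> V \<subseteq> U)"
    proof clarify
      fix U x assume U: "openin X U" "x \<in> U"
      then obtain r where r: "r > 0" "mball x r \<subseteq> U"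
        using X openin_mtopology by blast
      have xM: "x \<in> M"
        using U X openin_subset by fastforce
      \<comment> \<open>Half of the radius: a ball of this size about a point \<open>y\<close> near
        \<open>x\<close> contains \<open>x\<close> and still lies in the ball of radius
        \<open>r\<close> about \<open>x\<close>.\<close>
      obtain n where n: "1 / real (Suc n) < r / 2"
        using nat_approx_posE[of "r / 2"] r by (auto simp: field_simps)
      have "x \<in> X closure_of D"
        using xM X assms(4) by simp
      then have "\<forall>r>0. \<exists>y\<in>D. y \<in> mball x r"
        unfolding X metric_closure_of by blast
      then obtain y where y: "y \<in> D" "y \<in> mball x (1 / real (Suc n))"
        by (metis of_nat_0_less_iff zero_less_Suc zero_less_divide_1_iff)
      have "mball y (1 / real (Suc n)) \<subseteq> mball x r"
      proof
        fix w assume w: "w \<in> mball y (1 / real (Suc n))"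
        have "d x w \<le> d x y + d y w"
          using y w by (intro triangle) auto
        also have "\<dots> < r"
          using y w n by auto
        finally show "w \<in> mball x r"
          using y w by auto
      qed
      moreover have "x \<in> mball y (1 / real (Suc n))"
        using y by (auto simp: commute)
      ultimately show "\<exists>V\<in>?B. x \<in> V \<and> V \<subseteq> U"
        using r y(1) by (intro bexI[of _ "mball y (1 / real (Suc n))"]) (auto intro!: rev_image_eqI[of "(y, n)"])
    qed
  qed
qed

lemma polish_topology_iff:
  "polish_topology X \<longleftrightarrow> completely_metrizable_space X \<and> second_countable X"
proof
  assume "polish_topology X"
  then show "completely_metrizable_space X \<and> second_countable X"
    unfolding polish_topology_def
    using separable_metrizable_imp_second_countable completely_metrizable_imp_metrizable_space by blast
next
  assume *: "completely_metrizable_space X \<and> second_countable X"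
  then have "separable_space X"
    using second_countable_imp_separable_space by blast
  with * show "polish_topology X"
    unfolding polish_topology_def separable_space_def by simp
qed

lemma prod_topology_base:
  assumes A: "\<And>U x. openin X U \<Longrightarrow> x \<in> U \<Longrightarrow> \<exists>V\<in>A. x \<in> V \<and> V \<subseteq> U"
    and B: "\<And>U x. openin Y U \<Longrightarrow> x \<in> U \<Longrightarrow> \<exists>V\<in>B. x \<in> V \<and> V \<subseteq> U"
    and U: "openin (prod_topology X Y) U" "z \<in> U"
  shows "\<exists>V\<in>(\<lambda>(a, b). a \<times> b) ` (A \<times> B). z \<in> V \<and> V \<subseteq> U"
proof -
  obtain x y where z: "z = (x, y)"
    by (cases z)
  have "\<exists>V W. openin X V \<and> openin Y W \<and> x \<in> V \<and> y \<in> W \<and> V \<times> W \<subseteq> U"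
    using U z by (simp add: openin_prod_topology_alt)
  then obtain V W where VW: "openin X V" "openin Y W" "x \<in> V" "y \<in> W" "V \<times> W \<subseteq> U"
    by (elim exE conjE)
  obtain V' where V': "V' \<in> A" "x \<in> V'" "V' \<subseteq> V"
    using A[OF VW(1,3)] by auto
  obtain W' where W': "W' \<in> B" "y \<in> W'" "W' \<subseteq> W"
    using B[OF VW(2,4)] by auto
  show ?thesis
    using V' W' VW(5) z by (intro bexI[of _ "V' \<times> W'"] rev_image_eqI[of "(V', W')"]) auto
qed

lemma second_countable_prod_topology:
  assumes "second_countable X" "second_countable Y"
  shows "second_countable (prod_topology X Y)"
proof -
  obtain A where A: "countable A" "\<And>V. V\<in>A \<Longrightarrow> openin X V"
    "\<And>U x. openin X U \<Longrightarrow> x \<in> U \<Longrightarrow> \<exists>V\<in>A. x \<in> V \<and> V \<subseteq> U"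
    using assms(1) unfolding second_countable_def by auto
  obtain B where B: "countable B" "\<And>V. V\<in>B \<Longrightarrow> openin Y V"
    "\<And>U x. openin Y U \<Longrightarrow> x \<in> U \<Longrightarrow> \<exists>V\<in>B. x \<in> V \<and> V \<subseteq> U"
    using assms(2) unfolding second_countable_def by auto
  let ?C = "(\<lambda>(a, b). a \<times> b) ` (A \<times> B)"
  show ?thesis
    unfolding second_countable_def
  proof (intro exI conjI allI impI ballI)
    show "countable ?C"
      using A(1) B(1) by auto
    show "openin (prod_topology X Y) V" if "V \<in> ?C" for V
      using that A(2) B(2) by (auto simp: openin_prod_Times_iff)
    show "\<exists>V\<in>?C. z \<in> V \<and> V \<subseteq> U" if "openin (prod_topology X Y) U \<and> z \<in> U" for U z
      using that by (intro prod_topology_base[OF A(3) B(3)]) auto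
  qed
qed

lemma second_countable_product_topology:
  assumes "countable I" "\<And>i. i \<in> I \<Longrightarrow> second_countable (X i)"
  shows "second_countable (product_topology X I)"
proof -
  have "\<forall>i\<in>I. \<exists>B. countable B \<and> (\<forall>V\<in>B. openin (X i) V) \<and>
      (\<forall>U x. openin (X i) U \<and> x \<in> U \<longrightarrow> (\<exists>V\<in>B. x \<in> V \<and> V \<subseteq> U))"
    using assms(2) unfolding second_countable_def by blast
  then obtain B where B: "\<And>i. i \<in> I \<Longrightarrow> countable (B i)"
    "\<And>i V. i \<in> I \<Longrightarrow> V \<in> B i \<Longrightarrow> openin (X i) V"
    "\<And>i U x. i \<in> I \<Longrightarrow> openin (X i) U \<Longrightarrow> x \<in> U \<Longrightarrow> \<exists>V\<in>B i. x \<in> V \<and> V \<subseteq> U"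
    by metis
  let ?P = "product_topology X I"
  let ?c = "\<lambda>(i, V). {f \<in> topspace ?P. f i \<in> V}"
  let ?S = "?c ` (SIGMA i:I. B i)"
  show ?thesis
  proof (rule second_countableI_subbase)
    show "countable ?S"
      using assms(1) B(1) by auto
    show "openin ?P V" if "V \<in> ?S" for V
      using that B(2)
      by (auto simp del: topspace_product_topology intro!: openin_continuous_map_preimage[where Y="X _"])
  next
    fix U x assume U: "openin ?P U" "x \<in> U"
    obtain W where W: "x \<in> Pi\<^sub>E I W" "\<And>i. openin (X i) (W i)"
      "finite {i. W i \<noteq> topspace (X i)}" "Pi\<^sub>E I W \<subseteq> U"
      using product_topology_open_contains_basis[OF U] by blast
    have x: "x \<in> topspace ?P"
      using U openin_subset by blast
    \<comment> \<open>The finitely many coordinates that are really constrained; only these receive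
      a member of a countable base.\<close>
    define J where "J = {i\<in>I. W i \<noteq> topspace (X i)}"
    have "\<forall>i\<in>J. \<exists>V\<in>B i. x i \<in> V \<and> V \<subseteq> W i"
      using B(3) W unfolding J_def by (auto simp: PiE_iff)
    then obtain V where V: "\<And>i. i \<in> J \<Longrightarrow> V i \<in> B i \<and> x i \<in> V i \<and> V i \<subseteq> W i"
      by metis
    let ?F = "(\<lambda>i. ?c (i, V i)) ` J"
    have "finite J"
      unfolding J_def by (rule finite_subset[OF _ W(3)]) auto
    moreover have "?F \<subseteq> ?S"
      using V by (auto simp: J_def intro!: rev_image_eqI)
    moreover have "x \<in> \<Inter>?F \<inter> topspace ?P"
      using V x by auto
    moreover have "\<Inter>?F \<inter> topspace ?P \<subseteq> U"
    proof
      fix f assume f: "f \<in> \<Inter>?F \<inter> topspace ?P"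
      have "f \<in> Pi\<^sub>E I W"
      proof (rule PiE_I)
        fix i assume i: "i \<in> I"
        show "f i \<in> W i"
          using f V i by (cases "i \<in> J") (auto simp: J_def PiE_iff)
      qed (use f in \<open>auto simp: PiE_iff extensional_def\<close>)
      then show "f \<in> U"
        using W by blast
    qed
    ultimately show "\<exists>F. finite F \<and> F \<subseteq> ?S \<and> x \<in> \<Inter>F \<inter> topspace ?P \<and> \<Inter>F \<inter> topspace ?P \<subseteq> U"
      by (intro exI[of _ ?F]) simp
  qed
qed

lemma polish_prod_topology:
  "polish_topology X \<Longrightarrow> polish_topology Y \<Longrightarrow> polish_topology (prod_topology X Y)"
  by (simp add: polish_topology_iff completely_metrizable_space_prod_topology
      second_countable_prod_topology)

lemma polish_product_topology:
  "countable I \<Longrightarrow> (\<And>i. i \<in> I \<Longrightarrow> polish_topology (X i)) \<Longrightarrow> polish_topology (product_topology X I)"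
  unfolding polish_topology_iff completely_metrizable_space_product_topology
  by (intro conjI disjI2 ballI second_countable_product_topology countable_Collect) auto

lemma polish_euclidean: "polish_topology (euclidean :: 'a::{complete_space, second_countable_topology} topology)"
  unfolding polish_topology_iff second_countable_def
proof (intro conjI)
  obtain B :: "'a set set" where B: "countable B" "\<And>X. X \<in> B \<Longrightarrow> open X"
    "\<And>S. open S \<Longrightarrow> \<exists>U. U \<subseteq> B \<and> S = \<Union>U"
    by (metis univ_second_countable)
  have "\<exists>V\<in>B. x \<in> V \<and> V \<subseteq> U" if U: "open U" "x \<in> U" for U and x :: 'a
  proof -
    obtain F where "F \<subseteq> B" "U = \<Union>F"
      using B(3)[OF U(1)] by (elim exE conjE)
    then show ?thesis
      using U(2) by auto
  qed
  then show "\<exists>\<B>. countable \<B> \<and> (\<forall>V\<in>\<B>. openin (euclidean :: 'a topology) V) \<and>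
      (\<forall>U x. openin euclidean U \<and> x \<in> U \<longrightarrow> (\<exists>V\<in>\<B>. x \<in> V \<and> V \<subseteq> U))"
    using B(1,2) by (intro exI[of _ B] conjI allI impI ballI) auto
qed (simp add: completely_metrizable_space_euclidean)

section \<open>Refinements of a Polish topology\<close>

lemma finer_topology_trans:
  "finer_topology S R \<Longrightarrow> finer_topology R Q \<Longrightarrow> finer_topology S Q"
  by (simp add: finer_topology_def)

text \<open>Pulling the product topology back along x \<mapsto> (x, \<phi> x) turns the space into a
  copy of the graph of \<phi>. A closed subspace of a Polish product is Polish, and \<phi> becomes a
  projection, hence continuous. The refinements below come from choosing a \<phi> with closed graph
  whose continuity is the property wanted.\<close>

lemma polish_closed_graph_refinement:
  assumes S: "polish_topology S" and R: "polish_topology R"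
    and \<phi>: "\<phi> \<in> topspace S \<rightarrow> topspace R"
    and cl: "closedin (prod_topology S R) ((\<lambda>x. (x, \<phi> x)) ` topspace S)"
  obtains S' where "polish_topology S'" "finer_topology S' S" "continuous_map S' R \<phi>"
proof
  let ?P = "prod_topology S R"
  let ?j = "\<lambda>x. (x, \<phi> x)"
  let ?G = "?j ` topspace S"
  let ?S = "pullback_topology (topspace S) ?j ?P"
  have top: "topspace ?S = topspace S"
    using \<phi> by (auto simp: topspace_pullback_topology)
  have j: "continuous_map ?S ?P ?j"
    using continuous_map_pullback[OF continuous_map_id, of "topspace S" ?j ?P] by (simp add: comp_def)
  have hm: "homeomorphic_maps (subtopology ?P ?G) ?S fst ?j"
    unfolding homeomorphic_maps_def
  proof (intro conjI)
    show "continuous_map (subtopology ?P ?G) ?S fst"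
    proof (rule continuous_map_pullback')
      have "continuous_map (subtopology ?P ?G) ?P id"
        by (rule continuous_map_from_subtopology) simp
      then show "continuous_map (subtopology ?P ?G) ?P (?j \<circ> fst)"
        by (rule continuous_map_eq) auto
    qed auto
    show "continuous_map ?S (subtopology ?P ?G) ?j"
      using j top by (auto simp: continuous_map_in_subtopology)
  qed auto
  then have r: "retraction_map (subtopology ?P ?G) ?S fst"
    by (metis homeomorphic_map_maps section_and_retraction_eq_homeomorphic_map)
  have P: "polish_topology ?P"
    using S R by (rule polish_prod_topology)
  then have "completely_metrizable_space (subtopology ?P ?G)" "second_countable (subtopology ?P ?G)"
    using cl by (auto simp: polish_topology_iff completely_metrizable_space_closedin second_countable_subtopology)
  then show "polish_topology ?S"
    unfolding polish_topology_iff
    using completely_metrizable_space_retraction_map_image[OF r] second_countable_retraction_map_image[OF r]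
    by blast
  show "finer_topology ?S S"
    unfolding finer_topology_def
  proof (intro conjI allI impI)
    fix U assume "openin S U"
    then have "openin ?P (U \<times> topspace R)" "U \<subseteq> topspace S"
      by (auto simp: openin_prod_Times_iff openin_subset)
    moreover have "U = ?j -` (U \<times> topspace R) \<inter> topspace S"
      using \<phi> calculation(2) by auto
    ultimately show "openin ?S U"
      unfolding openin_pullback_topology by blast
  qed (rule top)
  show "continuous_map ?S R \<phi>"
    using continuous_map_compose[OF j continuous_map_snd] by (simp add: comp_def)
qed

lemma finer_topology_continuous_map:
  "finer_topology S R \<Longrightarrow> continuous_map R Q f \<Longrightarrow> continuous_map S Q f"
  by (auto simp: finer_topology_def continuous_map_def)

lemma continuous_map_id_imp_finer:
  "continuous_map S R (\<lambda>x. x) \<Longrightarrow> topspace S = topspace R \<Longrightarrow> finer_topology S R"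
  unfolding finer_topology_def continuous_map_def
  by (metis (no_types, lifting) Collect_cong Collect_mem_eq openin_subset subsetD)

text \<open>The diagonal of the product of the refinements is closed.\<close>

lemma polish_join:
  assumes S: "polish_topology S" and T: "\<And>n::nat. polish_topology (T n)" "\<And>n. finer_topology (T n) S"
  obtains S' where "polish_topology S'" "finer_topology S' S" "\<And>n. finer_topology S' (T n)"
proof -
  let ?R = "product_topology T UNIV"
  let ?P = "prod_topology S ?R"
  let ?\<phi> = "\<lambda>x (n::nat). x"
  have top: "topspace (T n) = topspace S" for n
    using T(2) by (simp add: finer_topology_def)
  have R: "polish_topology ?R"
    using T(1) by (intro polish_product_topology) auto
  have haus: "Hausdorff_space S"
    using S by (simp add: polish_topology_iff completely_metrizable_imp_metrizable_space metrizable_imp_Hausdorff_space)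
  have cl: "closedin ?P {z \<in> topspace ?P. fst z = snd z n}" for n
  proof -
    have id: "continuous_map (T n) S (\<lambda>x. x)"
      using T(2)[of n] by (intro finer_topology_continuous_map[of "T n" S]) auto
    have "continuous_map ?P (T n) (\<lambda>z. snd z n)"
      using continuous_map_compose[OF continuous_map_snd continuous_map_product_projection[of n UNIV T], of S]
      by (simp add: comp_def)
    then have "continuous_map ?P S (\<lambda>z. snd z n)"
      using continuous_map_compose[OF _ id] by (fastforce simp: comp_def)
    then show ?thesis
      using continuous_map_fst by (intro closedin_continuous_maps_eq[OF haus]) auto
  qed
  have "closedin ?P (\<Inter>n. {z \<in> topspace ?P. fst z = snd z n})"
    using cl by (intro closedin_Inter) auto
  also have "(\<Inter>n. {z \<in> topspace ?P. fst z = snd z n}) = (\<lambda>x. (x, ?\<phi> x)) ` topspace S"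
    by (auto simp: top image_iff fun_eq_iff)
  finally have cl: "closedin ?P ((\<lambda>x. (x, ?\<phi> x)) ` topspace S)" .
  have \<phi>: "?\<phi> \<in> topspace S \<rightarrow> topspace ?R"
    by (auto simp: top)
  from cl obtain S' where S': "polish_topology S'" "finer_topology S' S" "continuous_map S' ?R ?\<phi>"
    by (rule polish_closed_graph_refinement[OF S R \<phi>])
  show thesis
  proof (rule that[OF S'(1,2)])
    fix n
    have "continuous_map S' (T n) (\<lambda>x. x)"
      using continuous_map_compose[OF S'(3) continuous_map_product_projection[of n UNIV T]]
      by (simp add: comp_def)
    then show "finer_topology S' (T n)"
      using S'(2) top by (intro continuous_map_id_imp_finer) (auto simp: finer_topology_def)
  qed
qed

text \<open>An open set of a metrizable space is an increasing union of closed sets; Urysohn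
  functions that are 1 on the n-th closed set and 0 off \<open>U\<close> approximate the indicator.
  They serve twice: to build a function that is positive exactly on \<open>U\<close>, and to recover
  masses of open sets from integrals of continuous functions.\<close>

lemma open_set_indicator_limit:
  assumes X: "metrizable_space X" and U: "openin X U"
  shows "\<exists>f :: nat \<Rightarrow> 'a \<Rightarrow> real. (\<forall>n. continuous_map X euclideanreal (f n)) \<and>
    (\<forall>n. \<forall>x\<in>topspace X. 0 \<le> f n x \<and> f n x \<le> 1) \<and> (\<forall>n. \<forall>x\<in>topspace X - U. f n x = 0) \<and>
    (\<forall>x\<in>U. \<forall>\<^sub>F n in sequentially. f n x = 1)"
proof -
  obtain C where C: "\<And>n. closedin X (C n)" "\<And>n. C n \<subseteq> C (Suc n)" "\<Union>(range C) = U"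
    using open_imp_fsigma_in[OF X U] unfolding fsigma_in_ascending by blast
  have "\<exists>f. continuous_map X (top_of_set {0..1::real}) f \<and> f ` (topspace X - U) \<subseteq> {0} \<and> f ` (C n) \<subseteq> {1}" for n
  proof -
    have "disjnt (topspace X - U) (C n)"
      using C(3) by (auto simp: disjnt_def)
    then show ?thesis
      using Urysohn_lemma[OF metrizable_imp_normal_space[OF X], of "topspace X - U" "C n" 0 1]
        C(1) U by (metis closedin_def Diff_Diff_Int openin_subset Diff_subset inf.absorb_iff2 zero_le_one)
  qed
  then obtain f where f: "\<And>n. continuous_map X (top_of_set {0..1::real}) (f n)"
    "\<And>n. f n ` (topspace X - U) \<subseteq> {0}" "\<And>n. f n ` (C n) \<subseteq> {1}"
    by metis
  show ?thesis
  proof (intro exI[of _ f] conjI allI ballI)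
    show "continuous_map X euclideanreal (f n)" for n
      using f(1) continuous_map_into_fulltopology by blast
    show "0 \<le> f n x" "f n x \<le> 1" if "x \<in> topspace X" for n x
      using f(1)[of n] that unfolding continuous_map_def by (auto simp: Pi_iff)
    show "f n x = 0" if "x \<in> topspace X - U" for n x
      using f(2) that by blast
    show "\<forall>\<^sub>F n in sequentially. f n x = 1" if x: "x \<in> U" for x
    proof -
      obtain N where "x \<in> C N"
        using x C(3) by blast
      then have "x \<in> C n" if "N \<le> n" for n
        using lift_Suc_mono_le[of C, OF C(2) that] by blast
      then have "f n x = 1" if "N \<le> n" for n
        using f(3)[of n] that by blast
      then show ?thesis
        unfolding eventually_sequentially by blast
    qed
  qed
qed

text \<open>With \<open>F\<close> positive exactly on \<open>U\<close>, the function \<open>1 / F\<close> on \<open>U\<close>, continued by \<open>- 1\<close>, has a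
  closed graph.\<close>

lemma polish_make_open_clopen:
  assumes S: "polish_topology S" and U: "openin S U"
  obtains S' where "polish_topology S'" "finer_topology S' S" "closedin S' U"
proof -
  have met: "metrizable_space S"
    using S by (simp add: polish_topology_iff completely_metrizable_imp_metrizable_space)
  obtain f :: "nat \<Rightarrow> 'a \<Rightarrow> real" where "(\<forall>n. continuous_map S euclideanreal (f n)) \<and>
    (\<forall>n. \<forall>x\<in>topspace S. 0 \<le> f n x \<and> f n x \<le> 1) \<and> (\<forall>n. \<forall>x\<in>topspace S - U. f n x = 0) \<and>
    (\<forall>x\<in>U. \<forall>\<^sub>F n in sequentially. f n x = 1)"
    using open_set_indicator_limit[OF met U] by (elim exE)
  then have f: "\<And>n. continuous_map S euclideanreal (f n)"
    "\<And>n x. x \<in> topspace S \<Longrightarrow> 0 \<le> f n x \<and> f n x \<le> 1"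
    "\<And>n x. x \<in> topspace S - U \<Longrightarrow> f n x = 0"
    "\<And>x. x \<in> U \<Longrightarrow> \<forall>\<^sub>F n in sequentially. f n x = 1"
    by simp_all
  \<comment> \<open>The weights 2^-n make the series converge uniformly, hence \<open>F\<close> is
    continuous. It vanishes off \<open>U\<close>, and on \<open>U\<close> it is positive because
    some summand is.\<close>
  define F where "F x = (\<Sum>n. f n x * (1/2) ^ n)" for x
  have Usub: "U \<subseteq> topspace S"
    using U openin_subset by blast
  have summ: "summable (\<lambda>n. f n x * (1/2) ^ n)" if "x \<in> topspace S" for x
  proof (rule summable_comparison_test'[where N=0])
    show "summable (\<lambda>n. (1/2 :: real) ^ n)"
      by (rule summable_geometric) simp
    show "norm (f n x * (1/2) ^ n) \<le> (1/2) ^ n" for n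
      using f(2)[OF that, of n] by (simp add: abs_mult mult_left_le_one_le)
  qed
  have unif: "uniform_limit (topspace S) (\<lambda>n x. \<Sum>i<n. f i x * (1/2) ^ i) F sequentially"
    unfolding F_def
  proof (rule Weierstrass_m_test[where M="\<lambda>n. (1/2) ^ n"])
    show "norm (f n x * (1/2) ^ n) \<le> (1/2) ^ n" if "x \<in> topspace S" for n x
      using f(2)[OF that, of n] by (simp add: abs_mult mult_left_le_one_le)
    show "summable (\<lambda>n. (1/2 :: real) ^ n)"
      by (rule summable_geometric) simp
  qed
  have contF: "continuous_map S euclideanreal F"
  proof -
    have "continuous_map S Met_TC.mtopology F"
    proof (rule Met_TC.continuous_map_uniform_limit)
      show "\<forall>\<^sub>F n in sequentially. continuous_map S Met_TC.mtopology (\<lambda>x. \<Sum>i<n. f i x * (1/2) ^ i)"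
        using f(1) by (intro always_eventually allI)
          (simp, intro continuous_map_sum continuous_map_real_mult, auto)
      show "\<forall>\<^sub>F n in sequentially. \<forall>x\<in>topspace S. F x \<in> UNIV \<and> dist (\<Sum>i<n. f i x * (1/2) ^ i) (F x) < e"
        if "0 < e" for e
        using unif that unfolding uniform_limit_iff by simp
    qed simp
    then show ?thesis
      by simp
  qed
  have F0: "F x = 0" if "x \<in> topspace S - U" for x
    using f(3)[OF that] by (simp add: F_def)
  have Fpos: "F x > 0" if xU: "x \<in> U" for x
  proof -
    obtain n where n: "f n x = 1"
      using f(4)[OF xU] unfolding eventually_sequentially by blast
    have xt: "x \<in> topspace S"
      using xU Usub by blast
    show ?thesis
      unfolding F_def
    proof (rule suminf_pos2[OF summ[OF xt]])
      show "0 \<le> f i x * (1/2) ^ i" for i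
        using f(2)[OF xt] by simp
      show "0 < f n x * (1/2) ^ n"
        using n by simp
    qed
  qed
  define \<phi> where "\<phi> x = (if x \<in> U then 1 / F x else - 1)" for x
  let ?P = "prod_topology S euclideanreal"
  \<comment> \<open>The right-hand side uses closed conditions only. On \<open>U\<close>, where
    \<open>F\<close> is positive, r = -1 would make r * F x negative, so the last alternative forces
    r * F x = 1. Off \<open>U\<close>, where \<open>F\<close> is 0, only r = -1 is left.\<close>
  have "(\<lambda>x. (x, \<phi> x)) ` topspace S =
      {z \<in> topspace ?P. snd z * F (fst z) \<in> {0, 1} \<and> snd z \<ge> - 1 \<and> (snd z \<le> -1 \<or> F (fst z) * snd z \<ge> 1)}"
    (is "?G = ?C")
  proof
    show "?G \<subseteq> ?C"
    proof clarify
      fix x assume x: "x \<in> topspace S"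
      show "(x, \<phi> x) \<in> topspace ?P \<and> snd (x, \<phi> x) * F (fst (x, \<phi> x)) \<in> {0, 1} \<and> - 1 \<le> snd (x, \<phi> x) \<and>
          (snd (x, \<phi> x) \<le> - 1 \<or> 1 \<le> F (fst (x, \<phi> x)) * snd (x, \<phi> x))"
      proof (cases "x \<in> U")
        case True
        have "0 \<le> 1 / F x"
          using Fpos[OF True] by simp
        then have "- 1 \<le> 1 / F x"
          by linarith
        then show ?thesis
          using x True Fpos[OF True] by (simp add: \<phi>_def)
      qed (use x F0 in \<open>simp add: \<phi>_def\<close>)
    qed
    show "?C \<subseteq> ?G"
    proof clarify
      fix x and r :: real
      assume *: "(x, r) \<in> topspace ?P" "snd (x, r) * F (fst (x, r)) \<in> {0, 1}" "- 1 \<le> snd (x, r)"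
        "snd (x, r) \<le> - 1 \<or> 1 \<le> F (fst (x, r)) * snd (x, r)"
      have "r = \<phi> x"
      proof (cases "x \<in> U")
        case True
        then have "r * F x = 1"
          using * Fpos[OF True] by (auto simp: mult.commute)
        then show ?thesis
          using True Fpos[OF True] by (simp add: \<phi>_def field_simps)
      next
        case False
        then show ?thesis
          using * F0 by (auto simp: \<phi>_def)
      qed
      then show "(x, r) \<in> ?G"
        using * by auto
    qed
  qed
  moreover have "closedin ?P ?C"
  proof -
    have s: "continuous_map ?P euclideanreal snd"
      by (rule continuous_map_snd)
    have Ff: "continuous_map ?P euclideanreal (\<lambda>z. F (fst z))"
      using continuous_map_compose[OF continuous_map_fst contF] by (simp add: comp_def)
    have 1: "closedin ?P {z \<in> topspace ?P. snd z * F (fst z) \<in> {0, 1}}"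
      by (rule closedin_continuous_map_preimage[OF continuous_map_real_mult[OF s Ff]]) auto
    have 2: "closedin ?P {z \<in> topspace ?P. snd z \<in> {-1..}}"
      by (rule closedin_continuous_map_preimage[OF s]) auto
    have 3: "closedin ?P {z \<in> topspace ?P. snd z \<in> {..-1}}"
      by (rule closedin_continuous_map_preimage[OF s]) auto
    have 4: "closedin ?P {z \<in> topspace ?P. F (fst z) * snd z \<in> {1..}}"
      by (rule closedin_continuous_map_preimage[OF continuous_map_real_mult[OF Ff s]]) auto
    have "?C = {z \<in> topspace ?P. snd z * F (fst z) \<in> {0, 1}} \<inter> {z \<in> topspace ?P. snd z \<in> {-1..}}
        \<inter> ({z \<in> topspace ?P. snd z \<in> {..-1}} \<union> {z \<in> topspace ?P. F (fst z) * snd z \<in> {1..}})"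
      by auto
    then show ?thesis
      using 1 2 3 4 by (simp only: closedin_Int closedin_Un)
  qed
  ultimately have cl: "closedin ?P ?G"
    by simp
  have "\<phi> \<in> topspace S \<rightarrow> topspace euclideanreal"
    by simp
  then obtain S' where S': "polish_topology S'" "finer_topology S' S" "continuous_map S' euclideanreal \<phi>"
    by (rule polish_closed_graph_refinement[OF S polish_euclidean _ cl])
  \<comment> \<open>\<phi> is positive on \<open>U\<close> and -1 elsewhere, so \<open>U\<close> is
    the preimage of a closed half-line under a map that is now continuous.\<close>
  have "closedin S' {x \<in> topspace S'. \<phi> x \<in> {0..}}"
    by (rule closedin_continuous_map_preimage[OF S'(3)]) simp
  also have "{x \<in> topspace S'. \<phi> x \<in> {0..}} = U"
    using Usub S'(2) Fpos by (auto simp: \<phi>_def finer_topology_def less_imp_le)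
  finally show thesis
    using that S' by blast
qed

text \<open>The sets that become clopen in some finer Polish topology form a sigma-algebra
  containing the open sets. Carrying closedness along with openness is what makes the complement
  case go through.\<close>

lemma polish_make_borel_open:
  assumes S: "polish_topology S" and B: "B \<in> sets (borel_of S)"
  obtains S' where "polish_topology S'" "finer_topology S' S" "openin S' B"
proof -
  have "B \<in> sigma_sets (topspace S) {U. openin S U}"
    using B unfolding borel_of_def by (subst (asm) sets_measure_of) (auto dest: openin_subset)
  then have "\<exists>S'. polish_topology S' \<and> finer_topology S' S \<and> openin S' B \<and> closedin S' B"
  proof induction
    case (Basic U)
    then have U: "openin S U"
      by simp
    then obtain S' where "polish_topology S'" "finer_topology S' S" "closedin S' U"
      by (rule polish_make_open_clopen[OF S])
    then show ?case
      using U by (auto simp: finer_topology_def)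
  next
    case Empty
    then show ?case
      using S by (auto simp: finer_topology_def)
  next
    case (Compl A)
    then obtain S' where "polish_topology S'" "finer_topology S' S" "openin S' A" "closedin S' A"
      by blast
    moreover from this have "topspace S = topspace S'"
      by (simp add: finer_topology_def)
    ultimately show ?case
      by (metis closedin_def openin_closedin_eq openin_diff openin_topspace closedin_diff closedin_topspace)
  next
    case (Union A)
    then obtain T where T: "\<And>n. polish_topology (T n)" "\<And>n. finer_topology (T n) S"
      "\<And>n. openin (T n) (A n)"
      by metis
    then obtain S' where S': "polish_topology S'" "finer_topology S' S" "\<And>n. finer_topology S' (T n)"
      using polish_join[OF S, of T] by metis
    have op: "openin S' (\<Union>n. A n)"
      using S'(3) T(3) by (intro openin_Union) (auto simp: finer_topology_def)
    \<comment> \<open>The join of the countably many refinements makes the union open but perhaps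
      not closed, hence one more refinement.\<close>
    then obtain S'' where "polish_topology S''" "finer_topology S'' S'" "closedin S'' (\<Union>n. A n)"
      by (rule polish_make_open_clopen[OF S'(1)])
    then show ?case
      using op S'(2) finer_topology_trans by (metis finer_topology_def)
  qed
  then show thesis
    using that by blast
qed

lemma polish_make_borel_family_open:
  assumes S: "polish_topology S" and A: "countable A" "A \<subseteq> sets (borel_of S)"
  obtains S' where "polish_topology S'" "finer_topology S' S" "\<And>B. B \<in> A \<Longrightarrow> openin S' B"
proof (cases "A = {}")
  case True
  then show thesis
    using that[of S] S by (auto simp: finer_topology_def)
next
  case False
  let ?B = "from_nat_into A"
  have "\<exists>T. polish_topology T \<and> finer_topology T S \<and> openin T (?B n)" for n
    using polish_make_borel_open[OF S, of "?B n"] A from_nat_into[OF False, of n] by (metis subsetD)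
  then obtain T where T: "\<And>n. polish_topology (T n)" "\<And>n. finer_topology (T n) S"
      "\<And>n. openin (T n) (?B n)"
    by metis
  then obtain S' where S': "polish_topology S'" "finer_topology S' S" "\<And>n. finer_topology S' (T n)"
    using polish_join[OF S, of T] by metis
  show thesis
  proof (rule that[OF S'(1,2)])
    fix B assume "B \<in> A"
    then obtain n where "B = ?B n"
      using from_nat_into_surj[OF A(1)] by metis
    then show "openin S' B"
      using S'(3)[of n] T(3)[of n] by (simp add: finer_topology_def)
  qed
qed

section \<open>Borel structures and the weak topology\<close>

lemma space_borel_of [simp]: "space (borel_of S) = topspace S"
  unfolding borel_of_def by (rule space_measure_of) (auto dest: openin_subset)

lemma sets_borel_of: "sets (borel_of S) = sigma_sets (topspace S) {U. openin S U}"
  unfolding borel_of_def by (rule sets_measure_of) (auto dest: openin_subset)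

lemma openin_imp_borel: "openin S U \<Longrightarrow> U \<in> sets (borel_of S)"
  by (simp add: sets_borel_of sigma_sets.Basic)

lemma continuous_map_imp_measurable:
  assumes f: "continuous_map S R f"
  shows "f \<in> borel_of S \<rightarrow>\<^sub>M borel_of R"
proof (rule measurable_sigma_sets[OF sets_borel_of])
  show "f \<in> space (borel_of S) \<rightarrow> topspace R"
    using f by (auto simp: continuous_map_def)
  show "f -` U \<inter> space (borel_of S) \<in> sets (borel_of S)" if "U \<in> {U. openin R U}" for U
  proof -
    have "f -` U \<inter> space (borel_of S) = {x \<in> topspace S. f x \<in> U}"
      by auto
    then show ?thesis
      using that f by (auto simp: continuous_map_def intro!: openin_imp_borel)
  qed
qed (auto dest: openin_subset)

lemma sets_borel_of_euclidean: "sets (borel_of euclidean) = sets borel"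
  by (simp add: sets_borel_of borel_def)

lemma continuous_map_real_measurable:
  "continuous_map S euclideanreal f \<Longrightarrow> f \<in> borel_measurable (borel_of S)"
  using continuous_map_imp_measurable[of S euclideanreal f]
  by (simp add: measurable_cong_sets[OF refl sets_borel_of_euclidean])

lemma lsc_on_imp_measurable:
  fixes f :: "'a \<Rightarrow> 'b::{linorder_topology, second_countable_topology}"
  assumes "lsc_on S f"
  shows "f \<in> borel_measurable (borel_of S)"
  using assms by (intro borel_measurableI_greater) (auto simp: lsc_on_def intro: openin_imp_borel)

lemma second_countable_union_of:
  assumes "countable B" "\<And>U x. openin X U \<Longrightarrow> x \<in> U \<Longrightarrow> \<exists>V\<in>B. x \<in> V \<and> V \<subseteq> U" "openin X U"
  shows "countable {V \<in> B. V \<subseteq> U}" "U = \<Union>{V \<in> B. V \<subseteq> U}"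
proof -
  show "countable {V \<in> B. V \<subseteq> U}"
    by (rule countable_subset[OF _ assms(1)]) auto
  show "U = \<Union>{V \<in> B. V \<subseteq> U}"
  proof
    show "U \<subseteq> \<Union>{V \<in> B. V \<subseteq> U}"
      using assms(2)[OF assms(3)] by auto
  qed auto
qed

lemma sets_borel_of_base:
  assumes B: "countable B" "\<And>V. V \<in> B \<Longrightarrow> openin X V"
    "\<And>U x. openin X U \<Longrightarrow> x \<in> U \<Longrightarrow> \<exists>V\<in>B. x \<in> V \<and> V \<subseteq> U"
  shows "sets (borel_of X) = sigma_sets (topspace X) B"
proof
  have sub: "B \<subseteq> Pow (topspace X)"
    using B(2) openin_subset by blast
  interpret sigma_algebra "topspace X" "sigma_sets (topspace X) B"
    by (rule sigma_algebra_sigma_sets) (rule sub)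
  show "sets (borel_of X) \<subseteq> sigma_sets (topspace X) B"
    unfolding sets_borel_of
  proof (rule sigma_sets_subset, safe)
    fix U assume U: "openin X U"
    have "\<Union>{V \<in> B. V \<subseteq> U} \<in> sigma_sets (topspace X) B"
      using second_countable_union_of(1)[OF B(1,3) U] by (intro countable_Union) (auto intro: sigma_sets.Basic)
    then show "U \<in> sigma_sets (topspace X) B"
      using second_countable_union_of(2)[OF B(1,3) U] by simp
  qed
  show "sigma_sets (topspace X) B \<subseteq> sets (borel_of X)"
    using B(2) unfolding sets_borel_of by (intro sigma_sets_mono) (auto intro: sigma_sets.Basic)
qed

text \<open>Second countability gives the nontrivial inclusion: an open set of the product is a
  countable union of open rectangles from the two bases.\<close>

lemma sets_borel_of_prod:
  assumes "second_countable X" "second_countable Y"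
  shows "sets (borel_of (prod_topology X Y)) = sets (borel_of X \<Otimes>\<^sub>M borel_of Y)"
proof
  obtain A where A: "countable A" "\<And>V. V\<in>A \<Longrightarrow> openin X V"
    "\<And>U x. openin X U \<Longrightarrow> x \<in> U \<Longrightarrow> \<exists>V\<in>A. x \<in> V \<and> V \<subseteq> U"
    using assms(1) unfolding second_countable_def by auto
  obtain B where B: "countable B" "\<And>V. V\<in>B \<Longrightarrow> openin Y V"
    "\<And>U x. openin Y U \<Longrightarrow> x \<in> U \<Longrightarrow> \<exists>V\<in>B. x \<in> V \<and> V \<subseteq> U"
    using assms(2) unfolding second_countable_def by auto
  let ?C = "(\<lambda>(a, b). a \<times> b) ` (A \<times> B)"
  let ?P = "prod_topology X Y"
  have base: "\<exists>V\<in>?C. z \<in> V \<and> V \<subseteq> U" if "openin ?P U" "z \<in> U" for U z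
    by (rule prod_topology_base[OF A(3) B(3) that])
  have cC: "countable ?C"
    using A(1) B(1) by auto
  have op: "openin ?P V" if "V \<in> ?C" for V
    using that A(2) B(2) by (auto simp: openin_prod_Times_iff)
  show "sets (borel_of ?P) \<subseteq> sets (borel_of X \<Otimes>\<^sub>M borel_of Y)"
  proof -
    have "?C \<subseteq> sets (borel_of X \<Otimes>\<^sub>M borel_of Y)"
      using A(2) B(2) by (auto intro!: pair_measureI openin_imp_borel)
    from sets.sigma_sets_subset[OF this] show ?thesis
      by (simp add: sets_borel_of_base[OF cC op base] space_pair_measure)
  qed
  have "(\<lambda>z. z) \<in> borel_of ?P \<rightarrow>\<^sub>M borel_of X \<Otimes>\<^sub>M borel_of Y"
    using continuous_map_imp_measurable[OF continuous_map_fst, of X Y]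
      continuous_map_imp_measurable[OF continuous_map_snd, of X Y]
    by (intro measurable_pair) (simp_all add: comp_def)
  then show "sets (borel_of X \<Otimes>\<^sub>M borel_of Y) \<subseteq> sets (borel_of ?P)"
  proof safe
    fix C assume id: "(\<lambda>z. z) \<in> borel_of ?P \<rightarrow>\<^sub>M borel_of X \<Otimes>\<^sub>M borel_of Y"
      and C: "C \<in> sets (borel_of X \<Otimes>\<^sub>M borel_of Y)"
    have "C \<subseteq> space (borel_of ?P)"
      using sets.sets_into_space[OF C] by (simp add: space_pair_measure)
    then show "C \<in> sets (borel_of ?P)"
      using measurable_sets[OF id C] by (simp add: Int_absorb2)
  qed
qed

text \<open>Finite intersections of a countable base. Such a system can be enumerated, so that
  equality of measures and measurability of kernels are decided by a sequence of masses.\<close>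

lemma borel_of_countable_pi_system:
  assumes "second_countable X"
  obtains E where "countable E" "Int_stable E" "topspace X \<in> E" "\<And>U. U \<in> E \<Longrightarrow> openin X U"
    "sets (borel_of X) = sigma_sets (topspace X) E"
proof -
  obtain B where B: "countable B" "\<And>V. V\<in>B \<Longrightarrow> openin X V"
    "\<And>U x. openin X U \<Longrightarrow> x \<in> U \<Longrightarrow> \<exists>V\<in>B. x \<in> V \<and> V \<subseteq> U"
    using assms unfolding second_countable_def by auto
  define E where "E = (\<lambda>F. \<Inter>F \<inter> topspace X) ` {F. finite F \<and> F \<subseteq> B}"
  have op: "openin X U" if UE: "U \<in> E" for U
  proof -
    obtain F where F: "finite F" "F \<subseteq> B" "U = \<Inter>F \<inter> topspace X"
      using UE unfolding E_def by auto
    show ?thesis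
    proof (cases "F = {}")
      case False
      then have "openin X (\<Inter>F)"
        using F(1,2) B(2) by (intro openin_Inter) auto
      then show ?thesis
        unfolding F(3) by (intro openin_Int) auto
    qed (simp add: F(3))
  qed
  show thesis
  proof (rule that)
    show cE: "countable E"
      unfolding E_def using B(1) by (intro countable_image countable_Collect_finite_subset)
    show "Int_stable E"
    proof (rule Int_stableI)
      fix a b assume "a \<in> E" "b \<in> E"
      then obtain F G where "finite F" "F \<subseteq> B" "a = \<Inter>F \<inter> topspace X" "finite G" "G \<subseteq> B" "b = \<Inter>G \<inter> topspace X"
        unfolding E_def by (elim imageE CollectE conjE)
      then show "a \<inter> b \<in> E"
        unfolding E_def by (intro rev_image_eqI[of "F \<union> G"]) auto
    qed
    show "topspace X \<in> E"
      unfolding E_def by (intro rev_image_eqI[of "{}"]) auto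
    show "openin X U" if "U \<in> E" for U
      using op that .
    show "sets (borel_of X) = sigma_sets (topspace X) E"
    proof (rule sets_borel_of_base[OF cE op])
      fix U x assume U: "openin X U" "x \<in> U"
      then obtain V where V: "V \<in> B" "x \<in> V" "V \<subseteq> U"
        using B(3)[OF U] by auto
      moreover have "V \<in> E"
        unfolding E_def using V(1) openin_subset[OF B(2)[OF V(1)]] by (intro rev_image_eqI[of "{V}"]) auto
      ultimately show "\<exists>V\<in>E. x \<in> V \<and> V \<subseteq> U"
        by blast
    qed
  qed
qed

lemma probs_eq_space_prob_algebra: "probs S = space (prob_algebra (borel_of S))"
  by (auto simp: probs_def space_prob_algebra)

section \<open>Lower semicontinuous functions and integrals\<close>

lemma lsc_on_rationals:
  fixes f :: "'a \<Rightarrow> real"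
  assumes "\<And>r. r \<in> \<rat> \<Longrightarrow> openin S {x \<in> topspace S. r < f x}"
  shows "lsc_on S f"
  unfolding lsc_on_def
proof
  fix a
  have "{x \<in> topspace S. a < f x} = (\<Union>r\<in>{r\<in>\<rat>. a \<le> r}. {x \<in> topspace S. r < f x})"
    by (auto dest: Rats_dense_in_real less_imp_le)
  then show "openin S {x \<in> topspace S. a < f x}"
    using assms by auto
qed

lemma lsc_on_add:
  fixes f g :: "'a \<Rightarrow> real"
  assumes "lsc_on S f" "lsc_on S g"
  shows "lsc_on S (\<lambda>x. f x + g x)"
  unfolding lsc_on_def
proof
  fix a
  have "{x \<in> topspace S. a < f x + g x} =
      (\<Union>r. {x \<in> topspace S. r < f x} \<inter> {x \<in> topspace S. a - r < g x})" (is "?L = ?R")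
  proof
    show "?L \<subseteq> ?R"
    proof
      fix x assume x: "x \<in> ?L"
      then have "a - g x < f x"
        by auto
      then obtain r where "a - g x < r" "r < f x"
        using dense by blast
      then show "x \<in> ?R"
        using x by (auto intro!: exI[of _ r])
    qed
  qed auto
  then show "openin S {x \<in> topspace S. a < f x + g x}"
    using assms by (auto simp: lsc_on_def intro!: openin_Union openin_Int)
qed

lemma lsc_on_const: "lsc_on S (\<lambda>x. c)"
proof -
  have "{x \<in> topspace S. a < c} = (if a < c then topspace S else {})" for a
    by simp
  then show ?thesis
    unfolding lsc_on_def by simp
qed

lemma lsc_on_sum:
  fixes f :: "'i \<Rightarrow> 'a \<Rightarrow> real"
  assumes "\<And>i. i \<in> I \<Longrightarrow> lsc_on S (f i)"
  shows "lsc_on S (\<lambda>x. \<Sum>i\<in>I. f i x)"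
  using assms by (induction I rule: infinite_finite_induct) (auto intro: lsc_on_const lsc_on_add)

lemma lsc_on_cmult:
  fixes f :: "'a \<Rightarrow> real"
  assumes "c > 0" "lsc_on S f"
  shows "lsc_on S (\<lambda>x. c * f x)"
proof -
  have "{x \<in> topspace S. a < c * f x} = {x \<in> topspace S. a / c < f x}" for a
    using assms(1) by (auto simp: field_simps)
  then show ?thesis
    using assms(2) by (simp add: lsc_on_def)
qed

lemma continuous_map_real_lsc:
  fixes f :: "'a \<Rightarrow> real"
  assumes "lsc_on S f" "lsc_on S (\<lambda>x. - f x)"
  shows "continuous_map S euclideanreal f"
proof -
  have "openin S {x \<in> topspace S. a < f x}" "openin S {x \<in> topspace S. f x < a}" for a
    using assms(1) assms(2)[unfolded lsc_on_def, rule_format, of "- a"] by (auto simp: lsc_on_def)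
  then show ?thesis
    by (auto simp: continuous_map_upper_lower_semicontinuous_lt)
qed

text \<open>The integral of a bounded continuous function is a limit, from below, of combinations with
  positive coefficients of the masses of its superlevel sets.\<close>

lemma lsc_integral:
  fixes f :: "'a \<Rightarrow> real"
  assumes q: "\<And>w. w \<in> topspace W \<Longrightarrow> q w \<in> probs R"
    and lsc: "\<And>U. openin R U \<Longrightarrow> lsc_on W (\<lambda>w. measure (q w) U)"
    and f: "continuous_map R euclideanreal f" "bounded (f ` topspace R)"
  shows "lsc_on W (\<lambda>w. \<integral>x. f x \<partial>q w)"
proof -
  obtain K :: nat where K: "\<And>x. x \<in> topspace R \<Longrightarrow> \<bar>f x\<bar> < real K"
  proof -
    obtain b where b: "\<And>x. x \<in> topspace R \<Longrightarrow> \<bar>f x\<bar> \<le> b"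
      using f(2) unfolding bounded_iff by auto
    obtain K where "b < real K"
      using reals_Archimedean2 by blast
    with b that show thesis
      by (meson le_less_trans)
  qed
  \<comment> \<open>Superlevel sets at levels of spacing 1/(n+1) starting above -K. The staircase
    \<open>s n\<close> counts the levels below f x, so it lies below \<open>f\<close> by at most one
    spacing.\<close>
  define U where "U n k = {x \<in> topspace R. real k / real (Suc n) - real K < f x}" for n k :: nat
  define s where "s n x = (1 / real (Suc n)) * (\<Sum>k\<in>{1..2 * K * Suc n}. indicator (U n k) x) + (- real K)"
    for n x
  have opU: "openin R (U n k)" for n k
  proof -
    have "U n k = {x \<in> topspace R. f x \<in> {real k / real (Suc n) - real K<..}}"
      by (auto simp: U_def)
    then show ?thesis
      using openin_continuous_map_preimage[OF f(1), of "{real k / real (Suc n) - real K<..}"] by simp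
  qed
  have s_bounds: "s n x \<le> f x \<and> f x \<le> s n x + 1 / real (Suc n)" if x: "x \<in> topspace R" for n x
  proof -
    define c where "c = real (Suc n) * (f x + real K)"
    have c: "0 < c" "c < real (2 * K * Suc n)"
    proof -
      have "0 < f x + real K" "f x + real K < 2 * real K"
        using K[OF x] by auto
      then have "real (Suc n) * 0 < real (Suc n) * (f x + real K)"
        "real (Suc n) * (f x + real K) < real (Suc n) * (2 * real K)"
        by (intro mult_strict_left_mono; simp)+
      then show "0 < c" "c < real (2 * K * Suc n)"
        by (simp_all add: c_def algebra_simps)
    qed
    have mem: "x \<in> U n k \<longleftrightarrow> real k < c" for k
    proof -
      have "x \<in> U n k \<longleftrightarrow> real k / real (Suc n) < f x + real K"
        using x by (auto simp: U_def)
      also have "\<dots> \<longleftrightarrow> real k < c"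
        unfolding c_def by (subst pos_divide_less_eq) (simp_all add: mult.commute)
      finally show ?thesis .
    qed
    \<comment> \<open>The levels are exceeded strictly, so the number of k \<ge> 1 with k < c is the
      ceiling minus 1, which differs from the floor when c is an integer.\<close>
    define m where "m = nat (\<lceil>c\<rceil> - 1)"
    have m: "c - 1 \<le> real m" "real m < c" 
      using c(1) unfolding m_def by linarith+
    have km: "real k < c \<longleftrightarrow> k \<le> m" for k
      using c(1) unfolding m_def by linarith
    have "(\<Sum>k\<in>{1..2 * K * Suc n}. indicator (U n k) x) = real (card {k \<in> {1..2 * K * Suc n}. x \<in> U n k})"
      by (simp add: indicator_def sum.If_cases Int_def)
    also have "{k \<in> {1..2 * K * Suc n}. x \<in> U n k} = {1..m}"
    proof -
      have "real m < real (2 * K * Suc n)"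
        using m(2) c(2) by (rule less_trans)
      then have "m < 2 * K * Suc n"
        unfolding of_nat_less_iff .
      then show ?thesis
        unfolding mem km by auto
    qed
    finally have sum: "(\<Sum>k\<in>{1..2 * K * Suc n}. indicator (U n k) x) = real m"
      by simp
    have eq: "real m = real (Suc n) * (s n x + real K)"
      unfolding s_def sum by simp
    have "real (Suc n) * (s n x + real K) \<le> real (Suc n) * (f x + real K)"
      using m(2) unfolding eq c_def by linarith
    then have 1: "s n x + real K \<le> f x + real K"
      by (subst (asm) mult_le_cancel_left_pos) auto
    have "real (Suc n) * (f x + real K) \<le> real (Suc n) * (s n x + real K + 1 / real (Suc n))"
      using m(1) unfolding eq c_def by (simp add: distrib_left)
    then have 2: "f x + real K \<le> s n x + real K + 1 / real (Suc n)"
      by (subst (asm) mult_le_cancel_left_pos) auto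
    show ?thesis
      using 1 2 by simp
  qed
  have meas: "U n k \<in> sets (q w)" if "w \<in> topspace W" for n k w
    using q[OF that] opU by (auto simp: probs_def openin_imp_borel)
  have space: "space (q w) = topspace R" if "w \<in> topspace W" for w
    using q[OF that] sets_eq_imp_space_eq[of "q w" "borel_of R"] by (auto simp: probs_def)
  have int_s: "integrable (q w) (s n)"
    and s_eq: "(\<integral>x. s n x \<partial>q w) = (1 / real (Suc n)) * (\<Sum>k\<in>{1..2 * K * Suc n}. measure (q w) (U n k)) + (- real K)"
    if w: "w \<in> topspace W" for w n
  proof -
    interpret prob_space "q w"
      using q[OF w] by (simp add: probs_def)
    have i: "integrable (q w) (indicator (U n k) :: _ \<Rightarrow> real)" for k
      using meas[OF w] by (simp add: fmeasurableI integrable_indicator_iff emeasure_eq_measure)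
    have i2: "integrable (q w) (\<lambda>x. \<Sum>k\<in>{1..2 * K * Suc n}. indicator (U n k) x :: real)"
      using i by (intro Bochner_Integration.integrable_sum)
    then show "integrable (q w) (s n)"
      unfolding s_def by (intro Bochner_Integration.integrable_add integrable_mult_right) auto
    show "(\<integral>x. s n x \<partial>q w) = (1 / real (Suc n)) * (\<Sum>k\<in>{1..2 * K * Suc n}. measure (q w) (U n k)) + (- real K)"
      unfolding s_def using i i2 meas[OF w] by (subst Bochner_Integration.integral_add)
        (auto simp: Bochner_Integration.integral_sum prob_space intro!: arg_cong2[where f="(*)"] sum.cong)
  qed
  have int_f: "integrable (q w) f" if w: "w \<in> topspace W" for w
  proof -
    interpret prob_space "q w"
      using q[OF w] by (simp add: probs_def)
    have "f \<in> borel_measurable (q w)"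
      using q[OF w] continuous_map_real_measurable[OF f(1)]
      by (simp add: probs_def cong: measurable_cong_sets)
    then show ?thesis
      using K space[OF w] by (intro integrable_const_bound[where B="real K"]) (auto intro: less_imp_le)
  qed
  have le: "(\<integral>x. s n x \<partial>q w) \<le> (\<integral>x. f x \<partial>q w)"
    and ge: "(\<integral>x. f x \<partial>q w) \<le> (\<integral>x. s n x \<partial>q w) + 1 / real (Suc n)" if w: "w \<in> topspace W" for w n
  proof -
    interpret prob_space "q w"
      using q[OF w] by (simp add: probs_def)
    show "(\<integral>x. s n x \<partial>q w) \<le> (\<integral>x. f x \<partial>q w)"
      using s_bounds space[OF w] by (intro integral_mono int_s int_f w) auto
    have "(\<integral>x. f x \<partial>q w) \<le> (\<integral>x. s n x + 1 / real (Suc n) \<partial>q w)"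
      using s_bounds space[OF w] by (intro integral_mono int_s int_f w Bochner_Integration.integrable_add) auto
    then show "(\<integral>x. f x \<partial>q w) \<le> (\<integral>x. s n x \<partial>q w) + 1 / real (Suc n)"
      using int_s[OF w, of n] by (simp add: prob_space)
  qed
  \<comment> \<open>The staircase integrals approach the integral of \<open>f\<close> from below, so
    its superlevel set is a union of superlevel sets of positive finite combinations of open-set
    masses.\<close>
  have "{w \<in> topspace W. a < (\<integral>x. f x \<partial>q w)} = (\<Union>n. {w \<in> topspace W. a <
      (1 / real (Suc n)) * (\<Sum>k\<in>{1..2 * K * Suc n}. measure (q w) (U n k)) + (- real K)})" (is "?L = ?R") for a
  proof
    show "?L \<subseteq> ?R"
    proof clarify
      fix w assume w: "w \<in> topspace W" "a < (\<integral>x. f x \<partial>q w)"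
      obtain n where "1 / real (Suc n) < (\<integral>x. f x \<partial>q w) - a"
        using nat_approx_posE[of "(\<integral>x. f x \<partial>q w) - a"] w(2) by auto
      then have "a < (\<integral>x. s n x \<partial>q w)"
        using ge[OF w(1), of n] by linarith
      then show "w \<in> ?R"
        using w(1) unfolding s_eq[OF w(1)] by blast
    qed
    show "?R \<subseteq> ?L"
      using le s_eq by (fastforce intro: less_le_trans)
  qed
  moreover have "openin W {w \<in> topspace W. a <
      (1 / real (Suc n)) * (\<Sum>k\<in>{1..2 * K * Suc n}. measure (q w) (U n k)) + (- real K)}" for a n
  proof -
    have "lsc_on W (\<lambda>w. (1 / real (Suc n)) * (\<Sum>k\<in>{1..2 * K * Suc n}. measure (q w) (U n k)) + (- real K))"
      by (intro lsc_on_add lsc_on_cmult lsc_on_sum lsc_on_const lsc opU) simp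
    then show ?thesis
      by (simp only: lsc_on_def)
  qed
  ultimately show ?thesis
    unfolding lsc_on_def by (auto intro: openin_Union)
qed

section \<open>The weak topology on probability measures\<close>

lemma topspace_weak_topology [simp]: "topspace (weak_topology R) = probs R"
proof -
  have "probs R \<in> {{M \<in> probs R. (\<integral>x. f x \<partial>M) \<in> U} | f U.
        continuous_map R euclideanreal f \<and> bounded (f ` topspace R) \<and> open U}"
    by (intro CollectI exI[of _ "\<lambda>x. 0"] exI[of _ UNIV]) (auto intro: boundedI[of _ 0])
  then show ?thesis
    unfolding weak_topology_def topology_generated_by_topspace
    by (intro equalityI Union_upper Union_least) auto
qed

lemma openin_weak_topology:
  assumes "continuous_map R euclideanreal f" "bounded (f ` topspace R)" "open U"
  shows "openin (weak_topology R) {M \<in> probs R. (\<integral>x. f x \<partial>M) \<in> U}"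
  unfolding weak_topology_def using assms by (intro topology_generated_by_Basis) blast

text \<open>One direction of the portmanteau theorem: the semicontinuity of integrals, applied to f
  and to -f, gives continuity of all the integrals that generate the weak topology.\<close>

lemma continuous_map_weak_topology:
  assumes q: "\<And>w. w \<in> topspace W \<Longrightarrow> q w \<in> probs R"
    and lsc: "\<And>U. openin R U \<Longrightarrow> lsc_on W (\<lambda>w. measure (q w) U)"
  shows "continuous_map W (weak_topology R) q"
  unfolding weak_topology_def
proof (rule continuous_on_generated_topo)
  show "q ` topspace W \<subseteq> \<Union> {{M \<in> probs R. (\<integral>x. f x \<partial>M) \<in> U} | f U.
        continuous_map R euclideanreal f \<and> bounded (f ` topspace R) \<and> open U}"
    using q topspace_weak_topology[of R] unfolding weak_topology_def topology_generated_by_topspace by auto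
  fix V assume "V \<in> {{M \<in> probs R. (\<integral>x. f x \<partial>M) \<in> U} | f U.
        continuous_map R euclideanreal f \<and> bounded (f ` topspace R) \<and> open U}"
  then obtain f U where f: "continuous_map R euclideanreal f" "bounded (f ` topspace R)" "open U"
    and V: "V = {M \<in> probs R. (\<integral>x. f x \<partial>M) \<in> U}"
    by blast
  have "lsc_on W (\<lambda>w. \<integral>x. f x \<partial>q w)"
    by (rule lsc_integral[OF q lsc f(1,2)])
  moreover have "lsc_on W (\<lambda>w. \<integral>x. - f x \<partial>q w)"
    using f by (intro lsc_integral[OF q lsc]) (auto intro: continuous_map_minus simp: image_image[symmetric])
  ultimately have "continuous_map W euclideanreal (\<lambda>w. \<integral>x. f x \<partial>q w)"
    by (intro continuous_map_real_lsc) auto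
  then have "openin W {w \<in> topspace W. (\<integral>x. f x \<partial>q w) \<in> U}"
    using f(3) by (intro openin_continuous_map_preimage[where Y=euclideanreal]) auto
  also have "{w \<in> topspace W. (\<integral>x. f x \<partial>q w) \<in> U} = q -` V \<inter> topspace W"
    using q V by auto
  finally show "openin W (q -` V \<inter> topspace W)" .
qed

text \<open>Single members of a base may have much smaller mass than \<open>U\<close>, but finite
  unions of them exhaust \<open>U\<close> increasingly, and measures are continuous from below. Thus
  one countable family tests all open sets and all probability measures at once.\<close>

lemma open_base_closed_under_unions:
  assumes "second_countable R"
  shows "\<exists>E. countable E \<and> (\<forall>V\<in>E. openin R V) \<and>
    (\<forall>M\<in>probs R. \<forall>U a. openin R U \<longrightarrow> a < measure M U \<longrightarrow> (\<exists>V\<in>E. V \<subseteq> U \<and> a < measure M V))"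
proof -
  obtain B where B: "countable B" "\<And>V. V\<in>B \<Longrightarrow> openin R V"
    "\<And>U x. openin R U \<Longrightarrow> x \<in> U \<Longrightarrow> \<exists>V\<in>B. x \<in> V \<and> V \<subseteq> U"
    using assms unfolding second_countable_def by auto
  let ?E = "Union ` {F. finite F \<and> F \<subseteq> B}"
  have op: "openin R V" if "V \<in> ?E" for V
    using that B(2) by auto
  show ?thesis
  proof (intro exI[of _ ?E] conjI ballI allI impI)
    show "countable ?E"
      using B(1) by (intro countable_image countable_Collect_finite_subset)
    show "openin R V" if "V \<in> ?E" for V
      using op that .
    fix M U and a :: real assume M: "M \<in> probs R" and U: "openin R U" and a: "a < measure M U"
    interpret prob_space M
      using M by (simp add: probs_def)
    show "\<exists>V\<in>?E. V \<subseteq> U \<and> a < measure M V"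
    proof (cases "{V \<in> B. V \<subseteq> U} = {}")
      case True
      then have "U = {}"
        using B(3)[OF U] by auto
      then show ?thesis
        using a by (intro bexI[of _ "{}"]) (auto intro!: rev_image_eqI[of "{}"])
    next
      case False
      define C where "C = from_nat_into {V \<in> B. V \<subseteq> U}"
      have rC: "range C = {V \<in> B. V \<subseteq> U}"
        unfolding C_def using False B(1) by (intro range_from_nat_into) (auto intro: countable_subset)
      define D where "D n = (\<Union>i\<le>n. C i)" for n :: nat
      have D: "D n \<in> ?E" "D n \<subseteq> U" for n
      proof -
        have "C i \<in> B" "C i \<subseteq> U" for i
          using rC by auto
        then show "D n \<in> ?E" "D n \<subseteq> U"
          by (auto simp: D_def intro!: rev_image_eqI[of "C ` {..n}"])
      qed
      have "(\<Union>n. D n) = U"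
      proof
        show "(\<Union>n. D n) \<subseteq> U"
          using D by blast
        show "U \<subseteq> (\<Union>n. D n)"
        proof
          fix x assume "x \<in> U"
          then obtain V where V: "V \<in> B" "x \<in> V" "V \<subseteq> U"
            using B(3)[OF U] by auto
          then have "V \<in> range C"
            unfolding rC by simp
          then obtain i where "x \<in> C i"
            using V(2) by auto
          then show "x \<in> (\<Union>n. D n)"
            by (auto simp: D_def)
        qed
      qed
      moreover have "(\<lambda>n. measure M (D n)) \<longlonglongrightarrow> measure M (\<Union>n. D n)"
      proof (rule finite_Lim_measure_incseq)
        have "D n \<in> sets (borel_of R)" for n
          by (rule openin_imp_borel[OF op[OF D(1)]])
        then show "range D \<subseteq> sets M"
          using M by (auto simp: probs_def)
        show "incseq D"
          by (force simp: D_def incseq_def)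
      qed
      ultimately have "\<forall>\<^sub>F n in sequentially. a < measure M (D n)"
        using a order_tendstoD(1) by fastforce
      then obtain n where n: "a < measure M (D n)"
        by (auto simp: eventually_sequentially)
      show ?thesis
        by (rule bexI[OF _ D(1)[of n]]) (use D(2) n in simp)
    qed
  qed
qed

text \<open>Each strict lower bound for the mass of an open set is witnessed by a member of
  \<open>E\<close>, and rational thresholds suffice. With countable \<open>E\<close>, only countably
  many sets have to be made open.\<close>

lemma lsc_measure_from_base:
  assumes q: "\<And>w. w \<in> topspace W \<Longrightarrow> q w \<in> probs R"
    and E: "\<forall>V\<in>E. openin R V"
    "\<forall>M\<in>probs R. \<forall>U a. openin R U \<longrightarrow> a < measure M U \<longrightarrow> (\<exists>V\<in>E. V \<subseteq> U \<and> a < measure M V)"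
    and op: "\<And>V r. V \<in> E \<Longrightarrow> r \<in> \<rat> \<Longrightarrow> openin W {w \<in> topspace W. r < measure (q w) V}"
    and U: "openin R U"
  shows "lsc_on W (\<lambda>w. measure (q w) U)"
proof (rule lsc_on_rationals)
  fix r :: real assume r: "r \<in> \<rat>"
  have "{w \<in> topspace W. r < measure (q w) U} =
      (\<Union>V\<in>{V \<in> E. V \<subseteq> U}. {w \<in> topspace W. r < measure (q w) V})" (is "?L = ?R")
  proof
    show "?L \<subseteq> ?R"
      using E(2) q U by (auto simp: Bex_def)
    show "?R \<subseteq> ?L"
    proof clarify
      fix V w assume *: "V \<in> E" "V \<subseteq> U" "w \<in> topspace W" "r < measure (q w) V"
      interpret prob_space "q w"
        using q[OF *(3)] by (simp add: probs_def)
      have "measure (q w) V \<le> measure (q w) U"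
        using q[OF *(3)] U *(2) by (intro finite_measure_mono) (auto simp: probs_def openin_imp_borel)
      with *(4) show "r < measure (q w) U"
        by simp
    qed
  qed
  then show "openin W {w \<in> topspace W. r < measure (q w) U}"
    using op r by auto
qed

text \<open>The weak topology is generated by an uncountable family, so measurability cannot be
  checked on generators of the topology one by one. Instead the domain receives the topology
  \<open>W\<close> generated by countably many measurable sets; its open sets are countable unions
  of finite intersections, hence measurable, and \<open>q\<close> is continuous with respect to
  \<open>W\<close>.\<close>

lemma measurable_weak_topology:
  assumes R: "second_countable R" and q: "q \<in> M \<rightarrow>\<^sub>M prob_algebra (borel_of R)"
  shows "q \<in> M \<rightarrow>\<^sub>M borel_of (weak_topology R)"
proof -
  obtain E where E: "countable E" "\<forall>V\<in>E. openin R V"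
    "\<forall>M\<in>probs R. \<forall>U a. openin R U \<longrightarrow> a < measure M U \<longrightarrow> (\<exists>V\<in>E. V \<subseteq> U \<and> a < measure M V)"
    using open_base_closed_under_unions[OF R] by (elim exE conjE)
  have qp: "q w \<in> probs R" if "w \<in> space M" for w
    using measurable_space[OF q that] by (simp add: probs_eq_space_prob_algebra)
  \<comment> \<open>Adding \<open>space M\<close> makes it the carrier of the generated
    topology.\<close>
  define S where "S = insert (space M) ((\<lambda>(V, r). {w \<in> space M. r < measure (q w) V}) ` (E \<times> \<rat>))"
  have S_sets: "S \<subseteq> sets M"
    using E(2) q by (auto simp: S_def intro!: borel_measurable_less measurable_compose[OF q measurable_measure_prob_algebra]
        openin_imp_borel)
  have S_count: "countable S"
    unfolding S_def using E(1) countable_rat by auto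
  define W where "W = topology_generated_by S"
  have top: "topspace W = space M"
    unfolding W_def topology_generated_by_topspace using S_sets sets.sets_into_space
    by (fastforce simp: S_def)
  have W_sets: "U \<in> sets M" if "openin W U" for U
  proof -
    \<comment> \<open>A countable base that is stable under intersection. The induction over
      generated open sets then only has to show that each is a union of members of \<open>C\<close>,
      and such a union is countable.\<close>
    define C where "C = insert {} ((\<lambda>F. \<Inter>F) ` {F. finite F \<and> F \<subseteq> S \<and> F \<noteq> {}})"
    have cC: "countable C"
      unfolding C_def by (intro countable_insert countable_image
          countable_subset[OF _ countable_Collect_finite_subset[OF S_count]]) auto
    have "\<Inter>F \<in> sets M" if "finite F" "F \<subseteq> S" "F \<noteq> {}" for F
      using sets.finite_INT[of F "\<lambda>x. x" M] that S_sets by auto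
    then have C_sets: "C \<subseteq> sets M"
      by (auto simp: C_def)
    have C_Int: "x \<inter> y \<in> C" if "x \<in> C" "y \<in> C" for x y
    proof (cases "x = {} \<or> y = {}")
      case False
      have "\<exists>F. finite F \<and> F \<subseteq> S \<and> F \<noteq> {} \<and> x = \<Inter>F" "\<exists>F. finite F \<and> F \<subseteq> S \<and> y = \<Inter>F"
        using that False unfolding C_def by auto
      then obtain F G where "finite F" "F \<subseteq> S" "F \<noteq> {}" "x = \<Inter>F" "finite G" "G \<subseteq> S" "y = \<Inter>G"
        by (elim exE conjE)
      then have "x \<inter> y = \<Inter>(F \<union> G)" "finite (F \<union> G)" "F \<union> G \<subseteq> S" "F \<union> G \<noteq> {}"
        by auto
      then show ?thesis
        unfolding C_def by blast
    qed (auto simp: C_def)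
    have "generate_topology_on S U"
      using that by (simp add: W_def openin_topology_generated_by_iff)
    then have "\<exists>D. D \<subseteq> C \<and> U = \<Union>D"
    proof induction
      case Empty
      show ?case
        by (intro exI[of _ "{}"]) auto
    next
      case (Int a b)
      obtain D where D: "D \<subseteq> C" "a = \<Union>D"
        using Int.IH(1) by (elim exE conjE)
      obtain D' where D': "D' \<subseteq> C" "b = \<Union>D'"
        using Int.IH(2) by (elim exE conjE)
      have "(\<lambda>(x, y). x \<inter> y) ` (D \<times> D') \<subseteq> C"
        using D(1) D'(1) by (auto intro: C_Int)
      moreover have "a \<inter> b = \<Union>((\<lambda>(x, y). x \<inter> y) ` (D \<times> D'))"
        unfolding D(2) D'(2) by auto
      ultimately show ?case
        by (intro exI conjI)
    next
      case (UN K)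
      have "\<forall>k\<in>K. \<exists>D. D \<subseteq> C \<and> k = \<Union>D"
        by (intro ballI UN.IH)
      from bchoice[OF this] obtain D where D: "\<forall>k\<in>K. D k \<subseteq> C \<and> k = \<Union>(D k)"
        by (elim exE)
      have "\<Union>K = \<Union>(\<Union>(D ` K))"
        using D by blast
      moreover have "\<Union>(D ` K) \<subseteq> C"
        using D by (intro UN_least) simp
      ultimately show ?case
        by (intro exI conjI)
    next
      case (Basis s)
      then have "{s} \<subseteq> C"
        by (auto simp: C_def intro!: rev_image_eqI[of "{s}"])
      then show ?case
        by (intro exI[of _ "{s}"]) auto
    qed
    then obtain D where "D \<subseteq> C" "U = \<Union>D"
      by (elim exE conjE)
    then show ?thesis
      using C_sets countable_subset[OF _ cC, of D] by (auto intro!: sets.countable_Union)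
  qed
  have "continuous_map W (weak_topology R) q"
  proof (rule continuous_map_weak_topology)
    show "q w \<in> probs R" if "w \<in> topspace W" for w
      using qp that top by simp
    show "lsc_on W (\<lambda>w. measure (q w) U)" if "openin R U" for U
    proof (rule lsc_measure_from_base[OF _ E(2,3) _ that])
      show "q w \<in> probs R" if "w \<in> topspace W" for w
        using qp that top by simp
      show "openin W {w \<in> topspace W. r < measure (q w) V}" if "V \<in> E" "r \<in> \<rat>" for V r
        unfolding top unfolding W_def using that
        by (intro topology_generated_by_Basis) (auto simp: S_def)
    qed
  qed
  then have "openin W {w \<in> space M. q w \<in> U}" if "openin (weak_topology R) U" for U
    using that top by (auto simp: continuous_map_def)
  then have "q -` U \<inter> space M \<in> sets M" if "openin (weak_topology R) U" for U
    using W_sets[OF \<open>openin (weak_topology R) U \<Longrightarrow> openin W {w \<in> space M. q w \<in> U}\<close>[OF that]]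
    by (simp add: vimage_def Int_def conj_commute)
  moreover have "{U. openin (weak_topology R) U} \<subseteq> Pow (topspace (weak_topology R))"
    using openin_subset by blast
  ultimately show ?thesis
    using qp by (intro measurable_sigma_sets[OF sets_borel_of]) auto
qed

text \<open>The mass of an open set is a pointwise limit of integrals of bounded continuous
  functions, and these integrals are measurable in the parameter because they are continuous for the
  weak topology. Open sets form a generating pi-system.\<close>

lemma measurable_weak_topologyD:
  assumes R: "metrizable_space R" and q: "q \<in> M \<rightarrow>\<^sub>M borel_of (weak_topology R)"
  shows "q \<in> M \<rightarrow>\<^sub>M prob_algebra (borel_of R)"
proof (rule measurable_prob_algebra_generated[OF sets_borel_of])
  show "Int_stable {U. openin R U}" "{U. openin R U} \<subseteq> Pow (topspace R)"
    by (auto simp: Int_stable_def dest: openin_subset)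
  have qp: "q w \<in> probs R" if "w \<in> space M" for w
    using measurable_space[OF q that] by simp
  then show p: "prob_space (q w)" and qs: "sets (q w) = sets (borel_of R)" if "w \<in> space M" for w
    using that by (auto simp: probs_def)
  fix U assume "U \<in> {U. openin R U}"
  then have U: "openin R U" by simp
  obtain f :: "nat \<Rightarrow> 'a \<Rightarrow> real" where "(\<forall>n. continuous_map R euclideanreal (f n)) \<and>
    (\<forall>n. \<forall>x\<in>topspace R. 0 \<le> f n x \<and> f n x \<le> 1) \<and> (\<forall>n. \<forall>x\<in>topspace R - U. f n x = 0) \<and>
    (\<forall>x\<in>U. \<forall>\<^sub>F n in sequentially. f n x = 1)"
    using open_set_indicator_limit[OF R U] by (elim exE)
  then have f: "\<And>n. continuous_map R euclideanreal (f n)"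
    "\<And>n x. x \<in> topspace R \<Longrightarrow> 0 \<le> f n x \<and> f n x \<le> 1"
    "\<And>n x. x \<in> topspace R - U \<Longrightarrow> f n x = 0"
    "\<And>x. x \<in> U \<Longrightarrow> \<forall>\<^sub>F n in sequentially. f n x = 1"
    by simp_all
  have m: "(\<lambda>w. \<integral>x. f n x \<partial>q w) \<in> borel_measurable M" for n
  proof (rule borel_measurableI)
    fix V :: "real set" assume "open V"
    then have "{N \<in> probs R. (\<integral>x. f n x \<partial>N) \<in> V} \<in> sets (borel_of (weak_topology R))"
      using f(2) by (intro openin_imp_borel openin_weak_topology f(1)) (auto intro!: boundedI[of _ 1] simp: abs_le_iff intro: order_trans[of _ 0])
    from measurable_sets[OF q this] have "q -` {N \<in> probs R. (\<integral>x. f n x \<partial>N) \<in> V} \<inter> space M \<in> sets M" .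
    also have "q -` {N \<in> probs R. (\<integral>x. f n x \<partial>N) \<in> V} \<inter> space M = (\<lambda>w. \<integral>x. f n x \<partial>q w) -` V \<inter> space M"
      using qp by auto
    finally show "(\<lambda>w. \<integral>x. f n x \<partial>q w) -` V \<inter> space M \<in> sets M" .
  qed
  have lim: "(\<lambda>n. \<integral>x. f n x \<partial>q w) \<longlonglongrightarrow> measure (q w) U" if w: "w \<in> space M" for w
  proof -
    interpret prob_space "q w"
      by (rule p[OF w])
    have sp: "space (q w) = topspace R"
      using sets_eq_imp_space_eq[OF qs[OF w]] by simp
    have U_sets: "U \<in> sets (q w)"
      using U qs[OF w] by (simp add: openin_imp_borel)
    have "(\<lambda>n. \<integral>x. f n x \<partial>q w) \<longlonglongrightarrow> (\<integral>x. indicator U x \<partial>q w)"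
    proof (rule integral_dominated_convergence[where w="\<lambda>x. 1"])
      show "(indicator U :: _ \<Rightarrow> real) \<in> borel_measurable (q w)"
        using U_sets by simp
      show "f n \<in> borel_measurable (q w)" for n
        using continuous_map_real_measurable[OF f(1)] qs[OF w] by (simp cong: measurable_cong_sets)
      show "AE x in q w. (\<lambda>n. f n x) \<longlonglongrightarrow> indicator U x"
      proof (rule AE_I2)
        fix x assume x: "x \<in> space (q w)"
        show "(\<lambda>n. f n x) \<longlonglongrightarrow> indicator U x"
        proof (cases "x \<in> U")
          case True
          then show ?thesis
            using tendsto_eventually[OF f(4)] by simp
        next
          case False
          then show ?thesis
            using f(3) x sp by simp
        qed
      qed
      show "AE x in q w. norm (f n x) \<le> 1" for n
        using f(2) sp by (intro AE_I2) (auto simp: abs_le_iff intro: order_trans[of _ 0])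
    qed simp
    then show ?thesis
      using U_sets sets.Int_space_eq2 by (simp add: sets.Int_space_eq2)
  qed
  have "(\<lambda>w. measure (q w) U) \<in> borel_measurable M"
    by (rule borel_measurable_LIMSEQ_real[OF lim m])
  then have "(\<lambda>w. ennreal (measure (q w) U)) \<in> borel_measurable M"
    by simp
  then show "(\<lambda>w. emeasure (q w) U) \<in> borel_measurable M"
    using p by (subst measurable_cong[where g="\<lambda>w. ennreal (measure (q w) U)"])
      (auto simp: finite_measure.emeasure_eq_measure prob_space.finite_measure)
qed

section \<open>Refinements that regularize a value function and a kernel\<close>

lemma polish_refinement_lsc:
  fixes V :: "'a \<Rightarrow> ereal"
  assumes S: "polish_topology S" and V: "V \<in> borel_measurable (borel_of S)"
    and A: "countable A" "A \<subseteq> sets (borel_of S)"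
  obtains S' where "polish_topology S'" "finer_topology S' S" "lsc_on S' V" "\<And>B. B \<in> A \<Longrightarrow> openin S' B"
proof -
  let ?L = "\<lambda>r. {x \<in> topspace S. ereal r < V x}"
  have L: "?L r \<in> sets (borel_of S)" for r
    using borel_measurable_less[OF borel_measurable_const V, of "ereal r"] by simp
  have "countable (A \<union> ?L ` \<rat>)" "A \<union> ?L ` \<rat> \<subseteq> sets (borel_of S)"
    using A countable_rat L by auto
  then obtain S' where S': "polish_topology S'" "finer_topology S' S" "\<forall>B\<in>A \<union> ?L ` \<rat>. openin S' B"
    using polish_make_borel_family_open[OF S, of "A \<union> ?L ` \<rat>"] by (metis (no_types, lifting))
  have top: "topspace S' = topspace S"
    using S'(2) by (simp add: finer_topology_def)
  show thesis
  proof (rule that[OF S'(1,2)])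
    show "lsc_on S' V"
      unfolding lsc_on_def
    proof
      fix a
      have "{x \<in> topspace S'. a < V x} = (\<Union>r\<in>{r\<in>\<rat>. a \<le> ereal r}. ?L r)" (is "?A = ?B")
      proof
        show "?A \<subseteq> ?B"
        proof clarify
          fix x assume x: "x \<in> topspace S'" "a < V x"
          then obtain r where r: "a < ereal r" "ereal r < V x"
            using ereal_dense2 by blast
          obtain r' where "ereal r < ereal r'" "ereal r' < V x" "r' \<in> \<rat>"
          proof (cases "V x")
            case (real v)
            then show ?thesis
              using Rats_dense_in_real[of r v] r that by auto
          next
            case PInf
            then show ?thesis
              using Rats_dense_in_real[of r "r + 1"] that by auto
          qed (use r in auto)
          moreover have "a \<le> ereal r'"
            using less_trans[OF r(1) \<open>ereal r < ereal r'\<close>] by (rule less_imp_le)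
          ultimately show "x \<in> ?B"
            using x(1) top by (intro UN_I[of r']) auto
        qed
      qed (auto simp: top intro: le_less_trans)
      then show "openin S' {x \<in> topspace S'. a < V x}"
        using S'(3) by auto
    qed
  qed (use S'(3) in auto)
qed

text \<open>Continuity of \<open>q\<close> only asks that the sets of parameters with r < measure (q
  w) V be open, for rational r and V in the countable testing family. One refinement opens these
  together with the rational superlevel sets of the value function.\<close>

lemma polish_refinement_kernel:
  fixes V :: "'a \<Rightarrow> ereal"
  assumes S: "polish_topology S" and V: "V \<in> borel_measurable (borel_of S)"
    and R: "second_countable R" and q: "q \<in> borel_of S \<rightarrow>\<^sub>M prob_algebra (borel_of R)"
  obtains S' where "polish_topology S'" "finer_topology S' S" "continuous_map S' (weak_topology R) q" "lsc_on S' V"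
proof -
  obtain E where E: "countable E" "\<forall>V\<in>E. openin R V"
    "\<forall>M\<in>probs R. \<forall>U a. openin R U \<longrightarrow> a < measure M U \<longrightarrow> (\<exists>V\<in>E. V \<subseteq> U \<and> a < measure M V)"
    using open_base_closed_under_unions[OF R] by (elim exE conjE)
  have qp: "q w \<in> probs R" if "w \<in> topspace S" for w
    using measurable_space[OF q] that by (simp add: probs_eq_space_prob_algebra)
  let ?A = "(\<lambda>(V, r). {w \<in> topspace S. r < measure (q w) V}) ` (E \<times> \<rat>)"
  have "{w \<in> topspace S. r < measure (q w) V} \<in> sets (borel_of S)" if "V \<in> E" for V r
    using borel_measurable_less[OF borel_measurable_const measurable_compose[OF q measurable_measure_prob_algebra]]
      openin_imp_borel[OF E(2)[rule_format, OF that]] by fastforce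
  then have "?A \<subseteq> sets (borel_of S)"
    by auto
  moreover have "countable ?A"
    using E(1) countable_rat by auto
  ultimately obtain S' where S': "polish_topology S'" "finer_topology S' S" "lsc_on S' V" "\<forall>B\<in>?A. openin S' B"
    using polish_refinement_lsc[OF S V, of ?A] by (metis (no_types, lifting))
  have top: "topspace S' = topspace S"
    using S'(2) by (simp add: finer_topology_def)
  have "continuous_map S' (weak_topology R) q"
  proof (rule continuous_map_weak_topology)
    show qp': "q w \<in> probs R" if "w \<in> topspace S'" for w
      using qp that top by simp
    show "lsc_on S' (\<lambda>w. measure (q w) U)" if "openin R U" for U
    proof (rule lsc_measure_from_base[OF qp' E(2,3) _ that])
      show "openin S' {w \<in> topspace S'. r < measure (q w) V}" if "V \<in> E" "r \<in> \<rat>" for V r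
        unfolding top using that by (intro S'(4)[rule_format]) auto
    qed
  qed
  then show thesis
    using that S' by blast
qed

section \<open>Setwise convergence\<close>

text \<open>The inferior limit of coordinate \<open>n\<close> along the indices whose earlier
  coordinates are close to the values already chosen; the remaining indices get \<infinity> and do
  not affect the infimum. Choosing the coordinates one after another yields a common cluster point
  of all of them. Since only countable suprema and infima occur, it depends measurably on a
  parameter, which an extraction of subsequences would not show.\<close>

fun cluster_value :: "(nat \<Rightarrow> nat \<Rightarrow> real) \<Rightarrow> nat \<Rightarrow> real" where
  "cluster_value v n = real_of_ereal (SUP j. INF m.
     if j \<le> m \<and> (\<forall>i\<in>{..<n}. \<bar>v m i - cluster_value v i\<bar> < 1 / real (Suc j)) then ereal (v m n) else \<infinity>)"

declare cluster_value.simps [simp del]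

lemma frequently_near_cluster_value:
  assumes bd: "\<And>m n. 0 \<le> v m n \<and> v m n \<le> K" and e: "0 < e"
  shows "\<exists>m\<ge>N. \<forall>i<n. \<bar>v m i - cluster_value v i\<bar> < e"
  using e
proof (induction n arbitrary: N e)
  case (Suc n)
  define cond where "cond j m \<longleftrightarrow> j \<le> m \<and> (\<forall>i\<in>{..<n}. \<bar>v m i - cluster_value v i\<bar> < 1 / real (Suc j))" for j m
  define I where "I j = (INF m. if cond j m then ereal (v m n) else \<infinity>)" for j
  have ex: "\<exists>m. cond j m" for j
    using Suc.IH[of "1 / real (Suc j)" j] by (auto simp: cond_def)
  have I0: "0 \<le> I j" for j
    unfolding I_def using bd by (intro INF_greatest) auto
  have IK: "I j \<le> ereal K" for j
  proof -
    obtain m where "cond j m"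
      using ex by blast
    then show ?thesis
      unfolding I_def using bd by (intro INF_lower2[of m]) auto
  qed
  have mono: "I j \<le> I j'" if "j \<le> j'" for j j'
    unfolding I_def
  proof (rule INF_mono')
    fix m
    have "cond j' m \<Longrightarrow> cond j m"
    proof -
      assume *: "cond j' m"
      have "1 / real (Suc j') \<le> 1 / real (Suc j)"
        using that by (simp add: field_simps)
      with * that show "cond j m"
        unfolding cond_def by (meson le_trans less_le_trans)
    qed
    then show "(if cond j m then ereal (v m n) else \<infinity>) \<le> (if cond j' m then ereal (v m n) else \<infinity>)"
      by auto
  qed
  have S: "0 \<le> (SUP j. I j)" "(SUP j. I j) \<le> ereal K"
    using I0 IK by (auto intro: SUP_upper2 SUP_least)
  define b where "b = cluster_value v n"
  have b: "(SUP j. I j) = ereal b"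
    unfolding b_def cluster_value.simps[of v n] I_def[symmetric] cond_def[symmetric]
    using S by (cases "SUP j. I j") auto
  have "ereal (b - e) < (SUP j. I j)"
    using Suc.prems by (simp add: b)
  then obtain j0 where j0: "ereal (b - e) < I j0"
    by (auto simp: less_SUP_iff)
  obtain j1 where j1: "1 / real (Suc j1) < e"
    using nat_approx_posE[OF Suc.prems] by blast
  \<comment> \<open>\<open>N\<close> makes the index late, \<open>j0\<close> keeps the infimum above
    b - e, and \<open>j1\<close> brings the tolerance for the earlier coordinates below e.\<close>
  define j where "j = max N (max j0 j1)"
  have Ij: "ereal (b - e) < I j"
    using j0 mono[of j0 j] by (auto simp: j_def intro: less_le_trans)
  have "I j \<le> ereal b"
    unfolding b[symmetric] by (intro SUP_upper) simp
  then have "I j < ereal (b + e)"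
    using Suc.prems by (auto intro: le_less_trans)
  then obtain m where "(if cond j m then ereal (v m n) else \<infinity>) < ereal (b + e)"
    unfolding I_def INF_less_iff by blast
  then have m: "cond j m" "v m n < b + e"
    by (auto split: if_splits)
  have "I j \<le> ereal (v m n)"
    unfolding I_def using m(1) by (intro INF_lower2[of m]) auto
  with Ij have "ereal (b - e) < ereal (v m n)"
    by (rule less_le_trans)
  then have n: "\<bar>v m n - cluster_value v n\<bar> < e"
    using m(2) by (simp add: b_def)
  have "1 / real (Suc j) \<le> 1 / real (Suc j1)"
    by (simp add: j_def field_simps)
  moreover have "\<bar>v m i - cluster_value v i\<bar> < 1 / real (Suc j)" if "i < n" for i
    using m(1) that by (simp add: cond_def)
  ultimately have "\<bar>v m i - cluster_value v i\<bar> < e" if "i < n" for i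
    using j1 that by fastforce
  with n have "\<forall>i<Suc n. \<bar>v m i - cluster_value v i\<bar> < e"
    by (auto simp: less_Suc_eq)
  moreover have "m \<ge> N"
    using m(1) by (simp add: cond_def j_def)
  ultimately show ?case
    by blast
qed auto

lemma convergent_to_cluster_value:
  assumes bd: "\<And>m n. 0 \<le> v m n \<and> v m n \<le> K"
  obtains r where "strict_mono r" "\<And>n. (\<lambda>j. v (r j) n) \<longlonglongrightarrow> cluster_value v n"
proof -
  let ?P = "\<lambda>j m. \<forall>i<j. \<bar>v m i - cluster_value v i\<bar> < 1 / real (Suc j)"
  have ex: "\<exists>m\<ge>N. ?P j m" for N j
    by (rule frequently_near_cluster_value[OF bd]) simp
  \<comment> \<open>Diagonal choice: the j-th index is close in the first j coordinates, with
    tolerance 1/(j+1), and lies beyond its predecessor.\<close>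
  define r where "r = rec_nat (SOME m. ?P 0 m) (\<lambda>j m. SOME m'. Suc m \<le> m' \<and> ?P (Suc j) m')"
  have r: "Suc (r j) \<le> r (Suc j) \<and> ?P (Suc j) (r (Suc j))" for j
  proof -
    have "r (Suc j) = (SOME m'. Suc (r j) \<le> m' \<and> ?P (Suc j) m')"
      by (simp add: r_def)
    then show ?thesis
      using someI_ex[OF ex[of "Suc (r j)" "Suc j"]] by simp
  qed
  have "strict_mono r"
    using r by (auto simp: strict_mono_Suc_iff Suc_le_eq)
  moreover have "(\<lambda>j. v (r j) n) \<longlonglongrightarrow> cluster_value v n" for n
  proof (rule LIMSEQ_I)
    fix e :: real assume "0 < e"
    then obtain j0 where j0: "1 / real (Suc j0) < e"
      using nat_approx_posE by blast
    show "\<exists>no. \<forall>j\<ge>no. norm (v (r j) n - cluster_value v n) < e"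
    proof (intro exI allI impI)
      fix j assume j: "j \<ge> Suc (max j0 n)"
      then obtain j' where j': "j = Suc j'"
        by (cases j) auto
      have "\<bar>v (r j) n - cluster_value v n\<bar> < 1 / real (Suc j)"
        using r[of j'] j unfolding j' by auto
      also have "\<dots> \<le> 1 / real (Suc j0)"
        using j by (simp add: field_simps)
      finally show "norm (v (r j) n - cluster_value v n) < e"
        using j0 by simp
    qed
  qed
  ultimately show thesis
    by (rule that)
qed

lemma measurable_cluster_value:
  assumes u: "\<And>m n. u m n \<in> borel_measurable M"
  shows "(\<lambda>z. cluster_value (\<lambda>m n. u m n z) n) \<in> borel_measurable M"
proof (induction n rule: less_induct)
  case (less n)
  have [measurable]: "(\<lambda>z. cluster_value (\<lambda>m n. u m n z) i) \<in> borel_measurable M" if "i \<in> {..<n}" for i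
    using less that by simp
  note u[measurable]
  have P: "Measurable.pred M (\<lambda>z. \<forall>i\<in>{..<n}. \<bar>u m i z - cluster_value (\<lambda>m n. u m n z) i\<bar> < 1 / real (Suc j))" for j m
    by (intro pred_intros_finite(3)) simp_all
  show ?case
    unfolding cluster_value.simps[of _ n]
    by (intro borel_measurable_real_of_ereal borel_measurable_SUP borel_measurable_INF measurable_If
        pred_intros_logic) (use P in simp_all)
qed

text \<open>The sets with convergent masses form a Dynkin system containing \<open>E\<close>. For a
  disjoint union, domination supplies the summable majorant L * measure \<rho> (F i) in Tannery's
  theorem, which interchanges the limit with the series. The interchange is a conclusion of its own
  because it also gives countable additivity of the limit.\<close>

lemma convergent_measure_Int_stable_generator:
  assumes \<rho>: "finite_measure \<rho>"
    and M: "\<And>j::nat. finite_measure (M j)" "\<And>j. sets (M j) = sets \<rho>"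
    and dom: "\<And>j B. B \<in> sets \<rho> \<Longrightarrow> measure (M j) B \<le> L * measure \<rho> B"
    and E: "sets \<rho> = sigma_sets (space \<rho>) E" "Int_stable E" "E \<subseteq> Pow (space \<rho>)" "space \<rho> \<in> E"
    and conv: "\<And>A. A \<in> E \<Longrightarrow> convergent (\<lambda>j. measure (M j) A)"
  shows measure_limit_suminf: "\<And>F. disjoint_family F \<Longrightarrow> range F \<subseteq> sets \<rho> \<Longrightarrow>
      (\<And>i. convergent (\<lambda>j. measure (M j) (F i))) \<Longrightarrow>
      summable (\<lambda>i. lim (\<lambda>j. measure (M j) (F i))) \<and>
      (\<lambda>j. measure (M j) (\<Union>i::nat. F i)) \<longlonglongrightarrow> (\<Sum>i. lim (\<lambda>j. measure (M j) (F i)))"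
    and "\<And>B. B \<in> sets \<rho> \<Longrightarrow> convergent (\<lambda>j. measure (M j) B)"
proof -
  interpret \<rho>: finite_measure \<rho> by fact
  interpret M: finite_measure "M j" for j by (rule M(1))
  have sp: "space (M j) = space \<rho>" for j
    using sets_eq_imp_space_eq[OF M(2)] .
  show 1: "summable (\<lambda>i. lim (\<lambda>j. measure (M j) (F i))) \<and>
      (\<lambda>j. measure (M j) (\<Union>i::nat. F i)) \<longlonglongrightarrow> (\<Sum>i. lim (\<lambda>j. measure (M j) (F i)))"
    if F: "disjoint_family F" "range F \<subseteq> sets \<rho>" "\<And>i. convergent (\<lambda>j. measure (M j) (F i))" for F :: "nat \<Rightarrow> 'a set"
  proof -
    have sum: "(\<lambda>i. measure (M j) (F i)) sums measure (M j) (\<Union>i. F i)" for j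
      using F M(2) by (intro M.finite_measure_UNION) auto
    have "summable (\<lambda>i. L * measure \<rho> (F i))"
      using \<rho>.finite_measure_UNION[OF F(2,1)] by (intro summable_mult) (auto simp: sums_iff)
    moreover have "\<forall>\<^sub>F (i, j) in at_top \<times>\<^sub>F sequentially. norm (measure (M j) (F i)) \<le> L * measure \<rho> (F i)"
      using dom F(2) by (intro always_eventually) auto
    moreover have "(\<lambda>j. measure (M j) (F i)) \<longlonglongrightarrow> lim (\<lambda>j. measure (M j) (F i))" for i
      using F(3) by (simp add: convergent_LIMSEQ_iff)
    ultimately have "summable (\<lambda>i. lim (\<lambda>j. measure (M j) (F i)))"
      "(\<lambda>j. \<Sum>i. measure (M j) (F i)) \<longlonglongrightarrow> (\<Sum>i. lim (\<lambda>j. measure (M j) (F i)))"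
      using tannerys_theorem[of "\<lambda>i j. measure (M j) (F i)" "\<lambda>i. lim (\<lambda>j. measure (M j) (F i))"
          sequentially "\<lambda>i. L * measure \<rho> (F i)"] trivial_limit_sequentially
      by (blast intro: summable_norm_cancel)+
    then show ?thesis
      using sum by (simp add: sums_iff)
  qed
  show "convergent (\<lambda>j. measure (M j) B)" if "B \<in> sets \<rho>" for B
  proof -
    have "B \<in> sigma_sets (space \<rho>) E"
      using that E(1) by simp
    from E(2,3) this show ?thesis
    proof (induction rule: sigma_sets_induct_disjoint)
      case (basic A)
      then show ?case by (rule conv)
    next
      case empty
      then show ?case by (simp add: convergent_const)
    next
      case (compl A)
      have "measure (M j) (space \<rho> - A) = measure (M j) (space \<rho>) - measure (M j) A" for j
        using M.finite_measure_compl[of A j] compl(1) E(1) M(2) sp by simp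
      then show ?case
        using convergent_diff[OF conv[OF E(4)] compl(2)] by simp
    next
      case (union F)
      then show ?case
        using 1[OF union(1)] E(1) convergent_def by blast
    qed
  qed
qed

text \<open>The limits of the masses are taken as the new measure; the interchange of limit and
  series makes them countably additive. Domination stands in for the Vitali-Hahn-Saks
  theorem.\<close>

lemma setwise_limit_measure:
  assumes \<rho>: "finite_measure \<rho>"
    and M: "\<And>j::nat. finite_measure (M j)" "\<And>j. sets (M j) = sets \<rho>"
    and dom: "\<And>j B. B \<in> sets \<rho> \<Longrightarrow> measure (M j) B \<le> L * measure \<rho> B"
    and E: "sets \<rho> = sigma_sets (space \<rho>) E" "Int_stable E" "E \<subseteq> Pow (space \<rho>)" "space \<rho> \<in> E"
    and conv: "\<And>A. A \<in> E \<Longrightarrow> convergent (\<lambda>j. measure (M j) A)"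
  shows "\<exists>\<gamma>. finite_measure \<gamma> \<and> sets \<gamma> = sets \<rho> \<and>
    (\<forall>B\<in>sets \<rho>. (\<lambda>j. measure (M j) B) \<longlonglongrightarrow> measure \<gamma> B)"
proof -
  have conv_all: "convergent (\<lambda>j. measure (M j) B)" if "B \<in> sets \<rho>" for B
    by (rule convergent_measure_Int_stable_generator(2)[where E=E and L=L and \<rho>=\<rho>])
      (fact assms that)+
  have lim_sum: "summable (\<lambda>i. lim (\<lambda>j. measure (M j) (F i))) \<and>
      (\<lambda>j. measure (M j) (\<Union>i::nat. F i)) \<longlonglongrightarrow> (\<Sum>i. lim (\<lambda>j. measure (M j) (F i)))"
    if F: "disjoint_family F" "range F \<subseteq> sets \<rho>" "\<And>i. convergent (\<lambda>j. measure (M j) (F i))" for F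
    by (rule convergent_measure_Int_stable_generator(1)[where E=E and L=L and \<rho>=\<rho>])
      (fact assms F)+
  define l where "l B = lim (\<lambda>j. measure (M j) B)" for B
  have l: "(\<lambda>j. measure (M j) B) \<longlonglongrightarrow> l B" if "B \<in> sets \<rho>" for B
    using conv_all[OF that] by (simp add: convergent_LIMSEQ_iff l_def)
  have l0: "0 \<le> l B" if "B \<in> sets \<rho>" for B
    by (rule LIMSEQ_le_const[OF l[OF that]]) auto
  define \<gamma> where "\<gamma> = measure_of (space \<rho>) (sets \<rho>) (\<lambda>B. ennreal (l B))"
  have e\<gamma>: "emeasure \<gamma> B = ennreal (l B)" if "B \<in> sets \<rho>" for B
    unfolding \<gamma>_def
  proof (rule emeasure_measure_of_sigma)
    show "sigma_algebra (space \<rho>) (sets \<rho>)" ..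
    show "positive (sets \<rho>) (\<lambda>B. ennreal (l B))"
      by (simp add: positive_def l_def)
    show "countably_additive (sets \<rho>) (\<lambda>B. ennreal (l B))"
    proof (rule countably_additiveI)
      fix F :: "nat \<Rightarrow> 'a set" assume F: "range F \<subseteq> sets \<rho>" "disjoint_family F" "(\<Union>i. F i) \<in> sets \<rho>"
      have "convergent (\<lambda>j. measure (M j) (F i))" for i
        using F(1) by (intro conv_all) auto
      from lim_sum[OF F(2,1) this]
      have s: "summable (\<lambda>i. l (F i))" "l (\<Union>i. F i) = (\<Sum>i. l (F i))"
        using LIMSEQ_unique[OF l[OF F(3)]] by (auto simp: l_def)
      then show "(\<Sum>i. ennreal (l (F i))) = ennreal (l (\<Union>i. F i))"
        using F(1) by (simp add: suminf_ennreal2 l0 range_subsetD)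
    qed
  qed fact
  have s\<gamma>: "sets \<gamma> = sets \<rho>"
    unfolding \<gamma>_def by (simp add: sets.space_closed sets.sigma_sets_eq)
  have "measure \<gamma> B = l B" if "B \<in> sets \<rho>" for B
    using e\<gamma>[OF that] l0[OF that] by (simp add: measure_def)
  moreover have "finite_measure \<gamma>"
    using e\<gamma>[of "space \<rho>"] sets_eq_imp_space_eq[OF s\<gamma>] by (intro finite_measureI) auto
  ultimately show ?thesis
    using s\<gamma> l by (intro exI[of _ \<gamma>]) auto
qed

text \<open>Integrals of a simple function are finite sums of masses and converge along setwise
  limits; the integral of \<open>u\<close> is a supremum of such integrals. Simple functions with
  finite values are used, since multiplication by a finite constant passes to limits.\<close>

lemma nn_integral_setwise_liminf:
  assumes M: "\<And>j::nat. finite_measure (M j)" "\<And>j. sets (M j) = sets \<gamma>" and \<gamma>: "finite_measure \<gamma>"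
    and lim: "\<And>B. B \<in> sets \<gamma> \<Longrightarrow> (\<lambda>j. measure (M j) B) \<longlonglongrightarrow> measure \<gamma> B"
    and u: "u \<in> borel_measurable \<gamma>"
  shows "(\<integral>\<^sup>+x. u x \<partial>\<gamma>) \<le> liminf (\<lambda>j. \<integral>\<^sup>+x. u x \<partial>M j)"
  unfolding nn_integral_def_finite[of \<gamma>]
proof (rule SUP_least)
  fix g assume "g \<in> {g. simple_function \<gamma> g \<and> g \<le> u \<and> (\<forall>x. g x < top)}"
  then have g: "simple_function \<gamma> g" "g \<le> u" "\<And>x. g x < top"
    by auto
  have sp: "space (M j) = space \<gamma>" for j
    using sets_eq_imp_space_eq[OF M(2)] .
  have elim: "(\<lambda>j. emeasure (M j) B) \<longlonglongrightarrow> emeasure \<gamma> B" if "B \<in> sets \<gamma>" for B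
    using lim[OF that] M(1) \<gamma> by (simp add: finite_measure.emeasure_eq_measure tendsto_ennrealI)
  have gM: "simple_function (M j) g" for j
    using g(1) sp M(2) by (simp add: simple_function_def)
  have "(\<lambda>j. \<Sum>y\<in>g ` space \<gamma>. y * emeasure (M j) (g -` {y} \<inter> space \<gamma>)) \<longlonglongrightarrow>
      (\<Sum>y\<in>g ` space \<gamma>. y * emeasure \<gamma> (g -` {y} \<inter> space \<gamma>))"
    using g(3) simple_functionD(2)[OF g(1)] by (intro tendsto_sum ennreal_tendsto_cmult elim) auto
  then have "(\<lambda>j. integral\<^sup>S (M j) g) \<longlonglongrightarrow> integral\<^sup>S \<gamma> g"
    unfolding simple_integral_def sp .
  then have "integral\<^sup>S \<gamma> g = liminf (\<lambda>j. integral\<^sup>S (M j) g)"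
    using lim_imp_Liminf trivial_limit_sequentially by metis
  also have "\<dots> \<le> liminf (\<lambda>j. \<integral>\<^sup>+x. u x \<partial>M j)"
  proof (rule Liminf_mono, rule always_eventually, rule allI)
    fix j
    have "integral\<^sup>S (M j) g = (\<integral>\<^sup>+x. g x \<partial>M j)"
      using gM by (simp add: nn_integral_eq_simple_integral)
    also have "\<dots> \<le> (\<integral>\<^sup>+x. u x \<partial>M j)"
      using g(2) by (intro nn_integral_mono) (auto simp: le_fun_def)
    finally show "integral\<^sup>S (M j) g \<le> (\<integral>\<^sup>+x. u x \<partial>M j)" .
  qed
  finally show "integral\<^sup>S \<gamma> g \<le> liminf (\<lambda>j. \<integral>\<^sup>+x. u x \<partial>M j)" .
qed

section \<open>Approximation by rational combinations of indicators\<close>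

text \<open>Lists of pairs of a rational and an index form a countable type, so
  \<open>from_nat\<close> enumerates all rational combinations of the indicators of the sets
  \<open>A k\<close>.\<close>

definition indicator_comb :: "(nat \<Rightarrow> 'a set) \<Rightarrow> (rat \<times> nat) list \<Rightarrow> 'a \<Rightarrow> real" where
  "indicator_comb A l x = (\<Sum>(q, k)\<leftarrow>l. real_of_rat q * indicator (A k) x)"

lemma indicator_comb_append: "indicator_comb A (l @ l') x = indicator_comb A l x + indicator_comb A l' x"
  by (simp add: indicator_comb_def)

lemma indicator_comb_scale:
  "indicator_comb A (map (\<lambda>(p, k). (q * p, k)) l) x = real_of_rat q * indicator_comb A l x"
  by (induction l) (auto simp: indicator_comb_def of_rat_mult algebra_simps)

lemma measurable_indicator_comb:
  assumes "\<And>k. A k \<in> sets M"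
  shows "indicator_comb A l \<in> borel_measurable M"
proof (induction l)
  case Nil
  then show ?case by (simp add: indicator_comb_def cong: measurable_cong)
next
  case (Cons p l)
  have "indicator_comb A (p # l) = (\<lambda>x. real_of_rat (fst p) * indicator (A (snd p)) x + indicator_comb A l x)"
    by (auto simp: indicator_comb_def split: prod.split)
  then show ?case
    using Cons assms by simp
qed

lemma (in finite_measure) integrable_indicator_comb:
  assumes "\<And>k. A k \<in> sets M"
  shows "integrable M (indicator_comb A l)"
proof (induction l)
  case Nil
  then show ?case by (simp add: indicator_comb_def cong: integrable_cong)
next
  case (Cons p l)
  have eq: "indicator_comb A (p # l) = (\<lambda>x. real_of_rat (fst p) * indicator (A (snd p)) x + indicator_comb A l x)"
    by (auto simp: indicator_comb_def split: prod.split)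
  have "integrable M (indicator (A (snd p)) :: _ \<Rightarrow> real)"
    using assms by (simp add: integrable_indicator_iff less_top[symmetric])
  then show ?case
    unfolding eq using Cons by (intro Bochner_Integration.integrable_add integrable_mult_right)
qed

text \<open>The class \<open>P\<close> of functions approximable in L1 is closed under sums, real
  multiples and dominated limits. A Dynkin argument starting from the generator puts all indicators
  into it, and the induction principle for integrable functions does the rest.\<close>

lemma (in finite_measure) indicator_comb_dense:
  assumes E: "sets M = sigma_sets (space M) (range A)" "Int_stable (range A)" "range A \<subseteq> Pow (space M)"
      "space M \<in> range A"
    and F: "integrable M F" and e: "0 < e"
  shows "\<exists>l. (\<integral>x. \<bar>F x - indicator_comb A l x\<bar> \<partial>M) < e"
proof -
  have A: "A k \<in> sets M" for k
    unfolding E(1) by (intro sigma_sets.Basic) simp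
  note int_s = integrable_indicator_comb[of A, OF A]
  define P where "P F \<longleftrightarrow> (\<forall>e>0. \<exists>l. (\<integral>x. \<bar>F x - indicator_comb A l x\<bar> \<partial>M) < e)" for F
  have add: "P (\<lambda>x. F x + G x)" if FG: "integrable M F" "P F" "integrable M G" "P G" for F G
    unfolding P_def
  proof (intro allI impI)
    fix e :: real assume "0 < e"
    then have "0 < e / 2" by simp
    then obtain l l' where l: "(\<integral>x. \<bar>F x - indicator_comb A l x\<bar> \<partial>M) < e / 2"
      and l': "(\<integral>x. \<bar>G x - indicator_comb A l' x\<bar> \<partial>M) < e / 2"
      using FG(2,4) unfolding P_def by blast
    have "(\<integral>x. \<bar>F x + G x - indicator_comb A (l @ l') x\<bar> \<partial>M) \<le>
        (\<integral>x. \<bar>F x - indicator_comb A l x\<bar> + \<bar>G x - indicator_comb A l' x\<bar> \<partial>M)"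
      using FG int_s by (intro integral_mono) (auto simp: indicator_comb_append)
    also have "\<dots> = (\<integral>x. \<bar>F x - indicator_comb A l x\<bar> \<partial>M) + (\<integral>x. \<bar>G x - indicator_comb A l' x\<bar> \<partial>M)"
      using FG int_s by (intro Bochner_Integration.integral_add) auto
    finally show "\<exists>l. (\<integral>x. \<bar>F x + G x - indicator_comb A l x\<bar> \<partial>M) < e"
      using l l' by (intro exI[of _ "l @ l'"]) auto
  qed
  have scale: "P (\<lambda>x. c * F x)" if F: "integrable M F" "P F" for F c
    unfolding P_def
  proof (intro allI impI)
    fix e :: real assume e: "0 < e"
    \<comment> \<open>The summand 1 keeps \<open>K\<close> positive when F vanishes almost
      everywhere. Replacing c by a rational within e/(2K) then costs at most e/2.\<close>
    define K where "K = (\<integral>x. \<bar>F x\<bar> \<partial>M) + 1"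
    have K: "0 < K"
      unfolding K_def by (intro add_nonneg_pos integral_nonneg) auto
    obtain q where q: "c - e / (2 * K) < real_of_rat q" "real_of_rat q < c"
      using of_rat_dense[of "c - e / (2 * K)" c] e K by auto
    \<comment> \<open>The error of \<open>l\<close> is multiplied by the modulus of q afterwards;
      the added 1 avoids division by 0 and makes the product strictly smaller than e/2.\<close>
    have "0 < e / (2 * (\<bar>real_of_rat q\<bar> + 1))"
      using e by (simp add: add_nonneg_pos)
    then obtain l where l: "(\<integral>x. \<bar>F x - indicator_comb A l x\<bar> \<partial>M) < e / (2 * (\<bar>real_of_rat q\<bar> + 1))"
      using F(2) unfolding P_def by blast
    let ?l = "map (\<lambda>(p, k). (q * p, k)) l"
    have "(\<integral>x. \<bar>c * F x - indicator_comb A ?l x\<bar> \<partial>M) \<le>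
        (\<integral>x. (c - real_of_rat q) * \<bar>F x\<bar> + \<bar>real_of_rat q\<bar> * \<bar>F x - indicator_comb A l x\<bar> \<partial>M)"
    proof (rule integral_mono)
      fix x
      have "c * F x - indicator_comb A ?l x =
          (c - real_of_rat q) * F x + real_of_rat q * (F x - indicator_comb A l x)"
        unfolding indicator_comb_scale by (simp add: algebra_simps)
      then have "\<bar>c * F x - indicator_comb A ?l x\<bar> \<le>
          \<bar>(c - real_of_rat q) * F x\<bar> + \<bar>real_of_rat q * (F x - indicator_comb A l x)\<bar>"
        by (simp only: abs_triangle_ineq)
      then show "\<bar>c * F x - indicator_comb A ?l x\<bar> \<le>
          (c - real_of_rat q) * \<bar>F x\<bar> + \<bar>real_of_rat q\<bar> * \<bar>F x - indicator_comb A l x\<bar>"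
        using q by (simp add: abs_mult)
    qed (use F int_s in auto)
    also have "\<dots> = (c - real_of_rat q) * (\<integral>x. \<bar>F x\<bar> \<partial>M) +
        \<bar>real_of_rat q\<bar> * (\<integral>x. \<bar>F x - indicator_comb A l x\<bar> \<partial>M)"
      using F int_s by simp
    also have "\<dots> < e / 2 + e / 2"
    proof (rule add_le_less_mono)
      have "(c - real_of_rat q) * (\<integral>x. \<bar>F x\<bar> \<partial>M) \<le> (e / (2 * K)) * K"
        using q e K by (intro mult_mono) (auto simp: K_def)
      then show "(c - real_of_rat q) * (\<integral>x. \<bar>F x\<bar> \<partial>M) \<le> e / 2"
        using K by simp
      have "\<bar>real_of_rat q\<bar> * (\<integral>x. \<bar>F x - indicator_comb A l x\<bar> \<partial>M) \<le>
          \<bar>real_of_rat q\<bar> * (e / (2 * (\<bar>real_of_rat q\<bar> + 1)))"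
        using l by (intro mult_left_mono) auto
      also have "\<dots> < e / 2"
      proof -
        have "r / (r + 1) < 1" if "0 \<le> r" for r :: real
          using that by (simp add: divide_less_eq)
        then have "\<bar>real_of_rat q\<bar> / (\<bar>real_of_rat q\<bar> + 1) < 1"
          using abs_ge_zero by blast
        then have "e / 2 * (\<bar>real_of_rat q\<bar> / (\<bar>real_of_rat q\<bar> + 1)) < e / 2 * 1"
          using e by (intro mult_strict_left_mono) auto
        then show ?thesis
          by (simp add: mult_ac)
      qed
      finally show "\<bar>real_of_rat q\<bar> * (\<integral>x. \<bar>F x - indicator_comb A l x\<bar> \<partial>M) < e / 2" .
    qed
    finally show "\<exists>l. (\<integral>x. \<bar>c * F x - indicator_comb A l x\<bar> \<partial>M) < e"
      by (intro exI[of _ ?l]) simp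
  qed
  have lim: "P F" if s: "\<And>i. integrable M (s i)" "\<And>i. P (s i)"
      and F: "\<And>x. x \<in> space M \<Longrightarrow> (\<lambda>i::nat. s i x) \<longlonglongrightarrow> F x"
      "\<And>i x. x \<in> space M \<Longrightarrow> norm (s i x) \<le> norm (w x)" "integrable M F" "integrable M w" for F s and w :: "'a \<Rightarrow> real"
    unfolding P_def
  proof (intro allI impI)
    fix e :: real assume e: "0 < e"
    have "(\<lambda>i. \<integral>x. \<bar>F x - s i x\<bar> \<partial>M) \<longlonglongrightarrow> (\<integral>x. 0 \<partial>M)"
    proof (rule integral_dominated_convergence[where w="\<lambda>x. \<bar>F x\<bar> + \<bar>w x\<bar>"])
      show "AE x in M. (\<lambda>i. \<bar>F x - s i x\<bar>) \<longlonglongrightarrow> 0"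
      proof (rule AE_I2)
        fix x assume "x \<in> space M"
        then have "(\<lambda>i. F x - s i x) \<longlonglongrightarrow> F x - F x"
          by (intro tendsto_diff tendsto_const F(1))
        then show "(\<lambda>i. \<bar>F x - s i x\<bar>) \<longlonglongrightarrow> 0"
          by (simp add: tendsto_rabs_zero)
      qed
      show "AE x in M. norm \<bar>F x - s i x\<bar> \<le> \<bar>F x\<bar> + \<bar>w x\<bar>" for i
        using F(2)[of _ i] by (intro AE_I2) (auto intro!: order_trans[OF abs_triangle_ineq4] add_left_mono)
    qed (use s(1) F in auto)
    then have "\<forall>\<^sub>F i in sequentially. (\<integral>x. \<bar>F x - s i x\<bar> \<partial>M) < e / 2"
      using e by (intro order_tendstoD(2)) auto
    then obtain i where i: "(\<integral>x. \<bar>F x - s i x\<bar> \<partial>M) < e / 2"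
      by (auto simp: eventually_sequentially)
    obtain l where l: "(\<integral>x. \<bar>s i x - indicator_comb A l x\<bar> \<partial>M) < e / 2"
      using s(2)[of i] e unfolding P_def by (meson half_gt_zero)
    have "(\<integral>x. \<bar>F x - indicator_comb A l x\<bar> \<partial>M) \<le>
        (\<integral>x. \<bar>F x - s i x\<bar> + \<bar>s i x - indicator_comb A l x\<bar> \<partial>M)"
      using s(1) F int_s by (intro integral_mono) auto
    also have "\<dots> = (\<integral>x. \<bar>F x - s i x\<bar> \<partial>M) + (\<integral>x. \<bar>s i x - indicator_comb A l x\<bar> \<partial>M)"
      using s(1) F int_s by (intro Bochner_Integration.integral_add) auto
    finally show "\<exists>l. (\<integral>x. \<bar>F x - indicator_comb A l x\<bar> \<partial>M) < e"
      using i l by (intro exI[of _ l]) auto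
  qed
  have int_ind: "integrable M (indicator B :: _ \<Rightarrow> real)" if "B \<in> sets M" for B
    using that by (simp add: integrable_indicator_iff less_top[symmetric])
  have basic: "P (indicator (A k))" for k
    unfolding P_def by (auto intro!: exI[of _ "[(1, k)]"] simp: indicator_comb_def)
  have cong: "P F" if "P G" "\<And>x. x \<in> space M \<Longrightarrow> F x = G x" for F G
  proof -
    have "(\<integral>x. \<bar>F x - indicator_comb A l x\<bar> \<partial>M) = (\<integral>x. \<bar>G x - indicator_comb A l x\<bar> \<partial>M)" for l
      using that(2) by (intro Bochner_Integration.integral_cong) auto
    then show ?thesis
      using that(1) by (simp add: P_def)
  qed
  have ind: "P (indicator B)" if B: "B \<in> sets M" for B
  proof -
    have "B \<in> sigma_sets (space M) (range A)"
      using B E(1) by simp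
    from E(2,3) this show ?thesis
    proof (induction rule: sigma_sets_induct_disjoint)
      case (basic B)
      then show ?case using \<open>\<And>k. P (indicator (A k))\<close> by auto
    next
      case empty
      show ?case
        unfolding P_def by (auto intro!: exI[of _ "[]"] simp: indicator_comb_def)
    next
      case (compl B)
      then have B: "B \<in> sets M"
        using E(1) by simp
      have sp: "P (indicator (space M))"
        using E(4) basic by auto
      have "P (\<lambda>x. indicator (space M) x + (- 1) * indicator B x)"
        by (intro add scale int_ind B compl(2) sp integrable_mult_right sets.top)
      then show ?case
        by (rule cong) (auto simp: indicator_def)
    next
      case (union F)
      have Fs: "F i \<in> sets M" for i
        using union(2) E(1) by auto
      let ?s = "\<lambda>n x. \<Sum>i<n. indicator (F i) x :: real"
      have s: "integrable M (?s n)" for n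
        by (intro Bochner_Integration.integrable_sum int_ind Fs)
      have Ps: "P (?s n)" for n
      proof (induction n)
        case 0
        show ?case
          unfolding P_def by (auto intro!: exI[of _ "[]"] simp: indicator_comb_def)
      next
        case (Suc n)
        have "P (\<lambda>x. ?s n x + indicator (F n) x)"
          by (intro add s Suc union(3) int_ind Fs)
        then show ?case by simp
      qed
      \<comment> \<open>Disjointness turns the partial sums into indicators, so the constant 1
        dominates them.\<close>
      have eq: "?s n x = indicator (\<Union>i<n. F i) x" for n x
        using union(1) by (simp add: indicator_UN_disjoint disjoint_family_on_mono[of _ UNIV])
      show ?case
      proof (rule lim[of ?s _ "\<lambda>x. 1"])
        show "(\<lambda>n. ?s n x) \<longlonglongrightarrow> indicator (\<Union>i. F i) x" for x
          unfolding eq by (rule LIMSEQ_indicator_UN)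
        show "norm (?s n x) \<le> norm (1 :: real)" for n x
          unfolding eq by (simp add: indicator_def)
        show "integrable M (indicator (\<Union>i. F i) :: _ \<Rightarrow> real)"
          using Fs by (intro int_ind) auto
      qed (use s Ps in auto)
    qed
  qed
  have "P F"
    using F
  proof (induction rule: integrable_induct)
    case (base B c)
    have "P (\<lambda>x. c * indicator B x)"
      using base by (intro scale ind int_ind) auto
    then show ?case
      by (simp add: mult.commute)
  next
    case (add f g)
    then show ?case
      using \<open>\<And>F G. integrable M F \<Longrightarrow> P F \<Longrightarrow> integrable M G \<Longrightarrow> P G \<Longrightarrow> P (\<lambda>x. F x + G x)\<close> by blast
  next
    case (lim f s)
    then show ?case
      by (intro \<open>\<And>s F w. (\<And>i. integrable M (s i)) \<Longrightarrow> (\<And>i. P (s i)) \<Longrightarrow> (\<And>x. x \<in> space M \<Longrightarrow> (\<lambda>i. s i x) \<longlonglongrightarrow> F x) \<Longrightarrow>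
        (\<And>i x. x \<in> space M \<Longrightarrow> norm (s i x) \<le> norm (w x)) \<Longrightarrow> integrable M F \<Longrightarrow> integrable M w \<Longrightarrow> P F\<close>[of s f "\<lambda>x. 2 * f x"])
       (auto simp: abs_mult)
  qed
  then show ?thesis
    using e by (simp add: P_def)
qed

text \<open>Clipping to [0, L] produces densities bounded by L. Against a function with values in
  [0, L] it can only decrease the distance, so approximations survive it.\<close>

definition clipped_comb :: "real \<Rightarrow> (nat \<Rightarrow> 'a set) \<Rightarrow> (rat \<times> nat) list \<Rightarrow> 'a \<Rightarrow> real" where
  "clipped_comb L A l x = max 0 (min L (indicator_comb A l x))"

lemma measurable_clipped_comb:
  assumes "\<And>k. A k \<in> sets M"
  shows "clipped_comb L A l \<in> borel_measurable M"
  using measurable_indicator_comb[OF assms, of "\<lambda>k. k"]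
  unfolding clipped_comb_def[abs_def] by (intro borel_measurable_max borel_measurable_min) (auto intro: measurable_indicator_comb assms)

text \<open>On the set where a Radon-Nikodym density exceeds L, domination bounds the integral of
  the density by L times the mass of the set. This finite quantity cancels, so the excess integrates
  to 0 and the density is at most L almost everywhere; taking the minimum with L makes the bound
  hold everywhere.\<close>

lemma bounded_density:
  assumes \<rho>: "finite_measure \<rho>" and \<gamma>: "sets \<gamma> = sets \<rho>"
    and dom: "\<And>B. B \<in> sets \<rho> \<Longrightarrow> emeasure \<gamma> B \<le> ennreal L * emeasure \<rho> B" and L: "0 \<le> L"
  shows "\<exists>F\<in>borel_measurable \<rho>. (\<forall>x. 0 \<le> F x \<and> F x \<le> L) \<and> \<gamma> = density \<rho> (\<lambda>x. ennreal (F x))"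
proof -
  interpret \<rho>: finite_measure \<rho> by fact
  have "absolutely_continuous \<rho> \<gamma>"
    unfolding absolutely_continuous_def
  proof (rule subsetI)
    fix B assume "B \<in> null_sets \<rho>"
    then show "B \<in> null_sets \<gamma>"
      using dom[of B] \<gamma> by (auto simp: null_sets_def)
  qed
  then obtain f where f: "f \<in> borel_measurable \<rho>" "density \<rho> f = \<gamma>"
    using \<rho>.Radon_Nikodym \<gamma> by blast
  define B where "B = {x \<in> space \<rho>. ennreal L < f x}"
  have B: "B \<in> sets \<rho>"
    unfolding B_def using f(1) by measurable
  have "(\<integral>\<^sup>+x. (f x - ennreal L) * indicator B x \<partial>\<rho>) + ennreal L * emeasure \<rho> B =
      (\<integral>\<^sup>+x. (f x - ennreal L) * indicator B x + ennreal L * indicator B x \<partial>\<rho>)"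
    using f(1) B by (subst nn_integral_add) (auto simp: nn_integral_cmult_indicator)
  also have "\<dots> = (\<integral>\<^sup>+x. f x * indicator B x \<partial>\<rho>)"
    by (intro nn_integral_cong) (auto simp: indicator_def B_def diff_add_cancel_ennreal less_imp_le)
  also have "\<dots> = emeasure \<gamma> B"
    using f B by (auto simp: emeasure_density)
  also have "\<dots> \<le> 0 + ennreal L * emeasure \<rho> B"
    using dom[OF B] by simp
  finally have "(\<integral>\<^sup>+x. (f x - ennreal L) * indicator B x \<partial>\<rho>) \<le> 0"
    using \<rho>.emeasure_finite[of B]
    by (subst (asm) (1 2) add.commute, subst (asm) ennreal_add_left_cancel_le) (auto simp: ennreal_mult_eq_top_iff)
  then have "AE x in \<rho>. (f x - ennreal L) * indicator B x = 0"
    using f(1) B by (subst nn_integral_0_iff_AE[symmetric]) auto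
  then have le: "AE x in \<rho>. f x \<le> ennreal L"
  proof (rule AE_mp, intro AE_I2 impI)
    fix x assume x: "x \<in> space \<rho>" "(f x - ennreal L) * indicator B x = 0"
    show "f x \<le> ennreal L"
    proof (rule ccontr)
      assume "\<not> f x \<le> ennreal L"
      then show False
        using x by (auto simp: B_def ennreal_minus_eq_0 not_le diff_eq_0_iff_ennreal)
    qed
  qed
  define F where "F x = enn2real (min (f x) (ennreal L))" for x
  have eF: "ennreal (F x) = min (f x) (ennreal L)" for x
    unfolding F_def by (intro ennreal_enn2real) (auto simp: min_less_iff_disj)
  show ?thesis
  proof (intro bexI[of _ F] conjI allI)
    show "F \<in> borel_measurable \<rho>"
      unfolding F_def[abs_def] using f(1) by measurable
    show "0 \<le> F x" for x
      by (simp add: F_def)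
    show "F x \<le> L" for x
    proof -
      have "ennreal (F x) \<le> ennreal L"
        unfolding eF by simp
      then show ?thesis
        using L by simp
    qed
    have "density \<rho> f = density \<rho> (\<lambda>x. ennreal (F x))"
      using f(1) le by (intro density_cong) (auto simp: eF min_def intro: AE_mp[OF le AE_I2])
    then show "\<gamma> = density \<rho> (\<lambda>x. ennreal (F x))"
      using f(2) by simp
  qed
qed

section \<open>Measurable minimizers among dominated measures\<close>

text \<open>The left continuity of \<open>H z\<close> is lower semicontinuity, \<open>H z\<close> being nondecreasing.\<close>

locale dominated_minimization =
  fixes Z :: "'z measure" and N :: "'a measure" and A :: "nat \<Rightarrow> 'a set" and \<rho> :: "'z \<Rightarrow> 'a measure"
    and L :: real and U :: "nat \<Rightarrow> 'a set" and c :: "nat \<Rightarrow> 'z \<Rightarrow> real"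
    and C :: "'z \<Rightarrow> 'a \<Rightarrow> ennreal" and g :: "'a \<Rightarrow> ennreal" and H :: "'z \<Rightarrow> ennreal \<Rightarrow> ereal"
  assumes gen: "sets N = sigma_sets (space N) (range A)" "Int_stable (range A)" "range A \<subseteq> Pow (space N)"
      "space N \<in> range A"
    and \<rho>: "\<rho> \<in> Z \<rightarrow>\<^sub>M prob_algebra N" and L: "0 \<le> L"
    and U: "\<And>k. U k \<in> sets N" "U 0 = space N" and c: "\<And>k. c k \<in> borel_measurable Z" "\<And>z. z \<in> space Z \<Longrightarrow> c 0 z = 1"
    and C: "(\<lambda>(z, x). C z x) \<in> borel_measurable (Z \<Otimes>\<^sub>M N)" and g: "g \<in> borel_measurable N"
    and H: "(\<lambda>(z, s). H z s) \<in> borel_measurable (Z \<Otimes>\<^sub>M borel)"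
    and H_mono: "\<And>z s s'. z \<in> space Z \<Longrightarrow> s \<le> s' \<Longrightarrow> H z s \<le> H z s'"
    and H_lsc: "\<And>z s a. z \<in> space Z \<Longrightarrow> a < H z s \<Longrightarrow> s \<noteq> 0 \<Longrightarrow> \<exists>s'<s. a < H z s'"
    and H_bot: "\<And>z s. z \<in> space Z \<Longrightarrow> H z s \<noteq> -\<infinity>"
begin

text \<open>An abstract form of a set of couplings: the sets \<open>U k\<close> will be cylinders
  over generators of the two factors and \<open>c k z\<close> the corresponding marginal masses. The
  constraint for k = 0 makes the total mass 1.\<close>

definition \<Gamma> :: "'z \<Rightarrow> 'a measure set" where
  "\<Gamma> z = {\<gamma>. sets \<gamma> = sets N \<and> (\<forall>B\<in>sets N. emeasure \<gamma> B \<le> ennreal L * emeasure (\<rho> z) B) \<and>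
     (\<forall>k. measure \<gamma> (U k) = c k z)}"

definition \<Phi> :: "'z \<Rightarrow> 'a measure \<Rightarrow> ereal" where
  "\<Phi> z \<gamma> = enn2ereal (\<integral>\<^sup>+x. C z x \<partial>\<gamma>) + H z (\<integral>\<^sup>+x. g x \<partial>\<gamma>)"

definition \<delta> :: "nat \<Rightarrow> real" where
  "\<delta> m = 1 / real (Suc m)"

definition fam :: "nat \<Rightarrow> 'a \<Rightarrow> real" where
  "fam n = clipped_comb L A (from_nat n)"

definition D :: "'z \<Rightarrow> nat \<Rightarrow> 'a measure" where
  "D z n = density (\<rho> z) (\<lambda>x. ennreal (fam n x))"

text \<open>A member of the countable family need not satisfy any constraint exactly, so all of them
  are relaxed by the same tolerance, which disappears in the limit.\<close>

definition feas :: "nat \<Rightarrow> 'z \<Rightarrow> nat \<Rightarrow> bool" where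
  "feas m z n \<longleftrightarrow> (\<forall>k. \<bar>measure (D z n) (U k) - c k z\<bar> \<le> \<delta> m)"

text \<open>Truncation at m bounds the integrand, so an L1 error of the density changes the integral
  by at most m times that error.\<close>

definition trC :: "nat \<Rightarrow> 'z \<Rightarrow> nat \<Rightarrow> ennreal" where
  "trC m z n = (\<integral>\<^sup>+x. min (C z x) (of_nat m) \<partial>D z n)"

definition trg :: "nat \<Rightarrow> 'z \<Rightarrow> nat \<Rightarrow> ennreal" where
  "trg m z n = (\<integral>\<^sup>+x. min (g x) (of_nat m) \<partial>D z n) - ennreal (\<delta> m)"

text \<open>Truncation and the shift by \<open>\<delta> m\<close> keep \<open>\<Psi> m z n\<close> below \<open>\<Phi> z \<gamma>\<close>, up to
  \<open>\<delta> m\<close>, for suitable members near \<open>\<gamma>\<close>, although \<open>H z\<close> need not be upper semicontinuous.\<close>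

definition \<Psi> :: "nat \<Rightarrow> 'z \<Rightarrow> nat \<Rightarrow> ereal" where
  "\<Psi> m z n = enn2ereal (trC m z n) + H z (trg m z n)"

definition v :: "nat \<Rightarrow> 'z \<Rightarrow> ereal" where
  "v m z = (INF n. if feas m z n then \<Psi> m z n else \<infinity>)"

text \<open>The least index of a near-minimizer: among countably many candidates this is a
  measurable choice.\<close>

definition idx :: "nat \<Rightarrow> 'z \<Rightarrow> nat" where
  "idx m z = (LEAST n. feas m z n \<and> \<Psi> m z n \<le> v m z + ereal (\<delta> m))"

section \<open>Near-minimizers in the countable family\<close>

lemma \<delta>_pos: "0 < \<delta> m"
  by (simp add: \<delta>_def)

lemma A_sets: "A k \<in> sets N"
  unfolding gen(1) by (intro sigma_sets.Basic) simp

lemma \<rho>_prob: "z \<in> space Z \<Longrightarrow> prob_space (\<rho> z)"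
  using measurable_space[OF \<rho>] by (simp add: space_prob_algebra)

lemma \<rho>_sets: "z \<in> space Z \<Longrightarrow> sets (\<rho> z) = sets N"
  using measurable_space[OF \<rho>] by (simp add: space_prob_algebra)

lemma \<rho>_space: "z \<in> space Z \<Longrightarrow> space (\<rho> z) = space N"
  by (rule sets_eq_imp_space_eq[OF \<rho>_sets])

lemma fam_measurable [measurable]: "fam n \<in> borel_measurable N"
  unfolding fam_def by (intro measurable_clipped_comb A_sets)

lemma fam_measurable_\<rho>: "z \<in> space Z \<Longrightarrow> fam n \<in> borel_measurable (\<rho> z)"
  using fam_measurable by (simp cong: measurable_cong_sets add: \<rho>_sets)

lemma fam_bounds: "0 \<le> fam n x" "fam n x \<le> L"
  using L by (auto simp: fam_def clipped_comb_def)

lemma sets_D: "z \<in> space Z \<Longrightarrow> sets (D z n) = sets N"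
  by (simp add: D_def \<rho>_sets)

lemma nn_integral_D:
  assumes z: "z \<in> space Z" and u: "u \<in> borel_measurable N"
  shows "(\<integral>\<^sup>+x. u x \<partial>D z n) = (\<integral>\<^sup>+x. ennreal (fam n x) * u x \<partial>\<rho> z)"
  unfolding D_def using fam_measurable_\<rho>[OF z] u
  by (intro nn_integral_density) (simp_all cong: measurable_cong_sets add: \<rho>_sets[OF z])

lemma D_dominated:
  assumes z: "z \<in> space Z" and B: "B \<in> sets N"
  shows "emeasure (D z n) B \<le> ennreal L * emeasure (\<rho> z) B"
proof -
  have "emeasure (D z n) B = (\<integral>\<^sup>+x. ennreal (fam n x) * indicator B x \<partial>\<rho> z)"
    unfolding D_def using fam_measurable_\<rho>[OF z] B by (intro emeasure_density) (auto simp: \<rho>_sets[OF z])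
  also have "\<dots> \<le> (\<integral>\<^sup>+x. ennreal L * indicator B x \<partial>\<rho> z)"
    using fam_bounds by (intro nn_integral_mono mult_right_mono ennreal_leI) auto
  also have "\<dots> = ennreal L * emeasure (\<rho> z) B"
    using B by (subst nn_integral_cmult_indicator) (auto simp: \<rho>_sets[OF z])
  finally show ?thesis .
qed

lemma dominated_finite:
  assumes z: "z \<in> space Z" and \<gamma>: "sets \<gamma> = sets N" "\<And>B. B \<in> sets N \<Longrightarrow> emeasure \<gamma> B \<le> ennreal L * emeasure (\<rho> z) B"
  shows "finite_measure \<gamma>" "\<And>B. B \<in> sets N \<Longrightarrow> measure \<gamma> B \<le> L * measure (\<rho> z) B"
proof -
  interpret \<rho>: prob_space "\<rho> z"
    by (rule \<rho>_prob[OF z])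
  have *: "emeasure \<gamma> B \<le> ennreal (L * measure (\<rho> z) B)" if "B \<in> sets N" for B
    using \<gamma>(2)[OF that] L by (simp add: \<rho>.emeasure_eq_measure ennreal_mult)
  have sp: "space \<gamma> = space N"
    by (rule sets_eq_imp_space_eq[OF \<gamma>(1)])
  show fin: "finite_measure \<gamma>"
    using *[OF sets.top] sp by (intro finite_measureI) (auto simp: top_unique)
  show "measure \<gamma> B \<le> L * measure (\<rho> z) B" if "B \<in> sets N" for B
    using *[OF that] L finite_measure.emeasure_eq_measure[OF fin, of B] by simp
qed

lemma finite_D: "z \<in> space Z \<Longrightarrow> finite_measure (D z n)"
  by (rule dominated_finite(1)[OF _ sets_D D_dominated])

text \<open>The density of \<gamma> with respect to \<rho> z takes values in [0, L], so a clipped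
  rational combination is close to it in L1. Every bounded integrand then has nearly the same
  integral: this gives the relaxed constraints and the bound on the cost part. For the second part
  the approximation error is absorbed by the \<delta> m subtracted in \<open>trg\<close>, and
  monotonicity of \<open>H z\<close> suffices.\<close>

lemma approximate_by_members:
  assumes z: "z \<in> space Z" and \<gamma>: "\<gamma> \<in> \<Gamma> z"
  shows "\<exists>n. feas m z n \<and> \<Psi> m z n \<le> \<Phi> z \<gamma> + ereal (\<delta> m)"
proof -
  interpret \<rho>: prob_space "\<rho> z"
    by (rule \<rho>_prob[OF z])
  have \<gamma>': "sets \<gamma> = sets (\<rho> z)" "\<And>B. B \<in> sets (\<rho> z) \<Longrightarrow> emeasure \<gamma> B \<le> ennreal L * emeasure (\<rho> z) B"
    "\<And>k. measure \<gamma> (U k) = c k z"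
    using \<gamma> by (auto simp: \<Gamma>_def \<rho>_sets[OF z])
  obtain F where F0: "F \<in> borel_measurable (\<rho> z)" "\<forall>x. 0 \<le> F x \<and> F x \<le> L"
    and F\<gamma>: "\<gamma> = density (\<rho> z) (\<lambda>x. ennreal (F x))"
    using bounded_density[of "\<rho> z" \<gamma> L] \<rho>.finite_measure_axioms \<gamma>'(1,2) L by auto
  have F: "F \<in> borel_measurable (\<rho> z)" "\<And>x. 0 \<le> F x \<and> F x \<le> L" "\<gamma> = density (\<rho> z) (\<lambda>x. ennreal (F x))"
    using F0 F\<gamma> by simp_all
  have iF: "integrable (\<rho> z) F"
    using F by (intro \<rho>.integrable_const_bound[of _ L]) auto
  \<comment> \<open>The square of 1/(m+1) is small enough for two purposes: e \<le> \<delta> m for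
    the constraints, and m * e \<le> \<delta> m for integrands truncated at m.\<close>
  define e where "e = \<delta> m * \<delta> m"
  have e: "0 < e" "e \<le> \<delta> m" "real m * e \<le> \<delta> m"
  proof -
    have d: "\<delta> m \<le> 1" "real m * \<delta> m \<le> 1"
      by (simp_all add: \<delta>_def divide_le_eq)
    show "0 < e"
      using \<delta>_pos by (simp add: e_def)
    show "e \<le> \<delta> m"
      using mult_right_mono[OF d(1), of "\<delta> m"] \<delta>_pos[of m] by (simp add: e_def)
    show "real m * e \<le> \<delta> m"
      using mult_right_mono[OF d(2), of "\<delta> m"] \<delta>_pos[of m] by (simp add: e_def mult.assoc)
  qed
  obtain l where l: "(\<integral>x. \<bar>F x - indicator_comb A l x\<bar> \<partial>\<rho> z) < e"
    using \<rho>.indicator_comb_dense[of A F e] gen iF e(1) unfolding \<rho>_sets[OF z] \<rho>_space[OF z] by blast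
  define n where "n = to_nat l"
  have fn: "fam n = clipped_comb L A l"
    by (simp add: fam_def n_def)
  note mfam = fam_measurable_\<rho>[OF z, of n]
  have d: "(\<integral>\<^sup>+x. ennreal \<bar>F x - fam n x\<bar> \<partial>\<rho> z) \<le> ennreal e"
  proof -
    have i: "integrable (\<rho> z) (indicator_comb A l)"
      using A_sets by (intro \<rho>.integrable_indicator_comb) (simp add: \<rho>_sets[OF z])
    have "(\<integral>\<^sup>+x. ennreal \<bar>F x - fam n x\<bar> \<partial>\<rho> z) \<le> (\<integral>\<^sup>+x. ennreal \<bar>F x - indicator_comb A l x\<bar> \<partial>\<rho> z)"
    proof (intro nn_integral_mono ennreal_leI)
      fix x
      show "\<bar>F x - fam n x\<bar> \<le> \<bar>F x - indicator_comb A l x\<bar>"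
        using F(2)[of x] unfolding fn clipped_comb_def by (auto simp: max_def min_def)
    qed
    also have "\<dots> = ennreal (\<integral>x. \<bar>F x - indicator_comb A l x\<bar> \<partial>\<rho> z)"
      using i iF by (intro nn_integral_eq_integral) auto
    finally show ?thesis
      using l by (meson ennreal_leI less_imp_le order_trans)
  qed
  \<comment> \<open>The two densities differ by at most e in L1, and u is bounded by K. Both
    directions are needed for the absolute value in \<open>feas\<close>.\<close>
  have key: "(\<integral>\<^sup>+x. u x \<partial>D z n) \<le> (\<integral>\<^sup>+x. u x \<partial>\<gamma>) + ennreal (K * e)"
    and key': "(\<integral>\<^sup>+x. u x \<partial>\<gamma>) \<le> (\<integral>\<^sup>+x. u x \<partial>D z n) + ennreal (K * e)"
    if u: "u \<in> borel_measurable N" "\<And>x. u x \<le> ennreal K" "0 \<le> K" for u K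
  proof -
    have um: "u \<in> borel_measurable (\<rho> z)"
      using u(1) by (simp cong: measurable_cong_sets add: \<rho>_sets[OF z])
    have est: "(\<integral>\<^sup>+x. ennreal (a x) * u x \<partial>\<rho> z) \<le> (\<integral>\<^sup>+x. ennreal (b x) * u x \<partial>\<rho> z) + ennreal (K * e)"
      if ab: "a \<in> borel_measurable (\<rho> z)" "b \<in> borel_measurable (\<rho> z)" "\<And>x. 0 \<le> a x" "\<And>x. 0 \<le> b x"
        "\<And>x. \<bar>a x - b x\<bar> = \<bar>F x - fam n x\<bar>" for a b
    proof -
      have "(\<integral>\<^sup>+x. ennreal (a x) * u x \<partial>\<rho> z) \<le>
          (\<integral>\<^sup>+x. ennreal (b x) * u x + ennreal K * ennreal \<bar>F x - fam n x\<bar> \<partial>\<rho> z)"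
      proof (rule nn_integral_mono)
        fix x
        have "ennreal (a x) \<le> ennreal (b x + \<bar>F x - fam n x\<bar>)"
          using ab(5)[of x] by (intro ennreal_leI) linarith
        then have "ennreal (a x) * u x \<le> (ennreal (b x) + ennreal \<bar>F x - fam n x\<bar>) * u x"
          using ab(4) by (intro mult_right_mono) auto
        also have "\<dots> = ennreal (b x) * u x + u x * ennreal \<bar>F x - fam n x\<bar>"
          by (subst distrib_right) (simp add: mult.commute)
        also have "\<dots> \<le> ennreal (b x) * u x + ennreal K * ennreal \<bar>F x - fam n x\<bar>"
          using u(2) by (intro add_left_mono mult_right_mono) auto
        finally show "ennreal (a x) * u x \<le> ennreal (b x) * u x + ennreal K * ennreal \<bar>F x - fam n x\<bar>" .
      qed
      also have "\<dots> = (\<integral>\<^sup>+x. ennreal (b x) * u x \<partial>\<rho> z) + ennreal K * (\<integral>\<^sup>+x. ennreal \<bar>F x - fam n x\<bar> \<partial>\<rho> z)"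
        using um ab mfam F(1) by (subst nn_integral_add) (auto simp: nn_integral_cmult)
      also have "\<dots> \<le> (\<integral>\<^sup>+x. ennreal (b x) * u x \<partial>\<rho> z) + ennreal K * ennreal e"
        using d by (intro add_left_mono mult_left_mono) auto
      finally show ?thesis
        using u(3) e(1) by (simp add: ennreal_mult)
    qed
    have \<gamma>int: "(\<integral>\<^sup>+x. u x \<partial>\<gamma>) = (\<integral>\<^sup>+x. ennreal (F x) * u x \<partial>\<rho> z)"
      unfolding F(3) using F(1) um by (intro nn_integral_density) auto
    show "(\<integral>\<^sup>+x. u x \<partial>D z n) \<le> (\<integral>\<^sup>+x. u x \<partial>\<gamma>) + ennreal (K * e)"
      unfolding \<gamma>int nn_integral_D[OF z u(1)] using F fam_bounds
      by (intro est mfam) (auto simp: abs_minus_commute)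
    show "(\<integral>\<^sup>+x. u x \<partial>\<gamma>) \<le> (\<integral>\<^sup>+x. u x \<partial>D z n) + ennreal (K * e)"
      unfolding \<gamma>int nn_integral_D[OF z u(1)] using F fam_bounds by (intro est mfam) auto
  qed
  interpret \<gamma>: finite_measure \<gamma>
    using dominated_finite(1)[OF z] \<gamma>' by (simp add: \<rho>_sets[OF z])
  interpret D: finite_measure "D z n"
    by (rule finite_D[OF z])
  have feas: "feas m z n"
    unfolding feas_def
  proof
    fix k
    have Us: "U k \<in> sets (D z n)" "U k \<in> sets \<gamma>"
      using U(1) by (auto simp: sets_D[OF z] \<gamma>'(1) \<rho>_sets[OF z])
    have "emeasure (D z n) (U k) \<le> emeasure \<gamma> (U k) + ennreal e" "emeasure \<gamma> (U k) \<le> emeasure (D z n) (U k) + ennreal e"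
    proof -
      have i: "(indicator (U k) x :: ennreal) \<le> ennreal 1" for x
        by (simp add: indicator_def)
      show "emeasure (D z n) (U k) \<le> emeasure \<gamma> (U k) + ennreal e" "emeasure \<gamma> (U k) \<le> emeasure (D z n) (U k) + ennreal e"
        using key[of "indicator (U k)" 1, OF borel_measurable_indicator[OF U(1)] i]
          key'[of "indicator (U k)" 1, OF borel_measurable_indicator[OF U(1)] i] Us by auto
    qed
    then have "measure (D z n) (U k) \<le> measure \<gamma> (U k) + e" "measure \<gamma> (U k) \<le> measure (D z n) (U k) + e"
      using e(1) by (auto simp: \<gamma>.emeasure_eq_measure D.emeasure_eq_measure simp flip: ennreal_plus)
    then show "\<bar>measure (D z n) (U k) - c k z\<bar> \<le> \<delta> m"
      using e(2) \<gamma>'(3) by auto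
  qed
  have C_meas: "(\<lambda>x. C z x) \<in> borel_measurable N"
    using measurable_compose[OF measurable_Pair1'[OF z] C] by simp
  have mm: "real m * e \<le> \<delta> m"
    by (rule e(3))
  have "trC m z n \<le> (\<integral>\<^sup>+x. min (C z x) (of_nat m) \<partial>\<gamma>) + ennreal (real m * e)"
    unfolding trC_def using C_meas by (intro key) (auto simp: ennreal_of_nat_eq_real_of_nat)
  also have "\<dots> \<le> (\<integral>\<^sup>+x. C z x \<partial>\<gamma>) + ennreal (\<delta> m)"
    using mm by (intro add_mono nn_integral_mono ennreal_leI) auto
  finally have 1: "enn2ereal (trC m z n) \<le> enn2ereal (\<integral>\<^sup>+x. C z x \<partial>\<gamma>) + ereal (\<delta> m)"
    using \<delta>_pos[of m] by (simp add: less_eq_ennreal.rep_eq plus_ennreal.rep_eq enn2ereal_ennreal less_imp_le)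
  have "(\<integral>\<^sup>+x. min (g x) (of_nat m) \<partial>D z n) \<le> (\<integral>\<^sup>+x. min (g x) (of_nat m) \<partial>\<gamma>) + ennreal (real m * e)"
    using g by (intro key) (auto simp: ennreal_of_nat_eq_real_of_nat)
  also have "\<dots> \<le> (\<integral>\<^sup>+x. g x \<partial>\<gamma>) + ennreal (\<delta> m)"
    using mm by (intro add_mono nn_integral_mono ennreal_leI) auto
  finally have "trg m z n \<le> (\<integral>\<^sup>+x. g x \<partial>\<gamma>)"
    unfolding trg_def by (subst ennreal_minus_le_iff) (simp add: add.commute)
  then have 2: "H z (trg m z n) \<le> H z (\<integral>\<^sup>+x. g x \<partial>\<gamma>)"
    by (rule H_mono[OF z])
  have "\<Psi> m z n \<le> \<Phi> z \<gamma> + ereal (\<delta> m)"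
    unfolding \<Psi>_def \<Phi>_def using add_mono[OF 1 2] by (simp add: ac_simps)
  with feas show ?thesis
    by blast
qed

text \<open>One \<delta> m comes from approximating \<gamma> within the family, the other from the
  slack in the choice of the index.\<close>

lemma idx_spec:
  assumes z: "z \<in> space Z" and ne: "\<Gamma> z \<noteq> {}"
  shows "feas m z (idx m z)" "\<And>\<gamma>. \<gamma> \<in> \<Gamma> z \<Longrightarrow> \<Psi> m z (idx m z) \<le> \<Phi> z \<gamma> + ereal (2 * \<delta> m)"
proof -
  obtain \<gamma>0 n0 where n0: "feas m z n0"
    using approximate_by_members[OF z] ne by blast
  have bot: "\<Psi> m z n \<noteq> -\<infinity>" for n
    using H_bot[OF z, of "trg m z n"] enn2ereal_nonneg[of "trC m z n"]
    by (cases "H z (trg m z n)"; cases "enn2ereal (trC m z n)") (auto simp: \<Psi>_def)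
  \<comment> \<open>This keeps \<open>v m z\<close> away from -\<infinity>; otherwise adding
    \<delta> m would not increase a finite or smaller infimum strictly, and no near-minimizer would
    be guaranteed.\<close>
  have "H z 0 \<le> v m z"
    unfolding v_def
  proof (rule INF_greatest)
    fix n
    have "0 + H z 0 \<le> \<Psi> m z n"
      unfolding \<Psi>_def by (intro add_mono H_mono[OF z]) auto
    then show "H z 0 \<le> (if feas m z n then \<Psi> m z n else \<infinity>)"
      by auto
  qed
  then have vbot: "v m z \<noteq> -\<infinity>"
    using H_bot[OF z, of 0] by auto
  have "\<exists>n. feas m z n \<and> \<Psi> m z n \<le> v m z + ereal (\<delta> m)"
  proof (cases "v m z = \<infinity>")
    case True
    then show ?thesis
      using n0 by auto
  next
    case False
    then have "v m z < v m z + ereal (\<delta> m)"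
      using vbot \<delta>_pos[of m] by (cases "v m z") auto
    then obtain n where "(if feas m z n then \<Psi> m z n else \<infinity>) < v m z + ereal (\<delta> m)"
      unfolding v_def[of m z] INF_less_iff by blast
    then show ?thesis
      by (auto split: if_splits intro: less_imp_le)
  qed
  from LeastI_ex[OF this] have *: "feas m z (idx m z)" "\<Psi> m z (idx m z) \<le> v m z + ereal (\<delta> m)"
    by (auto simp: idx_def)
  show "feas m z (idx m z)"
    by (rule *(1))
  fix \<gamma> assume "\<gamma> \<in> \<Gamma> z"
  then obtain n where n: "feas m z n" "\<Psi> m z n \<le> \<Phi> z \<gamma> + ereal (\<delta> m)"
    using approximate_by_members[OF z] by blast
  have "v m z \<le> \<Psi> m z n"
    unfolding v_def using n(1) by (intro INF_lower2[of n]) auto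
  with n(2) have "v m z \<le> \<Phi> z \<gamma> + ereal (\<delta> m)"
    by simp
  then have "v m z + ereal (\<delta> m) \<le> \<Phi> z \<gamma> + ereal (\<delta> m) + ereal (\<delta> m)"
    by (rule add_right_mono)
  also have "\<dots> = \<Phi> z \<gamma> + ereal (2 * \<delta> m)"
    by (simp add: add.assoc)
  finally show "\<Psi> m z (idx m z) \<le> \<Phi> z \<gamma> + ereal (2 * \<delta> m)"
    using *(2) by simp
qed

section \<open>Measurability of the near-minimizers in the parameter\<close>

lemma nn_integral_D_measurable:
  assumes f: "(\<lambda>(z, x). f z x) \<in> borel_measurable (Z \<Otimes>\<^sub>M N)"
  shows "(\<lambda>z. \<integral>\<^sup>+x. f z x \<partial>D z n) \<in> borel_measurable Z"
proof -
  have "(\<lambda>z. \<integral>\<^sup>+x. ennreal (fam n x) * f z x \<partial>\<rho> z) \<in> borel_measurable Z"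
  proof (rule nn_integral_measurable_subprob_algebra2)
    have "(\<lambda>p. ennreal (fam n (snd p)) * (\<lambda>(z, x). f z x) p) \<in> borel_measurable (Z \<Otimes>\<^sub>M N)"
      using f by measurable
    then show "(\<lambda>(z, x). ennreal (fam n x) * f z x) \<in> borel_measurable (Z \<Otimes>\<^sub>M N)"
      by (simp add: case_prod_beta')
    show "\<rho> \<in> Z \<rightarrow>\<^sub>M subprob_algebra N"
      by (rule measurable_prob_algebraD[OF \<rho>])
  qed
  moreover have "(\<lambda>x. f z x) \<in> borel_measurable N" if "z \<in> space Z" for z
    using measurable_compose[OF measurable_Pair1'[OF that] f] by simp
  ultimately show ?thesis
    by (subst measurable_cong[OF nn_integral_D]) auto
qed

lemma measure_D_measurable:
  assumes "B \<in> sets N"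
  shows "(\<lambda>z. measure (D z n) B) \<in> borel_measurable Z"
proof -
  have "(\<lambda>z. \<integral>\<^sup>+x. indicator B x \<partial>D z n) \<in> borel_measurable Z"
    using assms by (intro nn_integral_D_measurable) (simp add: case_prod_beta')
  then have "(\<lambda>z. emeasure (D z n) B) \<in> borel_measurable Z"
    using assms by (subst measurable_cong[of _ _ "\<lambda>z. \<integral>\<^sup>+x. indicator B x \<partial>D z n"]) (auto simp: sets_D)
  then show ?thesis
    unfolding measure_def by measurable
qed

lemma feas_measurable: "Measurable.pred Z (\<lambda>z. feas m z n)"
  unfolding feas_def using measure_D_measurable[OF U(1)] c(1) by measurable

lemma \<Psi>_measurable: "(\<lambda>z. \<Psi> m z n) \<in> borel_measurable Z"
proof -
  have "(\<lambda>p. min ((\<lambda>(z, x). C z x) p) (of_nat m)) \<in> borel_measurable (Z \<Otimes>\<^sub>M N)"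
    using C by measurable
  then have 1: "(\<lambda>z. trC m z n) \<in> borel_measurable Z"
    unfolding trC_def by (intro nn_integral_D_measurable) (simp add: case_prod_beta')
  have "(\<lambda>z. \<integral>\<^sup>+x. min (g x) (of_nat m) \<partial>D z n) \<in> borel_measurable Z"
    using measurable_compose[OF measurable_snd g, of Z]
    by (intro nn_integral_D_measurable) (simp add: case_prod_beta')
  then have 2: "(\<lambda>z. trg m z n) \<in> borel_measurable Z"
    unfolding trg_def by measurable
  have "(\<lambda>z. H z (trg m z n)) \<in> borel_measurable Z"
    using measurable_compose[OF measurable_Pair[OF measurable_ident 2] H] by (simp add: id_def)
  then show ?thesis
    unfolding \<Psi>_def using 1 by measurable
qed

lemma idx_measurable: "idx m \<in> Z \<rightarrow>\<^sub>M count_space UNIV"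
proof -
  have "(\<lambda>z. if feas m z n then \<Psi> m z n else \<infinity>) \<in> borel_measurable Z" for n
    using feas_measurable \<Psi>_measurable by measurable
  then have v: "v m \<in> borel_measurable Z"
    unfolding v_def[abs_def] by (intro borel_measurable_INF) auto
  show ?thesis
    unfolding idx_def[abs_def] using feas_measurable \<Psi>_measurable v by measurable
qed

section \<open>The cluster point and its minimality\<close>

definition cl :: "nat \<Rightarrow> 'z \<Rightarrow> real" where
  "cl n z = cluster_value (\<lambda>m n. measure (D z (idx m z)) (A n)) n"

text \<open>The subsequence \<open>r\<close> may depend on \<open>z\<close> in an uncontrolled way;
  the last conjunct fixes the masses on the generator by measurable functions of \<open>z\<close>,
  so that any choice of such a \<gamma> is a measurable kernel.\<close>

definition limit_of :: "'z \<Rightarrow> 'a measure \<Rightarrow> bool" where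
  "limit_of z \<gamma> \<longleftrightarrow> (\<exists>r. strict_mono r \<and> finite_measure \<gamma> \<and> sets \<gamma> = sets N \<and>
     (\<forall>B\<in>sets N. (\<lambda>j. measure (D z (idx (r j) z)) B) \<longlonglongrightarrow> measure \<gamma> B) \<and> (\<forall>n. measure \<gamma> (A n) = cl n z))"

lemma ex_limit_of:
  assumes z: "z \<in> space Z"
  shows "\<exists>\<gamma>. limit_of z \<gamma>"
proof -
  interpret \<rho>: prob_space "\<rho> z"
    by (rule \<rho>_prob[OF z])
  have "0 \<le> measure (D z (idx m z)) (A n) \<and> measure (D z (idx m z)) (A n) \<le> L" for m n
    using dominated_finite(2)[OF z sets_D D_dominated, OF z z _ A_sets, of "idx m z" n]
      mult_left_mono[OF \<rho>.prob_le_1[of "A n"] L] by simp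
  from convergent_to_cluster_value[of "\<lambda>m n. measure (D z (idx m z)) (A n)" L, OF this]
  obtain r where r: "strict_mono r"
    "\<And>n. (\<lambda>j. measure (D z (idx (r j) z)) (A n)) \<longlonglongrightarrow> cl n z"
    unfolding cl_def by blast
  have "\<exists>\<gamma>. finite_measure \<gamma> \<and> sets \<gamma> = sets (\<rho> z) \<and>
    (\<forall>B\<in>sets (\<rho> z). (\<lambda>j. measure (D z (idx (r j) z)) B) \<longlonglongrightarrow> measure \<gamma> B)"
  proof (rule setwise_limit_measure[where E="range A" and L=L])
    show "finite_measure (\<rho> z)"
      by (rule \<rho>.finite_measure_axioms)
    show "finite_measure (D z (idx (r j) z))" for j
      by (rule finite_D[OF z])
    show "sets (D z (idx (r j) z)) = sets (\<rho> z)" for j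
      by (simp add: sets_D[OF z] \<rho>_sets[OF z])
    show "measure (D z (idx (r j) z)) B \<le> L * measure (\<rho> z) B" if "B \<in> sets (\<rho> z)" for j B
      using dominated_finite(2)[OF z sets_D D_dominated, OF z z] that by (simp add: \<rho>_sets[OF z])
    show "sets (\<rho> z) = sigma_sets (space (\<rho> z)) (range A)" "Int_stable (range A)"
      "range A \<subseteq> Pow (space (\<rho> z))" "space (\<rho> z) \<in> range A"
      using gen by (simp_all add: \<rho>_sets[OF z] \<rho>_space[OF z])
    show "convergent (\<lambda>j. measure (D z (idx (r j) z)) B)" if "B \<in> range A" for B
      using r(2) that by (auto simp: convergent_def)
  qed
  then obtain \<gamma> where \<gamma>: "finite_measure \<gamma>" "sets \<gamma> = sets N"
    "\<And>B. B \<in> sets N \<Longrightarrow> (\<lambda>j. measure (D z (idx (r j) z)) B) \<longlonglongrightarrow> measure \<gamma> B"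
    unfolding \<rho>_sets[OF z] by blast
  have "measure \<gamma> (A n) = cl n z" for n
    by (rule LIMSEQ_unique[OF \<gamma>(3)[OF A_sets] r(2)])
  with \<gamma> r(1) show ?thesis
    unfolding limit_of_def by blast
qed

text \<open>Domination is preserved by setwise limits, and the tolerances tend to 0 along the
  subsequence, which turns the relaxed constraints into equalities.\<close>

lemma limit_of_in_\<Gamma>:
  assumes z: "z \<in> space Z" and ne: "\<Gamma> z \<noteq> {}" and \<gamma>: "limit_of z \<gamma>"
  shows "\<gamma> \<in> \<Gamma> z"
proof -
  interpret \<rho>: prob_space "\<rho> z"
    by (rule \<rho>_prob[OF z])
  obtain r where r: "strict_mono r" "finite_measure \<gamma>" "sets \<gamma> = sets N"
    "\<And>B. B \<in> sets N \<Longrightarrow> (\<lambda>j. measure (D z (idx (r j) z)) B) \<longlonglongrightarrow> measure \<gamma> B"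
    using \<gamma> unfolding limit_of_def by blast
  have "measure \<gamma> B \<le> L * measure (\<rho> z) B" if B: "B \<in> sets N" for B
    using dominated_finite(2)[OF z sets_D D_dominated, OF z z _ B]
    by (intro LIMSEQ_le_const2[OF r(4)[OF B]]) auto
  then have dom: "emeasure \<gamma> B \<le> ennreal L * emeasure (\<rho> z) B" if B: "B \<in> sets N" for B
    using B L by (simp add: finite_measure.emeasure_eq_measure[OF r(2)] \<rho>.emeasure_eq_measure flip: ennreal_mult)
  have "measure \<gamma> (U k) = c k z" for k
  proof -
    have "(\<lambda>j. measure (D z (idx (r j) z)) (U k) - c k z) \<longlonglongrightarrow> 0"
    proof (rule tendsto_rabs_zero_cancel, rule tendsto_sandwich[where f="\<lambda>_. 0" and h=\<delta>])
      show "\<forall>\<^sub>F j in sequentially. \<bar>measure (D z (idx (r j) z)) (U k) - c k z\<bar> \<le> \<delta> j"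
      proof (intro always_eventually allI)
        fix j
        have "\<delta> (r j) \<le> \<delta> j"
          using seq_suble[OF r(1), of j] by (simp add: \<delta>_def field_simps)
        then show "\<bar>measure (D z (idx (r j) z)) (U k) - c k z\<bar> \<le> \<delta> j"
          using idx_spec(1)[OF z ne, of "r j"] unfolding feas_def by (meson order_trans)
      qed
      show "\<delta> \<longlonglongrightarrow> 0"
        unfolding \<delta>_def[abs_def] by (rule LIMSEQ_Suc[OF lim_1_over_n])
    qed auto
    then have "(\<lambda>j. measure (D z (idx (r j) z)) (U k)) \<longlonglongrightarrow> c k z"
      by (rule LIM_zero_cancel)
    then show ?thesis
      by (rule LIMSEQ_unique[OF r(4)[OF U(1)]])
  qed
  with dom r(3) show ?thesis
    by (simp add: \<Gamma>_def)
qed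

text \<open>For fixed k the truncation at k is eventually below the truncation at r j, so the Fatou
  inequality applies to it; monotone convergence in k then removes the truncation on the
  left.\<close>

lemma truncated_liminf:
  assumes z: "z \<in> space Z" and r: "strict_mono r" "finite_measure \<gamma>" "sets \<gamma> = sets N"
    "\<And>B. B \<in> sets N \<Longrightarrow> (\<lambda>j. measure (D z (idx (r j) z)) B) \<longlonglongrightarrow> measure \<gamma> B"
    and u: "u \<in> borel_measurable N"
  shows "(\<integral>\<^sup>+x. u x \<partial>\<gamma>) \<le> liminf (\<lambda>j. \<integral>\<^sup>+x. min (u x) (of_nat (r j)) \<partial>D z (idx (r j) z))"
proof -
  have um: "u \<in> borel_measurable \<gamma>"
    using u by (simp cong: measurable_cong_sets add: r(3))
  have "(\<integral>\<^sup>+x. u x \<partial>\<gamma>) = (\<integral>\<^sup>+x. (SUP k. min (u x) (of_nat k)) \<partial>\<gamma>)"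
  proof (intro nn_integral_cong)
    fix x
    have "(SUP k. min (u x) (of_nat k)) = min (u x) (SUP k. of_nat k)"
      by (simp flip: inf_min add: inf_SUP)
    then show "u x = (SUP k. min (u x) (of_nat k))"
      by (simp add: ennreal_SUP_of_nat_eq_top)
  qed
  also have "\<dots> = (SUP k. \<integral>\<^sup>+x. min (u x) (of_nat k) \<partial>\<gamma>)"
    using um by (intro nn_integral_monotone_convergence_SUP) (auto simp: incseq_def le_fun_def min_le_iff_disj)
  also have "\<dots> \<le> liminf (\<lambda>j. \<integral>\<^sup>+x. min (u x) (of_nat (r j)) \<partial>D z (idx (r j) z))"
  proof (rule SUP_least)
    fix k
    have "(\<integral>\<^sup>+x. min (u x) (of_nat k) \<partial>\<gamma>) \<le> liminf (\<lambda>j. \<integral>\<^sup>+x. min (u x) (of_nat k) \<partial>D z (idx (r j) z))"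
      using finite_D[OF z] sets_D[OF z] r um by (intro nn_integral_setwise_liminf) auto
    also have "\<dots> \<le> liminf (\<lambda>j. \<integral>\<^sup>+x. min (u x) (of_nat (r j)) \<partial>D z (idx (r j) z))"
    proof (rule Liminf_mono, rule eventually_sequentiallyI[of k])
      fix j assume "k \<le> j"
      then have "of_nat k \<le> (of_nat (r j) :: ennreal)"
        using seq_suble[OF r(1), of j] by simp
      then show "(\<integral>\<^sup>+x. min (u x) (of_nat k) \<partial>D z (idx (r j) z)) \<le> (\<integral>\<^sup>+x. min (u x) (of_nat (r j)) \<partial>D z (idx (r j) z))"
        by (intro nn_integral_mono min.mono) auto
    qed
    finally show "(\<integral>\<^sup>+x. min (u x) (of_nat k) \<partial>\<gamma>) \<le> liminf (\<lambda>j. \<integral>\<^sup>+x. min (u x) (of_nat (r j)) \<partial>D z (idx (r j) z))" .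
  qed
  finally show ?thesis .
qed

text \<open>Along the subsequence each of the two parts of the objective is eventually above any
  real number below its value at \<gamma>: the first by Fatou, the second by Fatou and left
  continuity of \<open>H z\<close>. Near-minimality within 2 * \<delta> bounds the sum of two such
  numbers by the objective of \<eta>.\<close>

lemma limit_of_minimal:
  assumes z: "z \<in> space Z" and ne: "\<Gamma> z \<noteq> {}" and \<gamma>: "limit_of z \<gamma>" and \<eta>: "\<eta> \<in> \<Gamma> z"
  shows "\<Phi> z \<gamma> \<le> \<Phi> z \<eta>"
proof -
  obtain r where r: "strict_mono r" "finite_measure \<gamma>" "sets \<gamma> = sets N"
    "\<And>B. B \<in> sets N \<Longrightarrow> (\<lambda>j. measure (D z (idx (r j) z)) B) \<longlonglongrightarrow> measure \<gamma> B"
    using \<gamma> unfolding limit_of_def by blast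
  have C_meas: "(\<lambda>x. C z x) \<in> borel_measurable N"
    using measurable_compose[OF measurable_Pair1'[OF z] C] by simp
  define I where "I = (\<integral>\<^sup>+x. C z x \<partial>\<gamma>)"
  define J where "J = (\<integral>\<^sup>+x. g x \<partial>\<gamma>)"
  let ?I = "\<lambda>j. trC (r j) z (idx (r j) z)"
  let ?J = "\<lambda>j. trg (r j) z (idx (r j) z)"
  have limI: "I \<le> liminf ?I"
    unfolding I_def trC_def by (rule truncated_liminf[OF z r C_meas])
  have evI: "\<forall>\<^sub>F j in sequentially. a < enn2ereal (?I j)" if "a < enn2ereal I" for a
  proof (cases "a < 0")
    case True
    then show ?thesis
      by (intro always_eventually allI) (auto intro: less_le_trans)
  next
    case False
    then have "enn2ereal (e2ennreal a) = a"
      by (simp add: enn2ereal_e2ennreal)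
    then have *: "a < enn2ereal x \<longleftrightarrow> e2ennreal a < x" for x
      by (simp add: less_ennreal.rep_eq)
    have "e2ennreal a < liminf ?I"
      using that limI unfolding * by (rule less_le_trans)
    then show ?thesis
      unfolding * by (rule less_LiminfD)
  qed
  have limJ: "J \<le> liminf (\<lambda>j. \<integral>\<^sup>+x. min (g x) (of_nat (r j)) \<partial>D z (idx (r j) z))"
    unfolding J_def by (rule truncated_liminf[OF z r g])
  \<comment> \<open>A value s strictly between s' and J leaves a gap that absorbs the \<delta> (r j)
    subtracted in \<open>trg\<close>.\<close>
  have evJ: "\<forall>\<^sub>F j in sequentially. s' < ?J j" if s': "s' < J" for s'
  proof -
    obtain s where s: "s' < s" "s < J"
      using dense[OF s'] by blast
    obtain \<sigma> where \<sigma>: "s = ennreal \<sigma>" "0 \<le> \<sigma>"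
      using s by (cases s) auto
    obtain \<sigma>' where \<sigma>': "s' = ennreal \<sigma>'" "0 \<le> \<sigma>'"
      using s by (cases s') auto
    have lt: "\<sigma>' < \<sigma>"
      using s(1) \<sigma> \<sigma>' by (simp add: ennreal_less_iff)
    have "s < liminf (\<lambda>j. \<integral>\<^sup>+x. min (g x) (of_nat (r j)) \<partial>D z (idx (r j) z))"
      using s(2) limJ by (rule less_le_trans)
    then have 1: "\<forall>\<^sub>F j in sequentially. s < (\<integral>\<^sup>+x. min (g x) (of_nat (r j)) \<partial>D z (idx (r j) z))"
      by (rule less_LiminfD)
    have "\<delta> \<longlonglongrightarrow> 0"
      unfolding \<delta>_def[abs_def] by (rule LIMSEQ_Suc[OF lim_1_over_n])
    then have "\<forall>\<^sub>F j in sequentially. \<delta> j < \<sigma> - \<sigma>'"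
      using lt by (intro order_tendstoD(2)) auto
    with 1 show ?thesis
    proof eventually_elim
      case (elim j)
      have "\<delta> (r j) \<le> \<delta> j"
        using seq_suble[OF r(1), of j] by (simp add: \<delta>_def field_simps)
      then have "\<sigma>' < \<sigma> - \<delta> (r j)"
        using elim(2) by simp
      then have "s' < s - ennreal (\<delta> (r j))"
        using \<sigma> \<sigma>' \<delta>_pos[of "r j"] by (simp add: ennreal_minus ennreal_less_iff)
      also have "\<dots> \<le> ?J j"
        unfolding trg_def using elim(1) by (intro ennreal_minus_mono) auto
      finally show ?case .
    qed
  qed
  \<comment> \<open>At J = 0 there is nothing below to approach from; monotonicity alone gives H z 0
    as a lower bound.\<close>
  have evH: "\<forall>\<^sub>F j in sequentially. a < H z (?J j)" if a: "a < H z J" for a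
  proof (cases "J = 0")
    case True
    then show ?thesis
      using a H_mono[OF z, of 0] by (intro always_eventually allI) (auto intro: less_le_trans)
  next
    case False
    then obtain s' where s': "s' < J" "a < H z s'"
      using H_lsc[OF z a] by blast
    from evJ[OF s'(1)] show ?thesis
    proof eventually_elim
      case (elim j)
      then show ?case
        using s'(2) H_mono[OF z, of s' "?J j"] by (auto intro: less_le_trans)
    qed
  qed
  have step: "ereal (a + b) \<le> \<Phi> z \<eta>" if ab: "ereal a < enn2ereal I" "ereal b < H z J" for a b
  proof -
    have "\<forall>\<^sub>F j in sequentially. ereal (a + b) - ereal (2 * \<delta> j) \<le> \<Phi> z \<eta>"
      using evI[OF ab(1)] evH[OF ab(2)]
    proof eventually_elim
      case (elim j)
      have "ereal a + ereal b \<le> \<Psi> (r j) z (idx (r j) z)"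
        unfolding \<Psi>_def using elim by (intro add_mono less_imp_le)
      also have "\<dots> \<le> \<Phi> z \<eta> + ereal (2 * \<delta> (r j))"
        by (rule idx_spec(2)[OF z ne \<eta>])
      also have "\<dots> \<le> \<Phi> z \<eta> + ereal (2 * \<delta> j)"
        using seq_suble[OF r(1), of j] by (intro add_left_mono) (simp add: \<delta>_def field_simps)
      finally show ?case
        by (cases "\<Phi> z \<eta>") auto
    qed
    moreover have "(\<lambda>j. ereal (a + b - 2 * \<delta> j)) \<longlonglongrightarrow> ereal (a + b - 2 * 0)"
      unfolding \<delta>_def[abs_def] by (intro tendsto_intros LIMSEQ_Suc[OF lim_1_over_n])
    ultimately show ?thesis
      by (intro tendsto_upperbound[of "\<lambda>j. ereal (a + b - 2 * \<delta> j)" "ereal (a + b)" sequentially]) auto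
  qed
  show ?thesis
  proof (rule ccontr)
    assume "\<not> \<Phi> z \<gamma> \<le> \<Phi> z \<eta>"
    then have lt: "\<Phi> z \<eta> < enn2ereal I + H z J"
      by (simp add: \<Phi>_def I_def J_def)
    \<comment> \<open>A strict inequality below a sum in which either term may be \<infinity> is
      split into real bounds below the two terms; excluding -\<infinity> ensures that such real
      numbers exist.\<close>
    have "\<exists>a b. ereal a < x \<and> ereal b < y \<and> w < ereal (a + b)"
      if wxy: "w < x + y" "x \<noteq> -\<infinity>" "y \<noteq> -\<infinity>" for w x y :: ereal
    proof -
      obtain w' where w': "w < ereal w'" "ereal w' < x + y"
        using ereal_dense2[OF wxy(1)] by blast
      have "\<exists>a b. ereal a < x \<and> ereal b < y \<and> w' < a + b"
      proof (cases x)
        case (real x')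
        show ?thesis
        proof (cases y)
          case (real y')
          define d where "d = (x' + y' - w') / 3"
          have "d > 0"
            using w'(2) \<open>x = ereal x'\<close> real by (simp add: d_def)
          then show ?thesis
            using \<open>x = ereal x'\<close> real by (intro exI[of _ "x' - d"] exI[of _ "y' - d"]) (simp add: d_def field_simps)
        next
          case PInf
          then show ?thesis
            using real by (intro exI[of _ "x' - 1"] exI[of _ "w' - x' + 2"]) auto
        qed (use wxy in auto)
      next
        case PInf
        show ?thesis
        proof (cases y)
          case (real y')
          then show ?thesis
            using PInf by (intro exI[of _ "w' - y' + 2"] exI[of _ "y' - 1"]) auto
        next
          case PInf
          then show ?thesis
            using \<open>x = \<infinity>\<close> by (intro exI[of _ "w' + 1"] exI[of _ 0]) auto
        qed (use wxy in auto)
      qed (use wxy in auto)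
      then obtain a b where "ereal a < x" "ereal b < y" "w' < a + b"
        by blast
      then show ?thesis
        using w'(1) by (intro exI[of _ a] exI[of _ b]) (auto intro: less_trans)
    qed
    from this[OF lt] obtain a b where "ereal a < enn2ereal I" "ereal b < H z J" "\<Phi> z \<eta> < ereal (a + b)"
      using H_bot[OF z, of J] enn2ereal_nonneg[of I] by fastforce
    then show False
      using step by (meson not_le)
  qed
qed

text \<open>The limit is picked by an unrestricted choice, yet its masses on the generating
  pi-system are the measurable functions \<open>cl n\<close>, and this is all that measurability of
  a kernel requires.\<close>

theorem measurable_minimizer:
  assumes ne: "\<And>z. z \<in> space Z \<Longrightarrow> \<Gamma> z \<noteq> {}"
  shows "\<exists>q \<in> Z \<rightarrow>\<^sub>M prob_algebra N. \<forall>z\<in>space Z. q z \<in> \<Gamma> z \<and> (\<forall>\<gamma>\<in>\<Gamma> z. \<Phi> z (q z) \<le> \<Phi> z \<gamma>)"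
proof
  define q where "q z = (SOME \<gamma>. limit_of z \<gamma>)" for z
  have q: "limit_of z (q z)" if "z \<in> space Z" for z
    unfolding q_def using ex_limit_of[OF that] by (rule someI_ex)
  have q\<Gamma>: "q z \<in> \<Gamma> z" if "z \<in> space Z" for z
    by (rule limit_of_in_\<Gamma>[OF that ne[OF that] q[OF that]])
  show "\<forall>z\<in>space Z. q z \<in> \<Gamma> z \<and> (\<forall>\<gamma>\<in>\<Gamma> z. \<Phi> z (q z) \<le> \<Phi> z \<gamma>)"
    using q\<Gamma> limit_of_minimal[OF _ ne q] by blast
  show "q \<in> Z \<rightarrow>\<^sub>M prob_algebra N"
  proof (rule measurable_prob_algebra_generated[OF gen(1,2,3)])
    fix z assume z: "z \<in> space Z"
    have fin: "finite_measure (q z)" and s: "sets (q z) = sets N"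
      using q[OF z] by (auto simp: limit_of_def)
    show "sets (q z) = sets N"
      by (rule s)
    have "measure (q z) (space N) = 1"
      using q\<Gamma>[OF z] U(2) c(2)[OF z] unfolding \<Gamma>_def by (metis (mono_tags, lifting) mem_Collect_eq)
    then show "prob_space (q z)"
      using sets_eq_imp_space_eq[OF s] finite_measure.emeasure_eq_measure[OF fin, of "space N"]
      by (intro prob_spaceI) simp
  next
    fix B assume "B \<in> range A"
    then obtain n where n: "B = A n"
      by blast
    have "(\<lambda>z. measure (D z (idx m z)) (A n)) \<in> borel_measurable Z" for m n
      using measure_D_measurable[OF A_sets] idx_measurable by (rule measurable_compose_countable)
    then have "cl n \<in> borel_measurable Z"
      unfolding cl_def[abs_def] by (intro measurable_cluster_value)
    moreover have "emeasure (q z) B = ennreal (cl n z)" if "z \<in> space Z" for z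
      using q[OF that] by (auto simp: limit_of_def n finite_measure.emeasure_eq_measure)
    ultimately show "(\<lambda>z. emeasure (q z) B) \<in> borel_measurable Z"
      by (simp cong: measurable_cong)
  qed
qed

end

section \<open>Extended integrals\<close>

lemma prob_algebra_cong: "sets M = sets N \<Longrightarrow> prob_algebra M = prob_algebra N"
  unfolding prob_algebra_def by (simp cong: subprob_algebra_cong)

lemma e2ennreal_add:
  assumes "0 \<le> x" "0 \<le> y"
  shows "e2ennreal (x + y) = e2ennreal x + e2ennreal y"
proof -
  have "enn2ereal (e2ennreal x + e2ennreal y) = x + y"
    using assms by (simp add: plus_ennreal.rep_eq enn2ereal_e2ennreal)
  then show ?thesis
    by (metis e2ennreal_enn2ereal)
qed

text \<open>For f \<ge> -K the positive parts satisfy (f + K) + f^- = f^+ + K pointwise. Integrating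
  and cancelling the integral of f^-, which is at most K, leaves a single nonnegative integral.
  Additivity and Fubini for extended integrals are reduced to nonnegative integrals in this
  way.\<close>

lemma ext_integral_shift:
  assumes M: "prob_space M" and f: "f \<in> borel_measurable M" and K: "0 \<le> K"
    and bd: "\<And>x. x \<in> space M \<Longrightarrow> - ereal K \<le> f x"
  shows "ext_integral M f = enn2ereal (\<integral>\<^sup>+x. e2ennreal (f x + ereal K) \<partial>M) - ereal K"
proof -
  interpret prob_space M by fact
  note f[measurable]
  let ?P = "\<integral>\<^sup>+x. e2ennreal (f x) \<partial>M" and ?N = "\<integral>\<^sup>+x. e2ennreal (- f x) \<partial>M"
  let ?A = "\<integral>\<^sup>+x. e2ennreal (f x + ereal K) \<partial>M"
  have pt: "e2ennreal (f x + ereal K) + e2ennreal (- f x) = e2ennreal (f x) + ennreal K" if "x \<in> space M" for x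
  proof (cases "f x")
    case (real r)
    then show ?thesis
      using K bd[OF that] by (cases "0 \<le> r")
        (simp_all add: ennreal_neg flip: ennreal_plus)
  qed (use K bd[OF that] in \<open>simp_all add: e2ennreal_neg\<close>)
  have "?A + ?N = (\<integral>\<^sup>+x. e2ennreal (f x + ereal K) + e2ennreal (- f x) \<partial>M)"
    by (rule nn_integral_add[symmetric]) measurable
  also have "\<dots> = (\<integral>\<^sup>+x. e2ennreal (f x) + ennreal K \<partial>M)"
    by (rule nn_integral_cong) (rule pt)
  also have "\<dots> = ?P + ennreal K"
    by (subst nn_integral_add) (auto simp: emeasure_space_1)
  finally have eq: "?A + ?N = ?P + ennreal K" .
  have "?N \<le> (\<integral>\<^sup>+x. ennreal K \<partial>M)"
  proof (rule nn_integral_mono)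
    fix x assume "x \<in> space M"
    then have "- f x \<le> ereal K"
      using bd by (metis ereal_uminus_le_reorder)
    then show "e2ennreal (- f x) \<le> ennreal K"
      using e2ennreal_mono[of "- f x" "ereal K"] by simp
  qed
  then have "?N \<le> ennreal K"
    by (simp add: emeasure_space_1)
  then obtain n where n: "?N = ennreal n" "0 \<le> n"
    by (metis ennreal_cases ennreal_top_eq_mult_iff ennreal_neq_top top_unique)
  have "enn2ereal ?A + ereal n = enn2ereal ?P + ereal K"
    using arg_cong[OF eq, of enn2ereal] n(2) K unfolding n(1) by (simp add: plus_ennreal.rep_eq enn2ereal_ennreal)
  then show ?thesis
    unfolding ext_integral_def n(1) using n(2)
    by (cases "enn2ereal ?A"; cases "enn2ereal ?P") (auto simp: enn2ereal_ennreal)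
qed

lemma ext_integral_ge:
  assumes "prob_space M" "f \<in> borel_measurable M" "0 \<le> K" "\<And>x. x \<in> space M \<Longrightarrow> - ereal K \<le> f x"
  shows "- ereal K \<le> ext_integral M f"
proof -
  let ?A = "\<integral>\<^sup>+x. e2ennreal (f x + ereal K) \<partial>M"
  have "- ereal K \<le> enn2ereal ?A - ereal K"
    using enn2ereal_nonneg[of ?A] by (cases "enn2ereal ?A") (auto simp del: enn2ereal_nonneg)
  then show ?thesis
    by (simp only: ext_integral_shift[OF assms])
qed

lemma ext_integral_add:
  assumes M: "prob_space M" and f: "f \<in> borel_measurable M" "0 \<le> K" "\<And>x. x \<in> space M \<Longrightarrow> - ereal K \<le> f x"
    and g: "g \<in> borel_measurable M" "0 \<le> K'" "\<And>x. x \<in> space M \<Longrightarrow> - ereal K' \<le> g x"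
  shows "ext_integral M (\<lambda>x. f x + g x) = ext_integral M f + ext_integral M g"
proof -
  note f(1)[measurable] g(1)[measurable]
  let ?F = "\<integral>\<^sup>+x. e2ennreal (f x + ereal K) \<partial>M" and ?G = "\<integral>\<^sup>+x. e2ennreal (g x + ereal K') \<partial>M"
  have bd: "- ereal (K + K') \<le> f x + g x" if "x \<in> space M" for x
    using add_mono[OF f(3)[OF that] g(3)[OF that]] by simp
  have "ext_integral M (\<lambda>x. f x + g x) =
      enn2ereal (\<integral>\<^sup>+x. e2ennreal (f x + g x + ereal (K + K')) \<partial>M) - ereal (K + K')"
    using f g by (intro ext_integral_shift[OF M _ _ bd]) auto
  also have "(\<integral>\<^sup>+x. e2ennreal (f x + g x + ereal (K + K')) \<partial>M) =
      (\<integral>\<^sup>+x. e2ennreal (f x + ereal K) + e2ennreal (g x + ereal K') \<partial>M)"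
  proof (rule nn_integral_cong)
    fix x assume x: "x \<in> space M"
    have "0 \<le> f x + ereal K" "0 \<le> g x + ereal K'"
      using f(3)[OF x] g(3)[OF x] by (cases "f x"; simp)  (cases "g x"; use f(3)[OF x] g(3)[OF x] in simp)
    then have "e2ennreal (f x + ereal K) + e2ennreal (g x + ereal K') = e2ennreal ((f x + ereal K) + (g x + ereal K'))"
      by (simp add: e2ennreal_add)
    also have "(f x + ereal K) + (g x + ereal K') = f x + g x + ereal (K + K')"
      by (simp add: ac_simps flip: plus_ereal.simps)
    finally show "e2ennreal (f x + g x + ereal (K + K')) = e2ennreal (f x + ereal K) + e2ennreal (g x + ereal K')"
      by simp
  qed
  also have "\<dots> = ?F + ?G"
    by (rule nn_integral_add) measurable
  also have "enn2ereal (?F + ?G) - ereal (K + K') = (enn2ereal ?F - ereal K) + (enn2ereal ?G - ereal K')"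
    using enn2ereal_nonneg[of ?F] enn2ereal_nonneg[of ?G]
    by (cases "enn2ereal ?F"; cases "enn2ereal ?G") (auto simp: plus_ennreal.rep_eq)
  also have "\<dots> = ext_integral M f + ext_integral M g"
    using f g by (simp add: ext_integral_shift[OF M])
  finally show ?thesis .
qed

lemma ext_integral_const: "prob_space M \<Longrightarrow> ext_integral M (\<lambda>_. c) = c"
  by (cases c rule: ereal_cases; cases "0 \<le> c")
    (auto simp: ext_integral_def prob_space.emeasure_space_1 e2ennreal_neg zero_ennreal.rep_eq enn2ereal_ennreal
      top_ennreal.rep_eq ennreal_neg)

lemma sum_ge_neg:
  fixes f :: "'i \<Rightarrow> ereal"
  assumes "finite I" "\<And>i. i \<in> I \<Longrightarrow> - ereal (K i) \<le> f i"
  shows "- ereal (\<Sum>i\<in>I. K i) \<le> (\<Sum>i\<in>I. f i)"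
  using assms
proof (induction I rule: finite_induct)
  case (insert i I)
  have "- ereal (K i) + - ereal (\<Sum>i\<in>I. K i) \<le> f i + (\<Sum>i\<in>I. f i)"
    using insert by (intro add_mono) auto
  then show ?case
    using insert(1,2) by simp
qed simp

lemma ext_integral_sum:
  assumes M: "prob_space M" and I: "finite I"
    and f: "\<And>i. i \<in> I \<Longrightarrow> f i \<in> borel_measurable M" "\<And>i. i \<in> I \<Longrightarrow> 0 \<le> K i"
      "\<And>i x. i \<in> I \<Longrightarrow> x \<in> space M \<Longrightarrow> - ereal (K i) \<le> f i x"
  shows "ext_integral M (\<lambda>x. \<Sum>i\<in>I. f i x) = (\<Sum>i\<in>I. ext_integral M (f i))"
  using I f
proof (induction I rule: finite_induct)
  case empty
  then show ?case
    using ext_integral_const[OF M, of 0] by simp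
next
  case (insert i I)
  have "ext_integral M (\<lambda>x. f i x + (\<Sum>i\<in>I. f i x)) = ext_integral M (f i) + ext_integral M (\<lambda>x. \<Sum>i\<in>I. f i x)"
  proof (rule ext_integral_add[OF M, where K="K i" and K'="\<Sum>i\<in>I. K i"])
    show "- ereal (\<Sum>i\<in>I. K i) \<le> (\<Sum>i\<in>I. f i x)" if "x \<in> space M" for x
      using insert that by (intro sum_ge_neg) auto
    show "0 \<le> (\<Sum>i\<in>I. K i)"
      using insert by (intro sum_nonneg) auto
    show "- ereal (K i) \<le> f i x" if "x \<in> space M" for x
      using insert that by auto
    show "0 \<le> K i"
      using insert by auto
  qed (use insert in auto)
  then show ?case
    using insert by simp
qed

lemma ext_integral_distr:
  assumes "T \<in> M \<rightarrow>\<^sub>M N" "f \<in> borel_measurable N"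
  shows "ext_integral (distr M N T) f = ext_integral M (\<lambda>x. f (T x))"
  unfolding ext_integral_def using assms by (simp add: nn_integral_distr)

lemma measurable_ext_integral:
  assumes L: "L \<in> M \<rightarrow>\<^sub>M prob_algebra N"
    and f: "(\<lambda>(x, y). f x y) \<in> borel_measurable (M \<Otimes>\<^sub>M N)"
  shows "(\<lambda>x. ext_integral (L x) (f x)) \<in> borel_measurable M"
proof -
  have "(\<lambda>x. \<integral>\<^sup>+y. e2ennreal (f x y) \<partial>L x) \<in> borel_measurable M"
    using measurable_compose[OF f measurable_e2ennreal]
    by (intro nn_integral_measurable_subprob_algebra2[OF _ measurable_prob_algebraD[OF L]]) (simp add: case_prod_beta')
  moreover have "(\<lambda>x. \<integral>\<^sup>+y. e2ennreal (- f x y) \<partial>L x) \<in> borel_measurable M"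
    using measurable_compose[OF borel_measurable_uminus_ereal[OF f] measurable_e2ennreal]
    by (intro nn_integral_measurable_subprob_algebra2[OF _ measurable_prob_algebraD[OF L]]) (simp add: case_prod_beta')
  ultimately show ?thesis
    unfolding ext_integral_def by measurable
qed

text \<open>The shift by K commutes with averaging over probability measures, so the rule for
  nonnegative integrals carries over.\<close>

lemma ext_integral_bind:
  assumes M: "prob_space M" and L: "L \<in> M \<rightarrow>\<^sub>M prob_algebra N"
    and f: "f \<in> borel_measurable N" "0 \<le> K" "\<And>x. x \<in> space N \<Longrightarrow> - ereal K \<le> f x"
  shows "ext_integral (bind M L) f = ext_integral M (\<lambda>x. ext_integral (L x) f)"
proof -
  have Lx: "prob_space (L x)" "sets (L x) = sets N" if "x \<in> space M" for x
    using measurable_space[OF L that] by (auto simp: space_prob_algebra)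
  have Lf: "f \<in> borel_measurable (L x)" "space (L x) = space N" if "x \<in> space M" for x
    using f(1) Lx(2)[OF that] sets_eq_imp_space_eq[OF Lx(2)[OF that]] by (auto cong: measurable_cong_sets)
  let ?F = "\<lambda>x. \<integral>\<^sup>+y. e2ennreal (f y + ereal K) \<partial>L x"
  note f(1)[measurable]
  have e: "(\<lambda>y. e2ennreal (f y + ereal K)) \<in> borel_measurable N"
    by measurable
  have Lb: "prob_space (bind M L)"
    using M L by (intro prob_space_bind'[where M=M and N=N]) (simp_all add: space_prob_algebra)
  have sb: "sets (bind M L) = sets N"
    using M L by (intro sets_bind'[where M=M]) (simp_all add: space_prob_algebra)
  have "ext_integral (bind M L) f = enn2ereal (\<integral>\<^sup>+x. ?F x \<partial>M) - ereal K"
    using f Lb sb sets_eq_imp_space_eq[OF sb] e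
    by (subst ext_integral_shift[where K=K]) (auto cong: measurable_cong_sets
        simp: nn_integral_bind[OF _ measurable_prob_algebraD[OF L]])
  moreover have "ext_integral M (\<lambda>x. ext_integral (L x) f) =
      enn2ereal (\<integral>\<^sup>+x. e2ennreal (ext_integral (L x) f + ereal K) \<partial>M) - ereal K"
  proof (rule ext_integral_shift[OF M _ f(2)])
    show "(\<lambda>x. ext_integral (L x) f) \<in> borel_measurable M"
      using measurable_compose[OF measurable_snd f(1), of M]
      by (intro measurable_ext_integral[OF L]) (simp add: case_prod_beta')
    show "- ereal K \<le> ext_integral (L x) f" if "x \<in> space M" for x
      using that by (intro ext_integral_ge Lx Lf f(2,3)) (simp_all only: Lf(2)[OF that])
  qed
  moreover have "(\<integral>\<^sup>+x. e2ennreal (ext_integral (L x) f + ereal K) \<partial>M) = (\<integral>\<^sup>+x. ?F x \<partial>M)"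
  proof (rule nn_integral_cong)
    fix x assume x: "x \<in> space M"
    have "ext_integral (L x) f = enn2ereal (?F x) - ereal K"
      using x by (intro ext_integral_shift Lx Lf f(2,3)) (simp_all only: Lf(2)[OF x])
    then have "ext_integral (L x) f + ereal K = enn2ereal (?F x)"
      by (cases "enn2ereal (?F x)") auto
    then show "e2ennreal (ext_integral (L x) f + ereal K) = ?F x"
      by simp
  qed
  ultimately show ?thesis
    by simp
qed

section \<open>Laws of Markov chains\<close>

text \<open>A symmetric description of the two marginals, instantiated for \<mu> and for \<nu>. The
  kernel given the whole history is a function of the last state only, with the fixed state
  \<open>s0\<close> at time 0.\<close>

locale markov_law =
  fixes S :: "nat \<Rightarrow> (real^'d::finite) topology" and T :: nat and s0 :: "real^'d"
    and m :: "'d path measure" and k :: "nat \<Rightarrow> real^'d \<Rightarrow> (real^'d) measure"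
  assumes S: "\<And>t. t \<le> T \<Longrightarrow> polish_topology (S t)" and S0: "topspace (S 0) = {s0}"
    and m: "m \<in> probs (product_topology S {0<..T})"
    and k: "\<And>t. t < T \<Longrightarrow> regular_cond_kernel m (borel_of (product_topology S {0<..t})) (borel_of (S (Suc t)))
       (\<lambda>xs. restrict xs {0<..t}) (\<lambda>xs. xs (Suc t)) (\<lambda>xs. k t (at_time s0 xs t))"
begin

lemma nonempty: "t \<le> T \<Longrightarrow> topspace (S t) \<noteq> {}"
proof (cases "t = 0")
  case False
  assume "t \<le> T"
  interpret prob_space m
    using m by (simp add: probs_def)
  have "space m = topspace (product_topology S {0<..T})"
    using m sets_eq_imp_space_eq[of m "borel_of (product_topology S {0<..T})"] by (simp add: probs_def)
  then have "topspace (product_topology S {0<..T}) \<noteq> {}"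
    using not_empty by simp
  then show ?thesis
    using False \<open>t \<le> T\<close> by (auto simp: PiE_eq_empty_iff)
qed (simp add: S0)

lemma second_countable_paths: "t \<le> T \<Longrightarrow> second_countable (product_topology S {s<..t})"
  using S by (intro second_countable_product_topology) (auto simp: polish_topology_iff)

text \<open>The conditional kernel is given as a measurable function of the history. Embedding a
  state as the last entry of a history whose other entries are fixed points of their spaces is
  continuous, and composing with it gives measurability in the state alone.\<close>

lemma kernel_measurable:
  assumes t: "t < T"
  shows "k t \<in> borel_of (S t) \<rightarrow>\<^sub>M prob_algebra (borel_of (S (Suc t)))"
proof -
  have *: "(\<lambda>xs. k t (at_time s0 xs t)) \<in> borel_of (product_topology S {0<..t}) \<rightarrow>\<^sub>M prob_algebra (borel_of (S (Suc t)))"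
    using k[OF t] by (simp add: regular_cond_kernel_def)
  have "\<forall>s\<in>{..T}. \<exists>x. x \<in> topspace (S s)"
    using nonempty by (metis atMost_iff ex_in_conv)
  then obtain a where a: "\<And>s. s \<le> T \<Longrightarrow> a s \<in> topspace (S s)"
    by (metis atMost_iff)
  let ?e = "\<lambda>y. \<lambda>s\<in>{0<..t}. if s = t then y else a s"
  have "continuous_map (S t) (product_topology S {0<..t}) ?e"
    unfolding continuous_map_componentwise
  proof (intro conjI ballI)
    fix s assume s: "s \<in> {0<..t}"
    show "continuous_map (S t) (S s) (\<lambda>x. ?e x s)"
      using s a[of s] t by (cases "s = t") (auto simp: continuous_map_const)
  qed auto
  from measurable_compose[OF continuous_map_imp_measurable[OF this] *]
  have "(\<lambda>y. k t (at_time s0 (?e y) t)) \<in> borel_of (S t) \<rightarrow>\<^sub>M prob_algebra (borel_of (S (Suc t)))" .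
  moreover have "at_time s0 (?e y) t = y" if "y \<in> topspace (S t)" for y
    using that S0 by (auto simp: at_time_def)
  ultimately show ?thesis
    by (subst measurable_cong[where g="\<lambda>y. k t (at_time s0 (?e y) t)"]) auto
qed

lemma restrict_measurable:
  "t \<le> T \<Longrightarrow> (\<lambda>xs. restrict xs {0<..t}) \<in> borel_of (product_topology S {0<..T}) \<rightarrow>\<^sub>M borel_of (product_topology S {0<..t})"
  by (intro continuous_map_imp_measurable) (auto simp: continuous_map_componentwise intro!: continuous_map_product_projection)

lemma eval_measurable:
  "0 < t \<Longrightarrow> t \<le> T \<Longrightarrow> (\<lambda>xs. xs t) \<in> borel_of (product_topology S {0<..T}) \<rightarrow>\<^sub>M borel_of (S t)"
  by (intro continuous_map_imp_measurable continuous_map_product_projection) auto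

text \<open>Induction on the length of the history: the joint law of history and next state is
  determined on rectangles by the common kernel and the law of the history, and rectangles form a
  generating pi-system.\<close>

lemma law_unique:
  assumes m': "m' \<in> probs (product_topology S {0<..T})"
    and k': "\<And>t. t < T \<Longrightarrow> regular_cond_kernel m' (borel_of (product_topology S {0<..t})) (borel_of (S (Suc t)))
       (\<lambda>xs. restrict xs {0<..t}) (\<lambda>xs. xs (Suc t)) (\<lambda>xs. k t (at_time s0 xs t))"
  shows "m' = m"
proof -
  let ?P = "\<lambda>t. borel_of (product_topology S {0<..t})"
  let ?r = "\<lambda>t xs. restrict xs {0<..t}"
  have sets: "sets m = sets (?P T)" "sets m' = sets (?P T)" and prob: "prob_space m" "prob_space m'"
    using m m' by (auto simp: probs_def)
  have space: "space m = space (?P T)" "space m' = space (?P T)"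
    by (intro sets_eq_imp_space_eq sets)+
  have rm: "?r t \<in> m \<rightarrow>\<^sub>M ?P t" "?r t \<in> m' \<rightarrow>\<^sub>M ?P t" if "t \<le> T" for t
    using restrict_measurable[OF that] by (simp_all cong: measurable_cong_sets add: sets)
  have em: "(\<lambda>xs. xs (Suc t)) \<in> m \<rightarrow>\<^sub>M borel_of (S (Suc t))" "(\<lambda>xs. xs (Suc t)) \<in> m' \<rightarrow>\<^sub>M borel_of (S (Suc t))" if "t < T" for t
    using eval_measurable[of "Suc t"] that by (simp_all cong: measurable_cong_sets add: sets)
  have "distr m' (?P t) (?r t) = distr m (?P t) (?r t)" if "t \<le> T" for t
    using that
  proof (induction t)
    \<comment> \<open>The index set \<open>{0<..0}\<close> is empty, so there is only one path and
      the only events are the trivial ones.\<close>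
    case 0
    have p: "prob_space (distr m (?P 0) (?r 0))" "prob_space (distr m' (?P 0) (?r 0))"
      using rm[of 0] prob by (auto intro: prob_space.prob_space_distr)
    show ?case
    proof (rule measure_eqI)
      fix A assume "A \<in> sets (distr m' (?P 0) (?r 0))"
      then have "A \<subseteq> space (?P 0)"
        using sets.sets_into_space by (metis sets_distr)
      then have "A = {} \<or> A = space (?P 0)"
        by (auto simp: PiE_empty_domain)
      then show "emeasure (distr m' (?P 0) (?r 0)) A = emeasure (distr m (?P 0) (?r 0)) A"
        using p[THEN prob_space.emeasure_space_1] by auto
    qed simp
  next
    case (Suc t)
    then have t: "t < T" and IH: "distr m' (?P t) (?r t) = distr m (?P t) (?r t)"
      by (simp, intro Suc.IH, simp)
    let ?R = "?P t \<Otimes>\<^sub>M borel_of (S (Suc t))"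
    let ?J = "\<lambda>xs. (?r t xs, xs (Suc t))"
    have J: "?J \<in> m \<rightarrow>\<^sub>M ?R" "?J \<in> m' \<rightarrow>\<^sub>M ?R"
      using rm[of t] em[OF t] t by (auto intro: measurable_Pair)
    have rect: "emeasure (distr M ?R ?J) (A \<times> B) = (\<integral>\<^sup>+ u. emeasure (k t (at_time s0 u t)) B * indicator A u \<partial>distr M (?P t) (?r t))"
      if M: "regular_cond_kernel M (?P t) (borel_of (S (Suc t))) (?r t) (\<lambda>xs. xs (Suc t)) (\<lambda>xs. k t (at_time s0 xs t))"
        "?J \<in> M \<rightarrow>\<^sub>M ?R" and AB: "A \<in> sets (?P t)" "B \<in> sets (borel_of (S (Suc t)))" for M A B
    proof -
      have "emeasure (distr M ?R ?J) (A \<times> B) = emeasure M (?J -` (A \<times> B) \<inter> space M)"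
        using M(2) AB by (intro emeasure_distr) auto
      also have "?J -` (A \<times> B) \<inter> space M = {\<omega> \<in> space M. ?r t \<omega> \<in> A \<and> \<omega> (Suc t) \<in> B}"
        by auto
      also have "emeasure M {\<omega> \<in> space M. ?r t \<omega> \<in> A \<and> \<omega> (Suc t) \<in> B} =
          (\<integral>\<^sup>+ u. emeasure (k t (at_time s0 u t)) B * indicator A u \<partial>distr M (?P t) (?r t))"
        using M(1) AB unfolding regular_cond_kernel_def by blast
      finally show ?thesis .
    qed
    define G where "G = {a \<times> b |a b. a \<in> sets (?P t) \<and> b \<in> sets (borel_of (S (Suc t)))}"
    have G: "sets ?R = sigma_sets (space ?R) G"
      unfolding G_def sets_pair_measure space_pair_measure ..
    have eq: "distr m' ?R ?J = distr m ?R ?J"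
    proof (rule measure_eqI_generator_eq[where E=G and \<Omega>="space ?R" and A="\<lambda>_. space ?R"])
      show "Int_stable G"
        unfolding G_def by (rule Int_stable_pair_measure_generator)
      show "G \<subseteq> Pow (space ?R)"
        unfolding G_def by (rule pair_measure_closed[folded space_pair_measure])
      show "sets (distr m' ?R ?J) = sigma_sets (space ?R) G" "sets (distr m ?R ?J) = sigma_sets (space ?R) G"
        by (simp_all only: sets_distr G)
      have "space ?R \<in> G"
        unfolding G_def space_pair_measure by (intro CollectI exI[of _ "space (?P t)"] exI[of _ "space (borel_of (S (Suc t)))"] conjI refl sets.top)
      then show "range (\<lambda>_. space ?R) \<subseteq> G"
        by blast
      show "emeasure (distr m' ?R ?J) X = emeasure (distr m ?R ?J) X" if "X \<in> G" for X
      proof -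
        have "\<exists>a b. X = a \<times> b \<and> a \<in> sets (?P t) \<and> b \<in> sets (borel_of (S (Suc t)))"
          using \<open>X \<in> G\<close> by (simp only: G_def mem_Collect_eq)
        then obtain a b where X: "X = a \<times> b" "a \<in> sets (?P t)" "b \<in> sets (borel_of (S (Suc t)))"
          by (elim exE conjE)
        show ?thesis
          unfolding X(1) rect[OF k[OF t] J(1) X(2,3)] rect[OF k'[OF t] J(2) X(2,3)] IH ..
      qed
      show "emeasure (distr m' ?R ?J) (space ?R) \<noteq> \<infinity>" for i :: nat
        using prob_space.emeasure_space_1[OF prob_space.prob_space_distr[OF prob(2) J(2)]] by simp
      show "(\<Union>i::nat. space ?R) = space ?R"
        by simp
    qed
    \<comment> \<open>Appending the next state to the history recovers the longer history, so the
      joint law determines its law.\<close>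
    let ?K = "\<lambda>(u, s). u(Suc t := s)"
    have K: "?K \<in> ?R \<rightarrow>\<^sub>M ?P (Suc t)"
    proof -
      have "continuous_map (prod_topology (product_topology S {0<..t}) (S (Suc t))) (product_topology S {0<..Suc t}) ?K"
        unfolding continuous_map_componentwise
      proof (intro conjI ballI)
        fix i assume i: "i \<in> {0<..Suc t}"
        show "continuous_map (prod_topology (product_topology S {0<..t}) (S (Suc t))) (S i) (\<lambda>x. ?K x i)"
        proof (cases "i = Suc t")
          case True
          then show ?thesis
            using continuous_map_snd by (simp add: case_prod_beta')
        next
          case False
          then have "i \<in> {0<..t}"
            using i by auto
          from continuous_map_compose[OF continuous_map_fst continuous_map_product_projection[OF this]]
          show ?thesis
            using False by (simp add: case_prod_beta' comp_def)
        qed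
      qed (auto simp: PiE_def extensional_def)
      from continuous_map_imp_measurable[OF this] show ?thesis
        using t S by (subst measurable_cong_sets[OF sets_borel_of_prod[symmetric] refl])
          (auto simp: second_countable_paths polish_topology_iff)
    qed
    have KJ: "distr (distr M ?R ?J) (?P (Suc t)) ?K = distr M (?P (Suc t)) (?r (Suc t))" if M: "?J \<in> M \<rightarrow>\<^sub>M ?R" for M
    proof -
      have "distr (distr M ?R ?J) (?P (Suc t)) ?K = distr M (?P (Suc t)) (?K \<circ> ?J)"
        by (rule distr_distr[OF K M])
      also have "?K \<circ> ?J = ?r (Suc t)"
        by (auto simp: fun_eq_iff restrict_def)
      finally show ?thesis .
    qed
    show ?case
      unfolding KJ[OF J(1), symmetric] KJ[OF J(2), symmetric] eq ..
  qed
  from this[of T] have "distr m' (?P T) (?r T) = distr m (?P T) (?r T)"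
    by simp
  moreover have "distr M (?P T) (?r T) = M" if "sets M = sets (?P T)" for M
  proof -
    have "distr M (?P T) (?r T) = distr M M (\<lambda>x. x)"
    proof (rule distr_cong)
      fix x assume "x \<in> space M"
      then show "?r T x = x"
        using sets_eq_imp_space_eq[OF that] by (auto simp: PiE_def extensional_restrict)
    qed (simp_all add: that)
    then show ?thesis
      by simp
  qed
  ultimately show ?thesis
    using sets by simp
qed

text \<open>A form of uniqueness fitted to marginals: the one-step condition is an integral over the
  plan \<open>Q\<close> itself, where the kernels of the plan are available, and no joint history
  needs to be projected first.\<close>

lemma law_of_projection:
  assumes Q: "prob_space Q" and Z: "Z \<in> Q \<rightarrow>\<^sub>M borel_of (product_topology S {0<..T})"
    and ker: "\<And>t A C. t < T \<Longrightarrow> A \<in> sets (borel_of (product_topology S {0<..t})) \<Longrightarrow> C \<in> sets (borel_of (S (Suc t))) \<Longrightarrow>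
      emeasure Q {\<omega> \<in> space Q. restrict (Z \<omega>) {0<..t} \<in> A \<and> Z \<omega> (Suc t) \<in> C} =
      (\<integral>\<^sup>+\<omega>. emeasure (k t (at_time s0 (Z \<omega>) t)) C * indicator A (restrict (Z \<omega>) {0<..t}) \<partial>Q)"
  shows "distr Q (borel_of (product_topology S {0<..T})) Z = m"
proof (rule law_unique)
  let ?P = "borel_of (product_topology S {0<..T})"
  let ?m = "distr Q ?P Z"
  show "?m \<in> probs (product_topology S {0<..T})"
    using prob_space.prob_space_distr[OF Q Z] by (simp add: probs_def)
  fix t assume t: "t < T"
  let ?H = "borel_of (product_topology S {0<..t})" and ?r = "\<lambda>xs. restrict xs {0<..t}"
  have k: "(\<lambda>xs. k t (at_time s0 xs t)) \<in> ?H \<rightarrow>\<^sub>M prob_algebra (borel_of (S (Suc t)))"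
    using k[OF t] by (simp add: regular_cond_kernel_def)
  have rm: "?r \<in> ?P \<rightarrow>\<^sub>M ?H"
    using t by (intro restrict_measurable) simp
  show "regular_cond_kernel ?m ?H (borel_of (S (Suc t))) ?r (\<lambda>xs. xs (Suc t)) (\<lambda>xs. k t (at_time s0 xs t))"
    unfolding regular_cond_kernel_def
  proof (intro conjI ballI k)
    fix A C assume A: "A \<in> sets ?H" and C: "C \<in> sets (borel_of (S (Suc t)))"
    let ?S = "{xs \<in> space ?m. ?r xs \<in> A \<and> xs (Suc t) \<in> C}"
    have "?S = (?r -` A \<inter> space ?P) \<inter> ((\<lambda>xs. xs (Suc t)) -` C \<inter> space ?P)"
      by auto
    also have "\<dots> \<in> sets ?P"
      using t by (intro sets.Int measurable_sets[OF rm A] measurable_sets[OF eval_measurable C]) auto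
    finally have S: "?S \<in> sets ?P" .
    have "emeasure ?m ?S = emeasure Q (Z -` ?S \<inter> space Q)"
      by (rule emeasure_distr[OF Z S])
    also have "Z -` ?S \<inter> space Q = {\<omega> \<in> space Q. ?r (Z \<omega>) \<in> A \<and> Z \<omega> (Suc t) \<in> C}"
      using measurable_space[OF Z] by (auto simp del: space_borel_of)
    also have "emeasure Q \<dots> = (\<integral>\<^sup>+\<omega>. emeasure (k t (at_time s0 (?r (Z \<omega>)) t)) C * indicator A (?r (Z \<omega>)) \<partial>Q)"
      unfolding ker[OF t A C] by (intro nn_integral_cong) (simp add: at_time_def)
    also have "\<dots> = (\<integral>\<^sup>+u. emeasure (k t (at_time s0 u t)) C * indicator A u \<partial>distr Q ?H (?r \<circ> Z))"
      using measurable_comp[OF Z rm] A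
        measurable_compose[OF measurable_prob_algebraD[OF k] measurable_emeasure_subprob_algebra[OF C]]
      by (subst nn_integral_distr) (auto intro: borel_measurable_times_ennreal)
    also have "distr Q ?H (?r \<circ> Z) = distr ?m ?H ?r"
      by (rule distr_distr[OF rm Z, symmetric])
    finally show "emeasure ?m ?S = (\<integral>\<^sup>+u. emeasure (k t (at_time s0 u t)) C * indicator A u \<partial>distr ?m ?H ?r)" .
  qed
qed

end

section \<open>The transport problem\<close>

text \<open>Covers time 0: \<open>setting\<close> requires Polish topologies at the times from 1 on
  and a one-point carrier at time 0.\<close>

lemma polish_topology_singleton:
  assumes "topspace S = {a}"
  shows "polish_topology S"
proof -
  have "openin S {a}"
    using openin_topspace[of S] assms by simp
  then have "discrete_topology {a} = S"
    using assms by (auto simp: discrete_topology_unique)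
  moreover have "polish_topology (discrete_topology {a})"
    by (simp add: polish_topology_iff completely_metrizable_space_discrete_topology second_countable_discrete_topology)
  ultimately show ?thesis
    by simp
qed

lemma measurable_prob_space_kernel:
  assumes "K \<in> M \<rightarrow>\<^sub>M prob_algebra N" "x \<in> space M"
  shows "prob_space (K x)" "sets (K x) = sets N" "space (K x) = space N"
  using measurable_space[OF assms] sets_eq_imp_space_eq[of "K x" N] by (auto simp: space_prob_algebra)

lemma prob_space_uniform_count_measure: "finite X \<Longrightarrow> X \<noteq> {} \<Longrightarrow> prob_space (uniform_count_measure X)"
  by (intro prob_spaceI) (simp add: emeasure_uniform_count_measure space_uniform_count_measure
      ennreal_of_nat_eq_real_of_nat flip: ennreal_mult)

text \<open>Enlarge each section {x} \<times> C_x to X \<times> C_x; these finitely many cylinders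
  cover C and have mass \<beta>(C_x). The sum over x is the mass of C under counting measure times
  \<beta>, and the factor \<open>card X\<close> compensates for normalizing the counting measure to
  a probability.\<close>

lemma coupling_dominated:
  assumes X: "finite X" "X \<noteq> {}" and \<beta>: "prob_space \<beta>" "sets \<beta> = sets N"
    and \<gamma>: "sets \<gamma> = sets (uniform_count_measure X \<Otimes>\<^sub>M N)" "distr \<gamma> N snd = \<beta>"
    and C: "C \<in> sets (uniform_count_measure X \<Otimes>\<^sub>M N)"
  shows "emeasure \<gamma> C \<le> ennreal (real (card X)) * emeasure (uniform_count_measure X \<Otimes>\<^sub>M \<beta>) C"
proof -
  interpret \<beta>: prob_space \<beta> by fact
  let ?D = "\<lambda>x. Pair x -` C"
  have D: "?D x \<in> sets N" for x
    by (rule sets_Pair1[OF C])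
  have sp: "space \<gamma> = X \<times> space N"
    using sets_eq_imp_space_eq[OF \<gamma>(1)] by (simp add: space_pair_measure space_uniform_count_measure)
  have e: "emeasure \<gamma> (X \<times> E) = emeasure \<beta> E" if "E \<in> sets N" for E
  proof -
    have "snd \<in> \<gamma> \<rightarrow>\<^sub>M N"
      using measurable_snd[of "uniform_count_measure X" N] by (simp cong: measurable_cong_sets add: \<gamma>(1))
    then have "emeasure \<beta> E = emeasure \<gamma> (snd -` E \<inter> space \<gamma>)"
      unfolding \<gamma>(2)[symmetric] using that by (rule emeasure_distr)
    also have "snd -` E \<inter> space \<gamma> = X \<times> E"
      using sets.sets_into_space[OF that] by (auto simp: sp)
    finally show ?thesis ..
  qed
  have XE: "X \<times> E \<in> sets \<gamma>" if "E \<in> sets N" for E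
    unfolding \<gamma>(1) using that by (intro pair_measureI) (auto simp: sets_uniform_count_measure)
  have "C \<subseteq> (\<Union>x\<in>X. X \<times> ?D x)"
    using sets.sets_into_space[OF C] by (auto simp: space_pair_measure space_uniform_count_measure)
  then have "emeasure \<gamma> C \<le> emeasure \<gamma> (\<Union>x\<in>X. X \<times> ?D x)"
    using X(1) D XE by (intro emeasure_mono) auto
  also have "\<dots> \<le> (\<Sum>x\<in>X. emeasure \<gamma> (X \<times> ?D x))"
    using X(1) D XE by (intro emeasure_subadditive_finite) auto
  also have "\<dots> = (\<Sum>x\<in>X. emeasure \<beta> (?D x))"
    using e D by simp
  finally have 1: "emeasure \<gamma> C \<le> (\<Sum>x\<in>X. emeasure \<beta> (?D x))" .
  have "C \<in> sets (uniform_count_measure X \<Otimes>\<^sub>M \<beta>)"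
    using C sets_pair_measure_cong[OF refl \<beta>(2)] by metis
  then have "emeasure (uniform_count_measure X \<Otimes>\<^sub>M \<beta>) C = (\<integral>\<^sup>+x. emeasure \<beta> (?D x) \<partial>uniform_count_measure X)"
    by (rule \<beta>.emeasure_pair_measure_alt)
  also have "\<dots> = ennreal (1 / real (card X)) * (\<Sum>x\<in>X. emeasure \<beta> (?D x))"
    unfolding uniform_count_measure_def nn_integral_point_measure_finite[OF X(1)] by (simp add: sum_distrib_left)
  finally have "ennreal (real (card X)) * emeasure (uniform_count_measure X \<Otimes>\<^sub>M \<beta>) C =
      ennreal (real (card X)) * ennreal (1 / real (card X)) * (\<Sum>x\<in>X. emeasure \<beta> (?D x))"
    by (simp only: mult.assoc)
  also have "ennreal (real (card X)) * ennreal (1 / real (card X)) = 1"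
    using X by (subst ennreal_mult[symmetric]) auto
  finally show ?thesis
    using 1 by simp
qed

lemma cancel_diff_self: "a \<noteq> -\<infinity> \<Longrightarrow> cancel_diff a a = 0"
  by (cases a) (auto simp: cancel_diff_def)

locale transport =
  fixes P :: "('d::finite) problem"
  assumes setting: "setting P" and A1: "asm_A1 P" and A2: "asm_A2 P" and A3: "asm_A3 P"
    and A4: "asm_A4 P" and M1: "asm_M1 P"
begin

abbreviation T :: nat where "T \<equiv> horizon P"

abbreviation B :: "nat \<Rightarrow> 'd state measure" where "B t \<equiv> borel_of (ZT P t)"

abbreviation BP :: "nat \<Rightarrow> nat \<Rightarrow> ('d path \<times> 'd path) measure" where "BP s t \<equiv> borel_of (ZP P s t)"

lemma polish_XY: "t \<le> T \<Longrightarrow> polish_topology (TX P t)" "t \<le> T \<Longrightarrow> polish_topology (TY P t)"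
proof -
  assume t: "t \<le> T"
  have "topspace (TX P 0) = {x0 P}" "topspace (TY P 0) = {y0 P}"
    "\<forall>t\<in>{1..T}. polish_topology (TX P t) \<and> polish_topology (TY P t)"
    using setting by (auto simp: setting_def)
  with t show "polish_topology (TX P t)" "polish_topology (TY P t)"
    using polish_topology_singleton by (cases "t = 0"; force)+
qed

sublocale X: markov_law "TX P" T "x0 P" "mu P" "kmu P"
  using polish_XY setting M1 by unfold_locales (auto simp: setting_def asm_M1_def)

sublocale Y: markov_law "TY P" T "y0 P" "nu P" "knu P"
  using polish_XY setting M1 by unfold_locales (auto simp: setting_def asm_M1_def)

section \<open>State spaces and path spaces\<close>

lemma polish_Z: "t \<le> T \<Longrightarrow> polish_topology (ZT P t)"
  by (intro polish_prod_topology polish_XY)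

lemma second_countable_Z: "t \<le> T \<Longrightarrow> second_countable (ZT P t)"
  using polish_Z by (simp add: polish_topology_iff)

lemma second_countable_ZP: "t \<le> T \<Longrightarrow> second_countable (ZP P s t)"
  by (intro second_countable_prod_topology X.second_countable_paths Y.second_countable_paths)

lemma sets_B: "t \<le> T \<Longrightarrow> sets (B t) = sets (borel_of (TX P t) \<Otimes>\<^sub>M borel_of (TY P t))"
  using polish_XY by (intro sets_borel_of_prod) (auto simp: polish_topology_iff)

lemma continuous_map_state:
  assumes "s < k" "k \<le> t"
  shows "continuous_map (ZP P s t) (ZT P k) (\<lambda>(xs, ys). (xs k, ys k))"
proof -
  have k: "k \<in> {s<..t}"
    using assms by simp
  have "continuous_map (ZP P s t) (TX P k) ((\<lambda>xs. xs k) \<circ> fst)"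
    by (rule continuous_map_compose[OF continuous_map_fst continuous_map_product_projection[OF k]])
  moreover have "continuous_map (ZP P s t) (TY P k) ((\<lambda>ys. ys k) \<circ> snd)"
    by (rule continuous_map_compose[OF continuous_map_snd continuous_map_product_projection[OF k]])
  ultimately show ?thesis
    by (simp add: continuous_map_pairwise case_prod_beta' comp_def)
qed

lemma state_measurable:
  "s < k \<Longrightarrow> k \<le> t \<Longrightarrow> (\<lambda>(xs, ys). (xs k, ys k)) \<in> BP s t \<rightarrow>\<^sub>M B k"
  by (intro continuous_map_imp_measurable continuous_map_state)

text \<open>The update inside \<open>prepend\<close>, named so that its joint continuity in state
  and path can be used.\<close>

definition upd :: "nat \<Rightarrow> 'd state \<Rightarrow> 'd path \<times> 'd path \<Rightarrow> 'd path \<times> 'd path" where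
  "upd t w = (\<lambda>(xs, ys). (xs(Suc t := fst w), ys(Suc t := snd w)))"

lemma continuous_map_upd:
  assumes t: "t < u"
  shows "continuous_map (prod_topology (ZT P (Suc t)) (ZP P (Suc t) u)) (ZP P t u) (\<lambda>(w, \<omega>). upd t w \<omega>)"
proof -
  let ?D = "prod_topology (ZT P (Suc t)) (ZP P (Suc t) u)"
  have f: "continuous_map ?D (TX P (Suc t)) (\<lambda>z. fst (fst z))" "continuous_map ?D (TY P (Suc t)) (\<lambda>z. snd (fst z))"
    by (rule continuous_map_compose[OF continuous_map_fst continuous_map_fst, unfolded comp_def])
      (rule continuous_map_compose[OF continuous_map_fst continuous_map_snd, unfolded comp_def])
  have g: "continuous_map ?D (XP P (Suc t) u) (\<lambda>z. fst (snd z))" "continuous_map ?D (YP P (Suc t) u) (\<lambda>z. snd (snd z))"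
    by (rule continuous_map_compose[OF continuous_map_snd continuous_map_fst, unfolded comp_def])
      (rule continuous_map_compose[OF continuous_map_snd continuous_map_snd, unfolded comp_def])
  have X: "continuous_map ?D (XP P t u) (\<lambda>z. (fst (snd z))(Suc t := fst (fst z)))"
    unfolding continuous_map_componentwise
  proof (intro conjI ballI)
    show "(\<lambda>z. (fst (snd z))(Suc t := fst (fst z))) ` topspace ?D \<subseteq> extensional {t<..u}"
      using t by (auto simp: PiE_def extensional_def)
    fix i assume i: "i \<in> {t<..u}"
    show "continuous_map ?D (TX P i) (\<lambda>z. ((fst (snd z))(Suc t := fst (fst z))) i)"
    proof (cases "i = Suc t")
      case False
      then have "i \<in> {Suc t<..u}"
        using i by auto
      from continuous_map_compose[OF g(1) continuous_map_product_projection[OF this]] False show ?thesis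
        by (simp add: comp_def)
    qed (use f(1) in simp)
  qed
  have Y: "continuous_map ?D (YP P t u) (\<lambda>z. (snd (snd z))(Suc t := snd (fst z)))"
    unfolding continuous_map_componentwise
  proof (intro conjI ballI)
    show "(\<lambda>z. (snd (snd z))(Suc t := snd (fst z))) ` topspace ?D \<subseteq> extensional {t<..u}"
      using t by (auto simp: PiE_def extensional_def)
    fix i assume i: "i \<in> {t<..u}"
    show "continuous_map ?D (TY P i) (\<lambda>z. ((snd (snd z))(Suc t := snd (fst z))) i)"
    proof (cases "i = Suc t")
      case False
      then have "i \<in> {Suc t<..u}"
        using i by auto
      from continuous_map_compose[OF g(2) continuous_map_product_projection[OF this]] False show ?thesis
        by (simp add: comp_def)
    qed (use f(2) in simp)
  qed
  have "continuous_map ?D (ZP P t u)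
      (\<lambda>z. ((fst (snd z))(Suc t := fst (fst z)), (snd (snd z))(Suc t := snd (fst z))))"
    using X Y by (simp add: continuous_map_pairwise comp_def)
  then show ?thesis
    by (simp add: upd_def case_prod_beta')
qed

lemma upd_measurable:
  assumes t: "t < T"
  shows "(\<lambda>(w, \<omega>). upd t w \<omega>) \<in> B (Suc t) \<Otimes>\<^sub>M BP (Suc t) T \<rightarrow>\<^sub>M BP t T"
proof -
  have "sets (borel_of (prod_topology (ZT P (Suc t)) (ZP P (Suc t) T))) = sets (B (Suc t) \<Otimes>\<^sub>M BP (Suc t) T)"
    using t by (intro sets_borel_of_prod second_countable_Z second_countable_ZP) auto
  then show ?thesis
    using continuous_map_imp_measurable[OF continuous_map_upd[OF t]] by (simp cong: measurable_cong_sets)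
qed

lemma upd_measurable1:
  assumes "t < T" "w \<in> topspace (ZT P (Suc t))"
  shows "upd t w \<in> BP (Suc t) T \<rightarrow>\<^sub>M BP t T"
  using measurable_compose[OF measurable_Pair1' upd_measurable[OF assms(1)], of w] assms(2) by simp

section \<open>Concatenation of kernels and integrals over concatenated paths\<close>

lemma prepend_eq: "prepend P t \<gamma> K = bind \<gamma> (\<lambda>w. distr (K w) (BP t T) (upd t w))"
  by (simp add: prepend_def upd_def)

lemma distr_upd_kernel:
  assumes t: "t < T" and K: "K \<in> B (Suc t) \<rightarrow>\<^sub>M prob_algebra (BP (Suc t) T)"
  shows "(\<lambda>w. distr (K w) (BP t T) (upd t w)) \<in> B (Suc t) \<rightarrow>\<^sub>M prob_algebra (BP t T)"
  by (rule measurable_distr_prob_space2[OF K upd_measurable[OF t]])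

lemma prepend_kernel:
  assumes t: "t < T" and q: "q \<in> M \<rightarrow>\<^sub>M prob_algebra (B (Suc t))"
    and K: "K \<in> B (Suc t) \<rightarrow>\<^sub>M prob_algebra (BP (Suc t) T)"
  shows "(\<lambda>z. prepend P t (q z) K) \<in> M \<rightarrow>\<^sub>M prob_algebra (BP t T)"
  unfolding prepend_eq by (rule measurable_bind_prob_space[OF q distr_upd_kernel[OF t K]])

text \<open>A single measure is a constant kernel on some nonempty discrete space.\<close>

lemma prepend_space:
  assumes t: "t < T" and \<gamma>: "\<gamma> \<in> space (prob_algebra (B (Suc t)))"
    and K: "K \<in> B (Suc t) \<rightarrow>\<^sub>M prob_algebra (BP (Suc t) T)"
  shows "prepend P t \<gamma> K \<in> space (prob_algebra (BP t T))"
  using measurable_space[OF prepend_kernel[OF t measurable_const[OF \<gamma>] K], of undefined "count_space UNIV"] by simp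

lemma ext_integral_prepend:
  assumes t: "t < T" and \<gamma>: "\<gamma> \<in> space (prob_algebra (B (Suc t)))"
    and K: "K \<in> B (Suc t) \<rightarrow>\<^sub>M prob_algebra (BP (Suc t) T)"
    and F: "F \<in> borel_measurable (BP t T)" "0 \<le> c" "\<And>\<omega>. \<omega> \<in> topspace (ZP P t T) \<Longrightarrow> - ereal c \<le> F \<omega>"
  shows "ext_integral (prepend P t \<gamma> K) F = ext_integral \<gamma> (\<lambda>w. ext_integral (K w) (\<lambda>\<omega>. F (upd t w \<omega>)))"
proof -
  have \<gamma>': "prob_space \<gamma>" "sets \<gamma> = sets (B (Suc t))"
    using \<gamma> by (auto simp: space_prob_algebra)
  have k: "(\<lambda>w. distr (K w) (BP t T) (upd t w)) \<in> \<gamma> \<rightarrow>\<^sub>M prob_algebra (BP t T)"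
    using distr_upd_kernel[OF t K] by (simp cong: measurable_cong_sets add: \<gamma>'(2))
  have "ext_integral (prepend P t \<gamma> K) F = ext_integral \<gamma> (\<lambda>w. ext_integral (distr (K w) (BP t T) (upd t w)) F)"
    unfolding prepend_eq using F by (intro ext_integral_bind[OF \<gamma>'(1) k, where K=c]) auto
  also have "\<dots> = ext_integral \<gamma> (\<lambda>w. ext_integral (K w) (\<lambda>\<omega>. F (upd t w \<omega>)))"
  proof (rule ext_integral_cong)
    fix w assume "w \<in> space \<gamma>"
    then have w: "w \<in> topspace (ZT P (Suc t))"
      using sets_eq_imp_space_eq[OF \<gamma>'(2)] by simp
    have "sets (K w) = sets (BP (Suc t) T)"
      using w by (intro measurable_prob_space_kernel(2)[OF K]) simp
    then have "upd t w \<in> K w \<rightarrow>\<^sub>M BP t T"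
      using upd_measurable1[OF t w] by (simp cong: measurable_cong_sets)
    then show "ext_integral (distr (K w) (BP t T) (upd t w)) F = ext_integral (K w) (\<lambda>\<omega>. F (upd t w \<omega>))"
      by (rule ext_integral_distr[OF _ F(1)])
  qed
  finally show ?thesis .
qed

lemma marginal_kernel:
  assumes "t < k" "k \<le> T" "L \<in> M \<rightarrow>\<^sub>M prob_algebra (BP t T)"
  shows "(\<lambda>z. marginal_at P k (L z)) \<in> M \<rightarrow>\<^sub>M prob_algebra (B k)"
  unfolding marginal_at_def
  by (rule measurable_compose[OF assms(3) measurable_distr_prob_space[OF state_measurable[OF assms(1,2)]]])

lemma ext_integral_marginal:
  assumes "t < k" "k \<le> T" and Q: "sets Q = sets (BP t T)" and f: "f \<in> borel_measurable (B k)"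
  shows "ext_integral (marginal_at P k Q) f = ext_integral Q (\<lambda>(xs, ys). f (xs k, ys k))"
proof -
  have "(\<lambda>(xs, ys). (xs k, ys k)) \<in> Q \<rightarrow>\<^sub>M B k"
    using state_measurable[OF assms(1,2)] by (simp cong: measurable_cong_sets add: Q)
  from ext_integral_distr[OF this f] show ?thesis
    by (simp add: marginal_at_def case_prod_beta')
qed

text \<open>The update overwrites coordinate \<open>Suc t\<close> by w and leaves the later ones
  alone, so \<open>f\<close> sees the first step if k = Suc t and the continuation
  otherwise.\<close>

lemma ext_integral_marginal_prepend:
  assumes t: "t < T" and \<gamma>: "\<gamma> \<in> space (prob_algebra (B (Suc t)))"
    and K: "K \<in> B (Suc t) \<rightarrow>\<^sub>M prob_algebra (BP (Suc t) T)"
    and k: "t < k" "k \<le> T"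
    and f: "f \<in> borel_measurable (B k)" "0 \<le> c" "\<And>w. w \<in> topspace (ZT P k) \<Longrightarrow> - ereal c \<le> f w"
  shows "ext_integral (marginal_at P k (prepend P t \<gamma> K)) f =
    ext_integral \<gamma> (\<lambda>w. if k = Suc t then f w else ext_integral (marginal_at P k (K w)) f)"
proof -
  have sets: "sets (prepend P t \<gamma> K) = sets (BP t T)"
    using prepend_space[OF t \<gamma> K] by (simp add: space_prob_algebra)
  let ?F = "\<lambda>(xs, ys). f (xs k, ys k)"
  have F: "?F \<in> borel_measurable (BP t T)"
    using measurable_compose[OF state_measurable[OF k] f(1)] by (simp add: case_prod_beta')
  have Fb: "- ereal c \<le> ?F \<omega>" if "\<omega> \<in> topspace (ZP P t T)" for \<omega>
    using measurable_space[OF state_measurable[OF k], of \<omega>] that f(3) by (auto simp: case_prod_beta')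
  have "ext_integral (marginal_at P k (prepend P t \<gamma> K)) f = ext_integral (prepend P t \<gamma> K) ?F"
    by (rule ext_integral_marginal[OF k sets f(1)])
  also have "\<dots> = ext_integral \<gamma> (\<lambda>w. ext_integral (K w) (\<lambda>\<omega>. ?F (upd t w \<omega>)))"
    by (rule ext_integral_prepend[OF t \<gamma> K F f(2) Fb])
  also have "\<dots> = ext_integral \<gamma> (\<lambda>w. if k = Suc t then f w else ext_integral (marginal_at P k (K w)) f)"
  proof (rule ext_integral_cong)
    fix w assume "w \<in> space \<gamma>"
    then have w: "w \<in> space (B (Suc t))"
      using \<gamma> sets_eq_imp_space_eq[of \<gamma> "B (Suc t)"] by (auto simp: space_prob_algebra)
    note Kw = measurable_prob_space_kernel[OF K w]
    show "ext_integral (K w) (\<lambda>\<omega>. ?F (upd t w \<omega>)) = (if k = Suc t then f w else ext_integral (marginal_at P k (K w)) f)"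
    proof (cases "k = Suc t")
      case True
      then have "ext_integral (K w) (\<lambda>\<omega>. ?F (upd t w \<omega>)) = ext_integral (K w) (\<lambda>_. f w)"
        by (intro ext_integral_cong) (auto simp: upd_def)
      then show ?thesis
        using True ext_integral_const[OF Kw(1)] by simp
    next
      case False
      then have "Suc t < k"
        using k by simp
      from ext_integral_marginal[OF this k(2) Kw(2) f(1)] False show ?thesis
        by (auto simp: upd_def case_prod_beta')
    qed
  qed
  finally show ?thesis .
qed

text \<open>Stated with \<open>prob_algebra\<close>, in which kernels can be composed and
  integrated; Borel measurability for the weak topology is translated into this form. Only times
  from t on are mentioned, as the backward construction has chosen no others yet.\<close>

definition kern :: "'d kernels \<Rightarrow> nat \<Rightarrow> bool" where
  "kern p t \<longleftrightarrow> (\<forall>s. t \<le> s \<and> s < T \<longrightarrow> p s \<in> B s \<rightarrow>\<^sub>M prob_algebra (B (Suc s)))"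

lemma kernD: "kern p t \<Longrightarrow> t \<le> s \<Longrightarrow> s < T \<Longrightarrow> p s \<in> B s \<rightarrow>\<^sub>M prob_algebra (B (Suc s))"
  by (simp add: kern_def)

lemma kern_mono: "kern p t \<Longrightarrow> t \<le> s \<Longrightarrow> kern p s"
  by (simp add: kern_def)

lemma concat_less: "t < T \<Longrightarrow> concat_kernels P p t z = deviate P p t (p t z)"
  by (subst concat_kernels.simps) (simp add: deviate_def)

lemma concat_kernel:
  assumes "t \<le> T" "kern p t"
  shows "concat_kernels P p t \<in> B t \<rightarrow>\<^sub>M prob_algebra (BP t T)"
  using assms
proof (induction rule: inc_induct)
  case base
  have "(\<lambda>_. undefined, \<lambda>_. undefined) \<in> space (BP T T)"
    by simp
  then have "return (BP T T) (\<lambda>_. undefined, \<lambda>_. undefined) \<in> space (prob_algebra (BP T T))"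
    by (auto simp: space_prob_algebra intro: prob_space_return)
  moreover have "concat_kernels P p T = (\<lambda>z. return (BP T T) (\<lambda>_. undefined, \<lambda>_. undefined))"
    by (subst concat_kernels.simps) simp
  ultimately show ?case
    by simp
next
  case (step t)
  then have p': "kern p (Suc t)"
    by (auto intro: kern_mono)
  have "(\<lambda>z. prepend P t (p t z) (concat_kernels P p (Suc t))) \<in> B t \<rightarrow>\<^sub>M prob_algebra (BP t T)"
    using step.hyps by (intro prepend_kernel kernD[OF step.prems] step.IH[OF p']) auto
  then show ?case
    using step by (subst measurable_cong[OF concat_less]) (simp_all add: deviate_def)
qed

lemma deviate_space:
  assumes "t < T" "kern p (Suc t)" "\<gamma> \<in> space (prob_algebra (B (Suc t)))"
  shows "deviate P p t \<gamma> \<in> space (prob_algebra (BP t T))"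
  unfolding deviate_def using assms by (intro prepend_space concat_kernel) auto

section \<open>Measurability and lower bounds of the costs, b and g\<close>

lemma cost_measurable:
  assumes "i \<le> T" "1 \<le> k" "k \<le> T"
  shows "(\<lambda>(v, w). ereal (cost P i k v w)) \<in> borel_measurable (B i \<Otimes>\<^sub>M B k)"
proof -
  have "lsc_on (prod_topology (ZT P i) (ZT P k)) (\<lambda>(z, w). cost P i k z w)"
    using A2 assms by (auto simp: asm_A2_def)
  then have "(\<lambda>(z, w). cost P i k z w) \<in> borel_measurable (borel_of (prod_topology (ZT P i) (ZT P k)))"
    by (rule lsc_on_imp_measurable)
  then have "(\<lambda>(z, w). cost P i k z w) \<in> borel_measurable (B i \<Otimes>\<^sub>M B k)"
    using assms by (simp cong: measurable_cong_sets add: sets_borel_of_prod second_countable_Z)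
  then show ?thesis
    using borel_measurable_ereal by (fastforce simp: case_prod_beta')
qed

lemma cost_measurable1:
  assumes "i \<le> T" "1 \<le> k" "k \<le> T" "v \<in> topspace (ZT P i)"
  shows "(\<lambda>w. ereal (cost P i k v w)) \<in> borel_measurable (B k)"
  using measurable_compose[OF measurable_Pair1' cost_measurable[OF assms(1-3)], of v] assms(4) by simp

lemma h_measurable: "(\<lambda>w. ereal (hfun P w)) \<in> borel_measurable (B T)"
  using A3 lsc_on_imp_measurable[of "ZT P T" "hfun P"] by (auto simp: asm_A3_def)

text \<open>One lower bound for all costs and for h. It exists because only finitely many pairs of
  times occur, and it rules out \<infinity> - \<infinity> in every sum of integrals below.\<close>

definition low :: real where
  "low = (SOME K. 0 \<le> K \<and> (\<forall>i\<le>T. \<forall>k\<in>{1..T}. \<forall>v\<in>topspace (ZT P i). \<forall>w\<in>topspace (ZT P k). - K \<le> cost P i k v w) \<and>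
     (\<forall>w\<in>topspace (ZT P T). - K \<le> hfun P w))"

lemma low: "0 \<le> low"
  "\<And>i k v w. i \<le> T \<Longrightarrow> 1 \<le> k \<Longrightarrow> k \<le> T \<Longrightarrow> v \<in> topspace (ZT P i) \<Longrightarrow> w \<in> topspace (ZT P k) \<Longrightarrow> - low \<le> cost P i k v w"
  "\<And>w. w \<in> topspace (ZT P T) \<Longrightarrow> - low \<le> hfun P w"
proof -
  have "\<exists>b. \<forall>v\<in>topspace (ZT P i). \<forall>w\<in>topspace (ZT P k). b \<le> cost P i k v w" if "i \<le> T" "k \<in> {1..T}" for i k
  proof -
    have "bdd_below ((\<lambda>(z, w). cost P i k z w) ` (topspace (ZT P i) \<times> topspace (ZT P k)))"
      using A2 that by (auto simp: asm_A2_def)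
    then show ?thesis
      unfolding bdd_below_def by (elim exE) (rule exI, force)
  qed
  then have "\<forall>i k. \<exists>b. i \<le> T \<and> k \<in> {1..T} \<longrightarrow> (\<forall>v\<in>topspace (ZT P i). \<forall>w\<in>topspace (ZT P k). b \<le> cost P i k v w)"
    by blast
  then obtain b where b: "\<And>i k v w. i \<le> T \<Longrightarrow> k \<in> {1..T} \<Longrightarrow> v \<in> topspace (ZT P i) \<Longrightarrow> w \<in> topspace (ZT P k) \<Longrightarrow> b i k \<le> cost P i k v w"
    by metis
  obtain bh where bh: "\<And>w. w \<in> topspace (ZT P T) \<Longrightarrow> bh \<le> hfun P w"
    using A3 unfolding asm_A3_def bdd_below_def by auto
  define K where "K = \<bar>bh\<bar> + (\<Sum>i\<le>T. \<Sum>k\<le>T. \<bar>b i k\<bar>)"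
  have "\<bar>b i k\<bar> \<le> (\<Sum>i\<le>T. \<Sum>k\<le>T. \<bar>b i k\<bar>)" if "i \<le> T" "k \<le> T" for i k
  proof -
    have "\<bar>b i k\<bar> \<le> (\<Sum>k\<le>T. \<bar>b i k\<bar>)"
      using that by (intro member_le_sum) auto
    also have "\<dots> \<le> (\<Sum>i\<le>T. \<Sum>k\<le>T. \<bar>b i k\<bar>)"
      using that by (intro member_le_sum[of i "{..T}" "\<lambda>i. \<Sum>k\<le>T. \<bar>b i k\<bar>"]) (auto intro: sum_nonneg)
    finally show ?thesis .
  qed
  then have bK: "- K \<le> b i k" if "i \<le> T" "k \<le> T" for i k
    using that unfolding K_def by (smt (verit))
  have nn: "0 \<le> (\<Sum>i\<le>T. \<Sum>k\<le>T. \<bar>b i k\<bar>)"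
    by (intro sum_nonneg) auto
  have "\<exists>K. 0 \<le> K \<and> (\<forall>i\<le>T. \<forall>k\<in>{1..T}. \<forall>v\<in>topspace (ZT P i). \<forall>w\<in>topspace (ZT P k). - K \<le> cost P i k v w) \<and>
     (\<forall>w\<in>topspace (ZT P T). - K \<le> hfun P w)"
  proof (intro exI[of _ K] conjI allI ballI impI)
    show "0 \<le> K"
      using nn by (simp add: K_def)
    show "- K \<le> cost P i k v w" if "i \<le> T" "k \<in> {1..T}" "v \<in> topspace (ZT P i)" "w \<in> topspace (ZT P k)" for i k v w
      using bK[of i k] b[OF that] that(1,2) by auto
    show "- K \<le> hfun P w" if "w \<in> topspace (ZT P T)" for w
      using bh[OF that] nn unfolding K_def by linarith
  qed
  from someI_ex[OF this] have *: "0 \<le> low \<and> (\<forall>i\<le>T. \<forall>k\<in>{1..T}. \<forall>v\<in>topspace (ZT P i). \<forall>w\<in>topspace (ZT P k). - low \<le> cost P i k v w) \<and>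
     (\<forall>w\<in>topspace (ZT P T). - low \<le> hfun P w)"
    unfolding low_def .
  show "0 \<le> low"
    using * by (elim conjE)
  show "- low \<le> cost P i k v w"
    if "i \<le> T" "1 \<le> k" "k \<le> T" "v \<in> topspace (ZT P i)" "w \<in> topspace (ZT P k)" for i k v w
    using *[THEN conjunct2, THEN conjunct1, rule_format, OF that(1) _ that(4,5)] that(2,3) by simp
  show "- low \<le> hfun P w" if "w \<in> topspace (ZT P T)" for w
    using *[THEN conjunct2, THEN conjunct2, rule_format, OF that] .
qed

lemma marginal_concat:
  assumes "s < k" "k \<le> T" "kern p s"
  shows "(\<lambda>z. marginal_at P k (concat_kernels P p s z)) \<in> B s \<rightarrow>\<^sub>M prob_algebra (B k)"
  using assms by (intro marginal_kernel[OF assms(1,2)] concat_kernel) auto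

text \<open>Joint measurability is used in two ways: on the diagonal v = z in the value of the plan,
  and with v as the parameter and z as the integration variable in the minimization.\<close>

lemma b_fun_measurable:
  assumes "s < k" "k \<le> T" "kern p s" "i \<le> T"
  shows "(\<lambda>(v, z). b_fun P p k i v s z) \<in> borel_measurable (B i \<Otimes>\<^sub>M B s)"
proof -
  have 1: "(\<lambda>q. marginal_at P k (concat_kernels P p s (snd q))) \<in> B i \<Otimes>\<^sub>M B s \<rightarrow>\<^sub>M prob_algebra (B k)"
    using measurable_compose[OF measurable_snd marginal_concat[OF assms(1-3)], of "B i"] .
  have "(\<lambda>r. (fst (fst r), snd r)) \<in> (B i \<Otimes>\<^sub>M B s) \<Otimes>\<^sub>M B k \<rightarrow>\<^sub>M B i \<Otimes>\<^sub>M B k"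
    by (intro measurable_Pair measurable_compose[OF measurable_fst measurable_fst] measurable_snd)
  from measurable_compose[OF this cost_measurable[OF assms(4) _ assms(2)]]
  have 2: "(\<lambda>(q, w). ereal (cost P i k (fst q) w)) \<in> borel_measurable ((B i \<Otimes>\<^sub>M B s) \<Otimes>\<^sub>M B k)"
    using assms(1) by (simp add: case_prod_beta')
  have "(\<lambda>q. ext_integral (marginal_at P k (concat_kernels P p s (snd q))) (\<lambda>w. ereal (cost P i k (fst q) w)))
      \<in> borel_measurable (B i \<Otimes>\<^sub>M B s)"
    by (rule measurable_ext_integral[OF 1 2])
  then show ?thesis
    by (simp add: b_fun_def case_prod_beta')
qed

lemma b_fun_measurable1:
  assumes "s < k" "k \<le> T" "kern p s" "i \<le> T" "v \<in> topspace (ZT P i)"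
  shows "b_fun P p k i v s \<in> borel_measurable (B s)"
  using measurable_compose[OF measurable_Pair1' b_fun_measurable[OF assms(1-4)], of v] assms(5) by simp

lemma b_fun_ge:
  assumes "s < k" "k \<le> T" "kern p s" "i \<le> T" "v \<in> topspace (ZT P i)" "z \<in> topspace (ZT P s)"
  shows "- ereal low \<le> b_fun P p k i v s z"
proof -
  have z: "z \<in> space (B s)"
    using assms by simp
  note q = measurable_prob_space_kernel[OF marginal_concat[OF assms(1-3)] z]
  have "(\<lambda>w. ereal (cost P i k v w)) \<in> borel_measurable (marginal_at P k (concat_kernels P p s z))"
    using cost_measurable1[of i k v] assms by (simp cong: measurable_cong_sets add: q(2))
  then show ?thesis
    unfolding b_fun_def using q low assms by (intro ext_integral_ge) auto
qed

lemma g_fun_measurable: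
  assumes "s \<le> T" "kern p s"
  shows "g_fun P p s \<in> borel_measurable (B s)"
proof (cases "s = T")
  case True
  then show ?thesis
    using h_measurable by (simp add: g_fun_def[abs_def])
next
  case False
  then have "(\<lambda>z. ext_integral (marginal_at P T (concat_kernels P p s z)) (\<lambda>w. ereal (hfun P w))) \<in> borel_measurable (B s)"
    using assms measurable_compose[OF measurable_snd h_measurable, of "B s"]
    by (intro measurable_ext_integral[OF marginal_concat]) (auto simp: case_prod_beta')
  then show ?thesis
    using False by (simp add: g_fun_def[abs_def])
qed

lemma g_fun_ge:
  assumes "s \<le> T" "kern p s" "z \<in> topspace (ZT P s)"
  shows "- ereal low \<le> g_fun P p s z"
proof (cases "s = T")
  case True
  then show ?thesis
    using low assms by (simp add: g_fun_def)
next
  case False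
  have z: "z \<in> space (B s)"
    using assms by simp
  have s: "s < T"
    using False assms by simp
  note q = measurable_prob_space_kernel[OF marginal_concat[OF s order_refl assms(2)] z]
  have "(\<lambda>w. ereal (hfun P w)) \<in> borel_measurable (marginal_at P T (concat_kernels P p s z))"
    using h_measurable by (simp cong: measurable_cong_sets add: q(2))
  then have "- ereal low \<le> ext_integral (marginal_at P T (concat_kernels P p s z)) (\<lambda>w. ereal (hfun P w))"
    using q low by (intro ext_integral_ge) auto
  then show ?thesis
    using False by (simp add: g_fun_def)
qed

section \<open>The objective of a one-step deviation\<close>

lemma ext_integral_h_deviate:
  assumes t: "t < T" and p: "kern p (Suc t)" and \<gamma>: "\<gamma> \<in> space (prob_algebra (B (Suc t)))"
  shows "ext_integral (marginal_at P T (deviate P p t \<gamma>)) (\<lambda>w. ereal (hfun P w)) = ext_integral \<gamma> (g_fun P p (Suc t))"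
proof -
  have "ext_integral (marginal_at P T (deviate P p t \<gamma>)) (\<lambda>w. ereal (hfun P w)) =
      ext_integral \<gamma> (\<lambda>w. if T = Suc t then ereal (hfun P w)
        else ext_integral (marginal_at P T (concat_kernels P p (Suc t) w)) (\<lambda>w. ereal (hfun P w)))"
    unfolding deviate_def using t p low(1,3)
    by (intro ext_integral_marginal_prepend[where c=low, OF t \<gamma> concat_kernel _ _ h_measurable]) auto
  also have "\<dots> = ext_integral \<gamma> (g_fun P p (Suc t))"
    by (intro ext_integral_cong) (auto simp: g_fun_def)
  finally show ?thesis .
qed

lemma ext_integral_cost_deviate:
  assumes t: "t < T" and p: "kern p (Suc t)" and \<gamma>: "\<gamma> \<in> space (prob_algebra (B (Suc t)))"
    and k: "t < k" "k \<le> T" and v: "i \<le> T" "v \<in> topspace (ZT P i)"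
  shows "ext_integral (marginal_at P k (deviate P p t \<gamma>)) (\<lambda>w. ereal (cost P i k v w)) =
    ext_integral \<gamma> (\<lambda>w. if k = Suc t then ereal (cost P i k v w) else b_fun P p k i v (Suc t) w)"
  unfolding deviate_def b_fun_def using assms low(1,2)
  by (intro ext_integral_marginal_prepend[where c=low, OF t \<gamma> concat_kernel _ _ cost_measurable1]) auto

text \<open>Each cost is at least -\<open>low\<close>, so the extended integral of the sum splits
  into integrals against the one-time marginals.\<close>

lemma objective_eq:
  assumes t: "t < T" and Q: "Q \<in> space (prob_algebra (BP t T))" and z: "z \<in> topspace (ZT P t)"
  shows "objective P t z Q = (\<Sum>k=t+1..T. ext_integral (marginal_at P k Q) (\<lambda>w. ereal (cost P t k z w))) +
    Gext P t z (ext_integral (marginal_at P T Q) (\<lambda>w. ereal (hfun P w)))"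
proof -
  have Q': "prob_space Q" "sets Q = sets (BP t T)"
    using Q by (auto simp: space_prob_algebra)
  have spQ: "space Q = topspace (ZP P t T)"
    using sets_eq_imp_space_eq[OF Q'(2)] by simp
  let ?f = "\<lambda>k (xs, ys). ereal (cost P t k z (xs k, ys k))"
  have "ext_integral Q (\<lambda>(xs, ys). ereal (\<Sum>k=t+1..T. cost P t k z (xs k, ys k))) =
      ext_integral Q (\<lambda>\<omega>. \<Sum>k=t+1..T. ?f k \<omega>)"
    by (intro ext_integral_cong) auto
  also have "\<dots> = (\<Sum>k=t+1..T. ext_integral Q (?f k))"
  proof (rule ext_integral_sum[OF Q'(1), where K="\<lambda>_. low"])
    fix k assume k: "k \<in> {t+1..T}"
    then have k': "t < k" "k \<le> T" "1 \<le> k"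
      by auto
    show "?f k \<in> borel_measurable Q"
      using measurable_compose[OF state_measurable[OF k'(1,2)] cost_measurable1[of t k z]] t z k'
      by (simp cong: measurable_cong_sets add: Q'(2) case_prod_beta')
    show "- ereal low \<le> ?f k \<omega>" if "\<omega> \<in> space Q" for \<omega>
      using measurable_space[OF state_measurable[OF k'(1,2)], of \<omega>] that low(2)[of t k z] t z k'
      by (auto simp: spQ case_prod_beta')
  qed (use low(1) in auto)
  also have "\<dots> = (\<Sum>k=t+1..T. ext_integral (marginal_at P k Q) (\<lambda>w. ereal (cost P t k z w)))"
  proof (rule sum.cong)
    fix k assume k: "k \<in> {t+1..T}"
    then have k': "t < k" "k \<le> T" "1 \<le> k"
      by auto
    show "ext_integral Q (?f k) = ext_integral (marginal_at P k Q) (\<lambda>w. ereal (cost P t k z w))"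
      using t z k' by (subst ext_integral_marginal[OF k'(1,2) Q'(2) cost_measurable1]) auto
  qed simp
  finally show ?thesis
    unfolding objective_def by (rule arg_cong)
qed

lemma objective_deviate:
  assumes t: "t < T" and p: "kern p (Suc t)" and \<gamma>: "\<gamma> \<in> space (prob_algebra (B (Suc t)))"
    and z: "z \<in> topspace (ZT P t)"
  shows "objective P t z (deviate P p t \<gamma>) = reduced_bracket P p t z \<gamma>"
proof -
  have \<gamma>': "prob_space \<gamma>" "sets \<gamma> = sets (B (Suc t))"
    using \<gamma> by (auto simp: space_prob_algebra)
  have sp\<gamma>: "space \<gamma> = topspace (ZT P (Suc t))"
    using sets_eq_imp_space_eq[OF \<gamma>'(2)] by simp
  let ?I = "\<lambda>k. ext_integral \<gamma> (\<lambda>w. if k = Suc t then ereal (cost P t k z w) else b_fun P p k t z (Suc t) w)"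
  have "(\<Sum>k=t+1..T. ext_integral (marginal_at P k (deviate P p t \<gamma>)) (\<lambda>w. ereal (cost P t k z w))) = (\<Sum>k=t+1..T. ?I k)"
    using t z by (intro sum.cong refl ext_integral_cost_deviate[OF t p \<gamma>]) auto
  \<comment> \<open>The term k = t + 1 is an integral of the cost itself against \<gamma>; from k =
    t + 2 on the later kernels intervene through \<open>b_fun\<close>.\<close>
  also have "{t+1..T} = insert (t+1) {t+2..T}"
    using t by auto
  also have "sum ?I (insert (t+1) {t+2..T}) =
      ext_integral \<gamma> (\<lambda>w. ereal (cost P t (t+1) z w)) + (\<Sum>k=t+2..T. ext_integral \<gamma> (b_fun P p k t z (Suc t)))"
    by (subst sum.insert) (auto intro!: sum.cong)
  also have "(\<Sum>k=t+2..T. ext_integral \<gamma> (b_fun P p k t z (Suc t))) = ext_integral \<gamma> (\<lambda>w. \<Sum>k=t+2..T. b_fun P p k t z (Suc t) w)"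
  proof (rule ext_integral_sum[OF \<gamma>'(1), where K="\<lambda>_. low", symmetric])
    fix k assume k: "k \<in> {t+2..T}"
    show "b_fun P p k t z (Suc t) \<in> borel_measurable \<gamma>"
      using b_fun_measurable1[of "Suc t" k p t z] k t z p by (simp cong: measurable_cong_sets add: \<gamma>'(2))
    show "- ereal low \<le> b_fun P p k t z (Suc t) w" if "w \<in> space \<gamma>" for w
      using that k t z p by (intro b_fun_ge) (auto simp: sp\<gamma>)
  qed (use low(1) in auto)
  finally have eq: "(\<Sum>k\<in>insert (t+1) {t+2..T}. ext_integral (marginal_at P k (deviate P p t \<gamma>)) (\<lambda>w. ereal (cost P t k z w))) =
      ext_integral \<gamma> (\<lambda>w. ereal (cost P t (t+1) z w)) + ext_integral \<gamma> (\<lambda>w. \<Sum>k=t+2..T. b_fun P p k t z (Suc t) w)" .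
  have "{t+1..T} = insert (t+1) {t+2..T}"
    using t by auto
  then show ?thesis
    unfolding objective_eq[OF t deviate_space[OF t p \<gamma>] z] reduced_bracket_def ext_integral_h_deviate[OF t p \<gamma>]
    by (simp only: eq) (simp add: ac_simps)
qed

lemma objective_concat:
  assumes t: "t < T" and p: "kern p t" and z: "z \<in> topspace (ZT P t)"
  shows "objective P t z (concat_kernels P p t z) = reduced_bracket P p t z (p t z)"
proof -
  have "p t z \<in> space (prob_algebra (B (Suc t)))"
    using measurable_space[OF kernD[OF p order_refl t]] z by simp
  then show ?thesis
    using objective_deviate[OF t kern_mono[OF p] _ z] by (simp add: concat_less[OF t])
qed

text \<open>The objective of following \<open>p\<close> from time t on, in a form that also makes
  sense at the horizon, where the sum is empty. It is the term at the next state that (DP) subtracts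
  from the next value.\<close>

definition W :: "'d kernels \<Rightarrow> nat \<Rightarrow> 'd state \<Rightarrow> ereal" where
  "W p t z = Gext P t z (g_fun P p t z) + (\<Sum>k=t+1..T. b_fun P p k t z t z)"

lemma objective_concat_W:
  assumes t: "t < T" and p: "kern p t" and z: "z \<in> topspace (ZT P t)"
  shows "objective P t z (concat_kernels P p t z) = W p t z"
proof -
  have "concat_kernels P p t z \<in> space (prob_algebra (BP t T))"
    using measurable_space[OF concat_kernel[OF less_imp_le[OF t] p]] z by simp
  from objective_eq[OF t this z] show ?thesis
    using t by (simp add: W_def b_fun_def g_fun_def add.commute)
qed

section \<open>The monotone extension of G\<close>

lemma G_mono: "t \<le> T \<Longrightarrow> z \<in> topspace (ZT P t) \<Longrightarrow> r \<le> s \<Longrightarrow> Gfun P t z r \<le> Gfun P t z s"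
  using A4 by (auto simp: asm_A4_def mono_def)

lemma Gext_real [simp]: "Gext P t z (ereal r) = ereal (Gfun P t z r)"
  by (simp add: Gext_def)

lemma Gext_PInf: "Gext P t z \<infinity> = (SUP r. ereal (Gfun P t z r))"
  by (simp add: Gext_def flip: infinity_ereal_def)

lemma Gext_mono:
  assumes "t \<le> T" "z \<in> topspace (ZT P t)" "a \<le> b" "a \<noteq> -\<infinity>"
  shows "Gext P t z a \<le> Gext P t z b"
proof (cases b)
  case (real s)
  then show ?thesis
    using assms G_mono by (cases a) auto
next
  case PInf
  then show ?thesis
    using assms by (cases a) (auto simp: Gext_PInf intro: SUP_upper)
qed (use assms in auto)

lemma Gext_not_MInf:
  assumes "e \<noteq> -\<infinity>"
  shows "Gext P t z e \<noteq> -\<infinity>"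
proof (cases e)
  case PInf
  have "ereal (Gfun P t z 0) \<le> (SUP r. ereal (Gfun P t z r))"
    by (rule SUP_upper) simp
  then show ?thesis
    unfolding PInf Gext_PInf by auto
qed (use assms in auto)

text \<open>For a nondecreasing function, lower semicontinuity at a real point gives values close to
  it at smaller arguments: take half the radius of a ball on which G stays above the bound. At
  \<infinity> it is the definition as a supremum.\<close>

lemma Gext_lsc:
  assumes t: "t \<le> T" and z: "z \<in> topspace (ZT P t)" and a: "a < Gext P t z e" and e: "e \<noteq> -\<infinity>"
  shows "\<exists>r. ereal r < e \<and> a < ereal (Gfun P t z r)"
proof (cases e)
  case PInf
  then show ?thesis
    using a by (auto simp: Gext_PInf less_SUP_iff)
next
  case (real s)
  show ?thesis
  proof (cases a)
    case (real b)
    let ?O = "{w \<in> topspace (prod_topology (ZT P t) euclideanreal). b < (\<lambda>(z, r). Gfun P t z r) w}"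
    have "openin (prod_topology (ZT P t) euclideanreal) ?O"
      using A4 t by (auto simp: asm_A4_def lsc_on_def)
    moreover have "continuous_map euclideanreal (prod_topology (ZT P t) euclideanreal) (\<lambda>r. (z, r))"
      using z by (simp add: continuous_map_pairwise comp_def del: topspace_prod_topology)
    ultimately have "openin euclideanreal {r \<in> topspace euclideanreal. (z, r) \<in> ?O}"
      by (rule openin_continuous_map_preimage[rotated])
    moreover have "{r \<in> topspace euclideanreal. (z, r) \<in> ?O} = {r. b < Gfun P t z r}"
      using z by auto
    ultimately have "open {r. b < Gfun P t z r}"
      by simp
    moreover have "s \<in> {r. b < Gfun P t z r}"
      using a \<open>e = ereal s\<close> real by simp
    ultimately obtain d where d: "d > 0" "ball s d \<subseteq> {r. b < Gfun P t z r}"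
      by (rule openE)
    have "s - d / 2 \<in> ball s d"
      using d(1) by (simp add: dist_real_def)
    from subsetD[OF d(2) this] have "b < Gfun P t z (s - d / 2)"
      by simp
    then show ?thesis
      using d(1) \<open>e = ereal s\<close> real by (intro exI[of _ "s - d / 2"]) auto
  next
    case MInf
    then show ?thesis
      using \<open>e = ereal s\<close> by (intro exI[of _ "s - 1"]) auto
  qed (use a in auto)
qed (use e in auto)

text \<open>Truncating the argument at n makes it real, which reduces measurability of the extension
  to that of G. The value -\<infinity> has to be excluded because \<open>real_of_ereal\<close> maps
  it to 0.\<close>

lemma Gext_eq_SUP:
  assumes t: "t \<le> T" and z: "z \<in> topspace (ZT P t)" and e: "e \<noteq> -\<infinity>"
  shows "Gext P t z e = (SUP n::nat. ereal (Gfun P t z (real_of_ereal (min e (ereal (real n))))))"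
proof (cases e)
  case PInf
  have "(SUP r. ereal (Gfun P t z r)) = (SUP n::nat. ereal (Gfun P t z (real n)))"
  proof (rule antisym)
    show "(SUP r. ereal (Gfun P t z r)) \<le> (SUP n::nat. ereal (Gfun P t z (real n)))"
    proof (rule SUP_least)
      fix r
      obtain n where "r \<le> real n"
        using real_arch_simple by blast
      then show "ereal (Gfun P t z r) \<le> (SUP n::nat. ereal (Gfun P t z (real n)))"
        using G_mono[OF t z] by (intro SUP_upper2[of n]) auto
    qed
    show "(SUP n::nat. ereal (Gfun P t z (real n))) \<le> (SUP r. ereal (Gfun P t z r))"
      by (intro SUP_least SUP_upper) auto
  qed
  then show ?thesis
    by (simp add: PInf Gext_PInf min_def)
next
  case (real r)
  have eq: "real_of_ereal (min e (ereal (real n))) = min r (real n)" for n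
    by (simp add: real min_def)
  obtain n where "r \<le> real n"
    using real_arch_simple by blast
  then have "ereal (Gfun P t z r) \<le> (SUP n::nat. ereal (Gfun P t z (min r (real n))))"
    by (intro SUP_upper2[of n]) (auto simp: min_def)
  moreover have "(SUP n::nat. ereal (Gfun P t z (min r (real n)))) \<le> ereal (Gfun P t z r)"
    using G_mono[OF t z] by (intro SUP_least) auto
  ultimately show ?thesis
    unfolding eq by (simp add: real)
qed (use e in auto)

lemma Gext_measurable:
  assumes t: "t \<le> T" and f: "f \<in> M \<rightarrow>\<^sub>M B t" and s: "s \<in> borel_measurable M"
    and bot: "\<And>x. x \<in> space M \<Longrightarrow> s x \<noteq> -\<infinity>"
  shows "(\<lambda>x. Gext P t (f x) (s x)) \<in> borel_measurable M"
proof -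
  have "lsc_on (prod_topology (ZT P t) euclideanreal) (\<lambda>(z, r). Gfun P t z r)"
    using A4 t by (auto simp: asm_A4_def)
  then have "(\<lambda>(z, r). Gfun P t z r) \<in> borel_measurable (borel_of (prod_topology (ZT P t) euclideanreal))"
    by (rule lsc_on_imp_measurable)
  moreover have "sets (borel_of (prod_topology (ZT P t) euclideanreal)) = sets (B t \<Otimes>\<^sub>M borel)"
  proof -
    have "second_countable (euclidean :: real topology)"
      using polish_euclidean[where 'a=real] by (simp add: polish_topology_iff)
    from sets_borel_of_prod[OF second_countable_Z[OF t] this] show ?thesis
      using sets_pair_measure_cong[OF refl sets_borel_of_euclidean] by (rule trans)
  qed
  ultimately have G: "(\<lambda>(z, r). Gfun P t z r) \<in> borel_measurable (B t \<Otimes>\<^sub>M borel)"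
    by (simp cong: measurable_cong_sets)
  have "(\<lambda>x. Gfun P t (f x) (real_of_ereal (min (s x) (ereal (real n))))) \<in> borel_measurable M" for n
  proof -
    have "(\<lambda>x. real_of_ereal (min (s x) (ereal (real n)))) \<in> borel_measurable M"
      using s by measurable
    from measurable_compose[OF measurable_Pair[OF f this] G] show ?thesis
      by simp
  qed
  then have "(\<lambda>x. SUP n::nat. ereal (Gfun P t (f x) (real_of_ereal (min (s x) (ereal (real n)))))) \<in> borel_measurable M"
    by (intro borel_measurable_SUP) auto
  moreover have "Gext P t (f x) (s x) = (SUP n::nat. ereal (Gfun P t (f x) (real_of_ereal (min (s x) (ereal (real n))))))"
    if "x \<in> space M" for x
    using measurable_space[OF f that] bot[OF that] by (intro Gext_eq_SUP t) auto
  ultimately show ?thesis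
    by (subst measurable_cong) auto
qed

lemma W_not_MInf:
  assumes t: "t \<le> T" and p: "kern p t" and z: "z \<in> topspace (ZT P t)"
  shows "W p t z \<noteq> -\<infinity>"
proof -
  have "g_fun P p t z \<noteq> -\<infinity>"
    using g_fun_ge[OF t p z] by auto
  then have "Gext P t z (g_fun P p t z) \<noteq> -\<infinity>"
    by (rule Gext_not_MInf)
  moreover have "- ereal (\<Sum>k=t+1..T. low) \<le> (\<Sum>k=t+1..T. b_fun P p k t z t z)"
    using b_fun_ge[OF _ _ p t z z] by (intro sum_ge_neg) auto
  ultimately show ?thesis
    unfolding W_def by (cases "Gext P t z (g_fun P p t z)"; cases "\<Sum>k=t+1..T. b_fun P p k t z t z") auto
qed

lemma W_measurable:
  assumes t: "t \<le> T" and p: "kern p t"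
  shows "W p t \<in> borel_measurable (B t)"
proof -
  have "(\<lambda>z. Gext P t z (g_fun P p t z)) \<in> borel_measurable (B t)"
  proof (rule Gext_measurable[OF t measurable_ident g_fun_measurable[OF t p], unfolded id_def])
    show "g_fun P p t z \<noteq> -\<infinity>" if "z \<in> space (B t)" for z
      using g_fun_ge[OF t p, of z] that by auto
  qed
  moreover have "(\<lambda>z. b_fun P p k t z t z) \<in> borel_measurable (B t)" if "k \<in> {t+1..T}" for k
    using measurable_compose[OF measurable_Pair[OF measurable_ident measurable_ident] b_fun_measurable[of t k p t]] that t p
    by (simp add: id_def)
  ultimately show ?thesis
    unfolding W_def[abs_def] by (intro borel_measurable_ereal_add borel_measurable_ereal_sum) auto
qed

section \<open>Cancellation in the extended equation\<close>

lemma admissible_space: "\<gamma> \<in> admissible P t z \<Longrightarrow> \<gamma> \<in> space (prob_algebra (B (Suc t)))"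
  by (simp add: admissible_def couplings_def probs_eq_space_prob_algebra)

text \<open>\<open>cancel_diff\<close> yields 0 for equal arguments even if both are \<infinity>;
  only -\<infinity> would spoil this, and the lower bounds exclude it.\<close>

lemma dp_bracket_eq_reduced_bracket:
  assumes t: "t < T" and p: "kern p (Suc t)" and \<gamma>: "\<gamma> \<in> space (prob_algebra (B (Suc t)))"
    and V: "\<And>w. w \<in> topspace (ZT P (Suc t)) \<Longrightarrow> V w = W p (Suc t) w"
  shows "dp_bracket P p V t z \<gamma> = reduced_bracket P p t z \<gamma>"
proof -
  have sp: "space \<gamma> = topspace (ZT P (Suc t))"
    using \<gamma> sets_eq_imp_space_eq[of \<gamma> "B (Suc t)"] by (auto simp: space_prob_algebra)
  have "ext_integral \<gamma> (\<lambda>w. ereal (cost P t (t+1) z w) + cancel_diff (V w)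
         (Gext P (t+1) w (g_fun P p (t+1) w) + (\<Sum>k=t+2..T. b_fun P p k (t+1) w (t+1) w))) =
      ext_integral \<gamma> (\<lambda>w. ereal (cost P t (t+1) z w))"
  proof (rule ext_integral_cong)
    fix w assume w: "w \<in> space \<gamma>"
    have "Gext P (t+1) w (g_fun P p (t+1) w) + (\<Sum>k=t+2..T. b_fun P p k (t+1) w (t+1) w) = W p (Suc t) w"
      by (simp add: W_def)
    then show "ereal (cost P t (t+1) z w) + cancel_diff (V w)
         (Gext P (t+1) w (g_fun P p (t+1) w) + (\<Sum>k=t+2..T. b_fun P p k (t+1) w (t+1) w)) =
        ereal (cost P t (t+1) z w)"
      using V[of w] W_not_MInf[of "Suc t" p w] t p w unfolding sp by (simp add: cancel_diff_self)
  qed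
  then show ?thesis
    unfolding dp_bracket_def reduced_bracket_def by simp
qed

text \<open>Backward induction: if the next value is \<open>W\<close>, the bracket reduces, its
  value at the optimizer is the objective of the concatenated kernels, and this is \<open>W\<close>
  one step earlier.\<close>

lemma dp_value_eq_W:
  assumes "t \<le> T" "kern p t" "\<And>s. t \<le> s \<Longrightarrow> s < T \<Longrightarrow> dp_optimizer P p s (p s)" "z \<in> topspace (ZT P t)"
  shows "dp_value P p t z = W p t z"
  using assms
proof (induction arbitrary: z rule: inc_induct)
  case base
  then show ?case
    by (subst dp_value.simps) (simp add: W_def g_fun_def)
next
  case (step t)
  have p': "kern p (Suc t)"
    using step.prems(1) by (rule kern_mono) simp
  have opt: "p t z \<in> admissible P t z" "dp_bracket P p (dp_value P p (Suc t)) t z (p t z) = dp_value P p t z"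
    using step.prems(2)[of t] step.hyps step.prems(3) by (auto simp: dp_optimizer_def)
  have "dp_value P p t z = reduced_bracket P p t z (p t z)"
    unfolding opt(2)[symmetric]
  proof (rule dp_bracket_eq_reduced_bracket[OF step.hyps(2) p' admissible_space[OF opt(1)]])
    show "dp_value P p (Suc t) w = W p (Suc t) w" if "w \<in> topspace (ZT P (Suc t))" for w
      using that step.prems(2) by (intro step.IH p') auto
  qed
  also have "\<dots> = objective P t z (concat_kernels P p t z)"
    by (rule objective_concat[OF step.hyps(2) step.prems(1,3), symmetric])
  also have "\<dots> = W p t z"
    by (rule objective_concat_W[OF step.hyps(2) step.prems(1,3)])
  finally show ?case .
qed

lemma dp_bracket_reduced:
  assumes t: "t < T" and p: "kern p (Suc t)" and opt: "\<And>s. t < s \<Longrightarrow> s < T \<Longrightarrow> dp_optimizer P p s (p s)"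
    and \<gamma>: "\<gamma> \<in> admissible P t z"
  shows "dp_bracket P p (dp_value P p (Suc t)) t z \<gamma> = reduced_bracket P p t z \<gamma>"
proof (rule dp_bracket_eq_reduced_bracket[OF t p admissible_space[OF \<gamma>]])
  show "dp_value P p (Suc t) w = W p (Suc t) w" if "w \<in> topspace (ZT P (Suc t))" for w
    using that t opt by (intro dp_value_eq_W p) auto
qed

lemma dp_value_reduced:
  assumes t: "t < T" and p: "kern p (Suc t)" and opt: "\<And>s. t < s \<Longrightarrow> s < T \<Longrightarrow> dp_optimizer P p s (p s)"
  shows "dp_value P p t z = reduced_value P p t z"
proof -
  have "dp_value P p t z = (INF \<gamma>\<in>admissible P t z. dp_bracket P p (dp_value P p (Suc t)) t z \<gamma>)"
    using t by (subst dp_value.simps) simp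
  also have "\<dots> = reduced_value P p t z"
    unfolding reduced_value_def by (intro INF_cong refl dp_bracket_reduced assms)
  finally show ?thesis .
qed

lemma dp_optimizer_reduced:
  assumes t: "t < T" and p: "kern p (Suc t)" and opt: "\<And>s. t < s \<Longrightarrow> s < T \<Longrightarrow> dp_optimizer P p s (p s)"
  shows "dp_optimizer P p t q \<longleftrightarrow> reduced_optimizer P p t q"
  unfolding dp_optimizer_def reduced_optimizer_def
  using dp_bracket_reduced[OF assms] dp_value_reduced[OF assms] by (auto simp del: topspace_prod_topology)

section \<open>Couplings as mass constraints, and existence of optimizers\<close>

lemma coupling_emeasure:
  assumes n: "n \<le> T" and \<gamma>: "\<gamma> \<in> couplings (TX P n) (TY P n) \<mu> \<nu>"
  shows "A \<in> sets (borel_of (TX P n)) \<Longrightarrow> emeasure \<gamma> (A \<times> topspace (TY P n)) = emeasure \<mu> A"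
    and "C \<in> sets (borel_of (TY P n)) \<Longrightarrow> emeasure \<gamma> (topspace (TX P n) \<times> C) = emeasure \<nu> C"
proof -
  have s: "sets \<gamma> = sets (B n)" and d: "distr \<gamma> (borel_of (TX P n)) fst = \<mu>" "distr \<gamma> (borel_of (TY P n)) snd = \<nu>"
    using \<gamma> by (auto simp: couplings_def probs_def)
  have sp: "space \<gamma> = topspace (TX P n) \<times> topspace (TY P n)"
    using sets_eq_imp_space_eq[OF s] by simp
  have m: "fst \<in> \<gamma> \<rightarrow>\<^sub>M borel_of (TX P n)" "snd \<in> \<gamma> \<rightarrow>\<^sub>M borel_of (TY P n)"
    by (simp_all cong: measurable_cong_sets add: s sets_B[OF n])
  show "emeasure \<gamma> (A \<times> topspace (TY P n)) = emeasure \<mu> A" if A: "A \<in> sets (borel_of (TX P n))"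
  proof -
    have "fst -` A \<inter> space \<gamma> = A \<times> topspace (TY P n)"
      using sets.sets_into_space[OF A] by (auto simp: sp)
    then show ?thesis
      using emeasure_distr[OF m(1) A] d(1) by simp
  qed
  show "emeasure \<gamma> (topspace (TX P n) \<times> C) = emeasure \<nu> C" if C: "C \<in> sets (borel_of (TY P n))"
  proof -
    have "snd -` C \<inter> space \<gamma> = topspace (TX P n) \<times> C"
      using sets.sets_into_space[OF C] by (auto simp: sp)
    then show ?thesis
      using emeasure_distr[OF m(2) C] d(2) by simp
  qed
qed

text \<open>Testing the marginals on generating pi-systems is enough. With countable systems this
  turns being a coupling into a sequence of constraints.\<close>

lemma couplingI:
  assumes n: "n \<le> T" and \<gamma>: "\<gamma> \<in> space (prob_algebra (B n))"
    and \<mu>: "sets \<mu> = sets (borel_of (TX P n))" and \<nu>: "sets \<nu> = sets (borel_of (TY P n))"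
    and E: "sets (borel_of (TX P n)) = sigma_sets (topspace (TX P n)) E" "Int_stable E" "topspace (TX P n) \<in> E"
    and F: "sets (borel_of (TY P n)) = sigma_sets (topspace (TY P n)) F" "Int_stable F" "topspace (TY P n) \<in> F"
    and EX: "\<And>A. A \<in> E \<Longrightarrow> emeasure \<gamma> (A \<times> topspace (TY P n)) = emeasure \<mu> A"
    and FY: "\<And>C. C \<in> F \<Longrightarrow> emeasure \<gamma> (topspace (TX P n) \<times> C) = emeasure \<nu> C"
  shows "\<gamma> \<in> couplings (TX P n) (TY P n) \<mu> \<nu>"
proof -
  have s: "sets \<gamma> = sets (B n)" and p: "prob_space \<gamma>"
    using \<gamma> by (auto simp: space_prob_algebra)
  have sp: "space \<gamma> = topspace (TX P n) \<times> topspace (TY P n)"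
    using sets_eq_imp_space_eq[OF s] by simp
  have m: "fst \<in> \<gamma> \<rightarrow>\<^sub>M borel_of (TX P n)" "snd \<in> \<gamma> \<rightarrow>\<^sub>M borel_of (TY P n)"
    by (simp_all cong: measurable_cong_sets add: s sets_B[OF n])
  have "distr \<gamma> (borel_of (TX P n)) fst = \<mu>"
  proof (rule measure_eqI_generator_eq[where E=E and \<Omega>="topspace (TX P n)" and A="\<lambda>_. topspace (TX P n)"])
    show EP: "E \<subseteq> Pow (topspace (TX P n))"
      using E(1) sets.sets_into_space[of _ "borel_of (TX P n)"] by (auto intro: sigma_sets.Basic)
    show "emeasure (distr \<gamma> (borel_of (TX P n)) fst) A = emeasure \<mu> A" if A: "A \<in> E" for A
    proof -
      have "A \<in> sets (borel_of (TX P n))"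
        using A E(1) by (auto intro: sigma_sets.Basic)
      moreover have "fst -` A \<inter> space \<gamma> = A \<times> topspace (TY P n)"
        using A EP by (auto simp: sp)
      ultimately show ?thesis
        using EX[OF A] by (simp add: emeasure_distr[OF m(1)])
    qed
    show "emeasure (distr \<gamma> (borel_of (TX P n)) fst) (topspace (TX P n)) \<noteq> \<infinity>" for i :: nat
      using prob_space.emeasure_space_1[OF prob_space.prob_space_distr[OF p m(1)]] by simp
  qed (use E \<mu> in auto)
  moreover have "distr \<gamma> (borel_of (TY P n)) snd = \<nu>"
  proof (rule measure_eqI_generator_eq[where E=F and \<Omega>="topspace (TY P n)" and A="\<lambda>_. topspace (TY P n)"])
    show FP: "F \<subseteq> Pow (topspace (TY P n))"
      using F(1) sets.sets_into_space[of _ "borel_of (TY P n)"] by (auto intro: sigma_sets.Basic)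
    show "emeasure (distr \<gamma> (borel_of (TY P n)) snd) A = emeasure \<nu> A" if A: "A \<in> F" for A
    proof -
      have "A \<in> sets (borel_of (TY P n))"
        using A F(1) by (auto intro: sigma_sets.Basic)
      moreover have "snd -` A \<inter> space \<gamma> = topspace (TX P n) \<times> A"
        using A FP by (auto simp: sp)
      ultimately show ?thesis
        using FY[OF A] by (simp add: emeasure_distr[OF m(2)])
    qed
    show "emeasure (distr \<gamma> (borel_of (TY P n)) snd) (topspace (TY P n)) \<noteq> \<infinity>" for i :: nat
      using prob_space.emeasure_space_1[OF prob_space.prob_space_distr[OF p m(2)]] by simp
  qed (use F \<nu> in auto)
  ultimately show ?thesis
    using \<gamma> by (simp add: couplings_def probs_eq_space_prob_algebra)
qed

text \<open>Brings the bracket into the form minimized in \<open>dominated_minimization\<close>. The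
  constant \<open>L\<close> consists of one \<open>low\<close> for the running cost and one for each
  b; the shift of g by \<open>low\<close> is undone inside G, because \<gamma> has mass 1.\<close>

lemma reduced_bracket_shift:
  assumes t: "t < T" and p: "kern p (Suc t)" and \<gamma>: "\<gamma> \<in> space (prob_algebra (B (Suc t)))"
    and z: "z \<in> topspace (ZT P t)" and L: "L = low + (\<Sum>k=t+2..T. low)"
  shows "reduced_bracket P p t z \<gamma> + ereal L =
    enn2ereal (\<integral>\<^sup>+w. e2ennreal (ereal (cost P t (t+1) z w) + (\<Sum>k=t+2..T. b_fun P p k t z (t+1) w) + ereal L) \<partial>\<gamma>) +
    Gext P t z (enn2ereal (\<integral>\<^sup>+w. e2ennreal (g_fun P p (t+1) w + ereal low) \<partial>\<gamma>) - ereal low)"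
proof -
  have \<gamma>': "prob_space \<gamma>" "sets \<gamma> = sets (B (Suc t))"
    using \<gamma> by (auto simp: space_prob_algebra)
  have sp: "space \<gamma> = topspace (ZT P (Suc t))"
    using sets_eq_imp_space_eq[OF \<gamma>'(2)] by simp
  let ?c = "\<lambda>w. ereal (cost P t (t+1) z w)" and ?b = "\<lambda>w. \<Sum>k=t+2..T. b_fun P p k t z (t+1) w"
  have L0: "0 \<le> (\<Sum>k=t+2..T. low)" "0 \<le> L"
    using low(1) by (auto simp: L intro!: sum_nonneg add_nonneg_nonneg)
  have c: "?c \<in> borel_measurable \<gamma>" "\<And>w. w \<in> space \<gamma> \<Longrightarrow> - ereal low \<le> ?c w"
    using cost_measurable1[of t "t+1" z] low(2)[of t "t+1" z] t z by (auto cong: measurable_cong_sets simp: \<gamma>'(2) sp)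
  have b: "?b \<in> borel_measurable \<gamma>"
    using b_fun_measurable1[of "Suc t" _ p t z] t p z
    by (intro borel_measurable_ereal_sum) (auto cong: measurable_cong_sets simp: \<gamma>'(2))
  have b_ge: "- ereal (\<Sum>k=t+2..T. low) \<le> ?b w" if "w \<in> space \<gamma>" for w
    using b_fun_ge[of "Suc t" _ p t z w] t p z that by (intro sum_ge_neg) (auto simp: sp)
  have cb_ge: "- ereal L \<le> ?c w + ?b w" if "w \<in> space \<gamma>" for w
    using add_mono[OF c(2)[OF that] b_ge[OF that]] by (simp add: L)
  have g: "g_fun P p (t+1) \<in> borel_measurable \<gamma>"
    using g_fun_measurable[of "Suc t" p] t p by (simp cong: measurable_cong_sets add: \<gamma>'(2))
  have g_ge: "- ereal low \<le> g_fun P p (t+1) w" if "w \<in> space \<gamma>" for w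
    using g_fun_ge[of "Suc t" p w] t p that by (simp add: sp)
  let ?I = "\<integral>\<^sup>+w. e2ennreal (?c w + ?b w + ereal L) \<partial>\<gamma>"
  have "reduced_bracket P p t z \<gamma> = ext_integral \<gamma> (\<lambda>w. ?c w + ?b w) + Gext P t z (ext_integral \<gamma> (g_fun P p (t+1)))"
    unfolding reduced_bracket_def using ext_integral_add[OF \<gamma>'(1) c(1) low(1) c(2) b L0(1) b_ge] by (simp add: ac_simps)
  also have "ext_integral \<gamma> (\<lambda>w. ?c w + ?b w) = enn2ereal ?I - ereal L"
    using c(1) b by (intro ext_integral_shift[OF \<gamma>'(1) _ L0(2) cb_ge]) auto
  also have "ext_integral \<gamma> (g_fun P p (t+1)) = enn2ereal (\<integral>\<^sup>+w. e2ennreal (g_fun P p (t+1) w + ereal low) \<partial>\<gamma>) - ereal low"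
    by (rule ext_integral_shift[OF \<gamma>'(1) g low(1) g_ge])
  finally show ?thesis
    by (cases "enn2ereal ?I"; cases "Gext P t z (enn2ereal (\<integral>\<^sup>+w. e2ennreal (g_fun P p (t+1) w + ereal low) \<partial>\<gamma>) - ereal low)") auto
qed

text \<open>The bracket, shifted by a constant, is the abstract objective for a suitable choice of
  the data, and the abstract constraint set is the set of couplings. Adding a real constant does not
  change minimizers, even when the values are infinite.\<close>

lemma ex_reduced_optimizer:
  assumes t: "t < T" and p: "kern p (Suc t)"
  shows "\<exists>q\<in>B t \<rightarrow>\<^sub>M prob_algebra (B (Suc t)). reduced_optimizer P p t q"
proof -
  define n where "n = Suc t"
  have n: "n \<le> T" "n \<in> {1..T}"
    using t by (auto simp: n_def)
  define X where "X = topspace (TX P n)"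
  define Y where "Y = topspace (TY P n)"
  define uX where "uX = uniform_count_measure X"
  have X: "finite X" "X \<noteq> {}" "TX P n = discrete_topology X"
    using A1 n(2) by (auto simp: asm_A1_def X_def)
  have setsX: "sets (borel_of (TX P n)) = sets uX"
  proof -
    have "{U. openin (TX P n) U} = Pow X"
      unfolding X(3) by auto
    then show ?thesis
      using sigma_algebra.sigma_sets_eq[OF sigma_algebra_Pow]
      by (simp add: sets_borel_of uX_def sets_uniform_count_measure flip: X_def)
  qed
  have setsN: "sets (B n) = sets (uX \<Otimes>\<^sub>M borel_of (TY P n))"
    unfolding sets_B[OF n(1)] by (rule sets_pair_measure_cong[OF setsX refl])
  have uX: "uX \<in> space (prob_algebra uX)" "prob_space uX"
    using prob_space_uniform_count_measure[OF X(1,2)] by (auto simp: space_prob_algebra uX_def)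
  obtain E where E: "countable E" "Int_stable E" "topspace (ZT P n) \<in> E" "\<And>U. U \<in> E \<Longrightarrow> openin (ZT P n) U"
    "sets (B n) = sigma_sets (topspace (ZT P n)) E"
    using borel_of_countable_pi_system[OF second_countable_Z[OF n(1)]] by metis
  obtain FX where FX: "countable FX" "Int_stable FX" "topspace (TX P n) \<in> FX" "\<And>U. U \<in> FX \<Longrightarrow> openin (TX P n) U"
    "sets (borel_of (TX P n)) = sigma_sets (topspace (TX P n)) FX"
    using borel_of_countable_pi_system[of "TX P n"] polish_XY[OF n(1)] unfolding polish_topology_iff by metis
  obtain FY where FY: "countable FY" "Int_stable FY" "topspace (TY P n) \<in> FY" "\<And>U. U \<in> FY \<Longrightarrow> openin (TY P n) U"
    "sets (borel_of (TY P n)) = sigma_sets (topspace (TY P n)) FY"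
    using borel_of_countable_pi_system[of "TY P n"] polish_XY[OF n(1)] unfolding polish_topology_iff by metis
  define A where "A = from_nat_into E"
  define AX where "AX = from_nat_into FX"
  define AY where "AY = from_nat_into FY"
  have rA: "range A = E" "range AX = FX" "range AY = FY"
    using E FX FY by (auto simp: A_def AX_def AY_def intro!: range_from_nat_into)
  have AXs: "AX j \<in> sets (borel_of (TX P n))" for j
    using FX(4)[of "AX j"] rA(2) openin_imp_borel by blast
  have AYs: "AY j \<in> sets (borel_of (TY P n))" for j
    using FY(4)[of "AY j"] rA(3) openin_imp_borel by blast
  \<comment> \<open>Index 0 fixes the total mass; odd indices 2j+1 test the first marginal on
    \<open>AX j\<close>, and even indices 2j+2 the second marginal on \<open>AY j\<close>.\<close>
  define U where "U k = (case k of 0 \<Rightarrow> topspace (ZT P n) | Suc k \<Rightarrow> if even k then AX (k div 2) \<times> Y else X \<times> AY (k div 2))" for k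
  define c where "c k z = (case k of 0 \<Rightarrow> 1 | Suc k \<Rightarrow> if even k then measure (kmu P t (fst z)) (AX (k div 2))
      else measure (knu P t (snd z)) (AY (k div 2)))" for k and z :: "'d state"
  \<comment> \<open>The dominating kernel of \<open>coupling_dominated\<close>, normalized to a
    probability; the bound is the number of points of X.\<close>
  define \<rho> where "\<rho> z = uX \<Otimes>\<^sub>M knu P t (snd z)" for z :: "'d state"
  define L where "L = low + (\<Sum>k=t+2..T. low)"
  define C where "C z w = e2ennreal (ereal (cost P t (t+1) z w) + (\<Sum>k=t+2..T. b_fun P p k t z (t+1) w) + ereal L)" for z w
  define g where "g w = e2ennreal (g_fun P p (t+1) w + ereal low)" for w
  \<comment> \<open>Undoes the shift that makes g nonnegative.\<close>
  define H where "H z s = Gext P t z (enn2ereal s - ereal low)" for z s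
  have knu: "(\<lambda>z. knu P t (snd z)) \<in> B t \<rightarrow>\<^sub>M prob_algebra (borel_of (TY P n))"
    unfolding n_def by (rule measurable_compose[OF continuous_map_imp_measurable[OF continuous_map_snd] Y.kernel_measurable[OF t]])
  have kmu: "(\<lambda>z. kmu P t (fst z)) \<in> B t \<rightarrow>\<^sub>M prob_algebra (borel_of (TX P n))"
    unfolding n_def by (rule measurable_compose[OF continuous_map_imp_measurable[OF continuous_map_fst] X.kernel_measurable[OF t]])
  have kmu_prob: "prob_space (kmu P t (fst z))" "sets (kmu P t (fst z)) = sets (borel_of (TX P n))"
    "space (kmu P t (fst z)) = X" if "z \<in> space (B t)" for z
    using measurable_prob_space_kernel[OF kmu that] by (auto simp: X_def)
  have knu_prob: "prob_space (knu P t (snd z))" "sets (knu P t (snd z)) = sets (borel_of (TY P n))"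
    "space (knu P t (snd z)) = Y" if "z \<in> space (B t)" for z
    using measurable_prob_space_kernel[OF knu that] by (auto simp: Y_def)
  have spN: "space (B n) = X \<times> Y"
    by (simp add: X_def Y_def)
  have Xs: "X \<in> sets (borel_of (TX P n))" and Ys: "Y \<in> sets (borel_of (TY P n))"
    using sets.top[of "borel_of (TX P n)"] sets.top[of "borel_of (TY P n)"] by (simp_all add: X_def Y_def)
  have H_ne: "enn2ereal s - ereal low \<noteq> -\<infinity>" for s
    using enn2ereal_nonneg[of s] by (cases "enn2ereal s") auto
  interpret D: dominated_minimization "B t" "B n" A \<rho> "real (card X)" U c C g H
  proof unfold_locales
    show "sets (B n) = sigma_sets (space (B n)) (range A)" "Int_stable (range A)" "space (B n) \<in> range A"
      using E rA by simp_all
    show "range A \<subseteq> Pow (space (B n))"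
      using E(4) openin_subset[of "ZT P n"] unfolding rA by (auto simp del: topspace_prod_topology)
    have "(\<lambda>z. uX \<Otimes>\<^sub>M knu P t (snd z)) \<in> B t \<rightarrow>\<^sub>M prob_algebra (uX \<Otimes>\<^sub>M borel_of (TY P n))"
      by (rule measurable_pair_prob[OF measurable_const[OF uX(1)] knu])
    then show "\<rho> \<in> B t \<rightarrow>\<^sub>M prob_algebra (B n)"
      unfolding \<rho>_def[abs_def] prob_algebra_cong[OF setsN] .
    show "0 \<le> real (card X)"
      by simp
    show "U k \<in> sets (B n)" for k
    proof (cases k)
      case 0
      then show ?thesis
        using sets.top[of "B n"] by (simp add: U_def)
    next
      case (Suc j)
      then show ?thesis
        unfolding sets_B[OF n(1)] using AXs AYs Xs Ys by (auto simp: U_def)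
    qed
    show "U 0 = space (B n)"
      by (simp add: U_def)
    show "c k \<in> borel_measurable (B t)" for k
    proof (cases k)
      case (Suc j)
      then show ?thesis
        using measurable_compose[OF kmu measurable_measure_prob_algebra[OF AXs]]
          measurable_compose[OF knu measurable_measure_prob_algebra[OF AYs]]
        by (cases "even j") (simp_all add: c_def[abs_def])
    qed (simp add: c_def[abs_def])
    show "c 0 z = 1" for z
      by (simp add: c_def)
    have "(\<lambda>q. b_fun P p k t (fst q) (t+1) (snd q)) \<in> borel_measurable (B t \<Otimes>\<^sub>M B n)" if "k \<in> {t+2..T}" for k
      using b_fun_measurable[of "Suc t" k p t] that t p by (simp add: case_prod_beta' n_def)
    then have "(\<lambda>q. ereal (cost P t (t+1) (fst q) (snd q)) + (\<Sum>k=t+2..T. b_fun P p k t (fst q) (t+1) (snd q)) + ereal L)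
        \<in> borel_measurable (B t \<Otimes>\<^sub>M B n)"
      using cost_measurable[of t "Suc t"] t
      by (intro borel_measurable_ereal_add borel_measurable_ereal_sum) (auto simp: case_prod_beta' n_def)
    from measurable_compose[OF this measurable_e2ennreal]
    show "(\<lambda>(z, w). C z w) \<in> borel_measurable (B t \<Otimes>\<^sub>M B n)"
      by (simp add: C_def case_prod_beta')
    have "(\<lambda>w. g_fun P p (t+1) w + ereal low) \<in> borel_measurable (B n)"
      using g_fun_measurable[of "Suc t" p] t p by (simp add: n_def)
    from measurable_compose[OF this measurable_e2ennreal]
    show "g \<in> borel_measurable (B n)"
      by (simp add: g_def[abs_def])
    have "(\<lambda>q. enn2ereal (snd q) - ereal low) \<in> borel_measurable (B t \<Otimes>\<^sub>M (borel :: ennreal measure))"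
      by measurable
    from Gext_measurable[OF less_imp_le[OF t] measurable_fst this H_ne]
    show "(\<lambda>(z, s). H z s) \<in> borel_measurable (B t \<Otimes>\<^sub>M borel)"
      by (simp add: H_def case_prod_beta')
    show "H z s \<le> H z s'" if "z \<in> space (B t)" "s \<le> s'" for z s s'
      unfolding H_def using that t H_ne
      by (intro Gext_mono ereal_minus_mono) (auto simp: less_eq_ennreal.rep_eq)
    show "\<exists>s'<s. a < H z s'" if z: "z \<in> space (B t)" and a: "a < H z s" and s: "s \<noteq> 0" for z s a
    proof -
      obtain r where r: "ereal r < enn2ereal s - ereal low" "a < ereal (Gfun P t z r)"
        using Gext_lsc[OF less_imp_le[OF t] _ a[unfolded H_def] H_ne] z by auto
      define s' where "s' = e2ennreal (ereal (r + low))"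
      have "ereal r + ereal low < enn2ereal s"
        using r(1) by (cases "enn2ereal s") auto
      then have rl: "ereal (r + low) < enn2ereal s"
        by simp
      have "s' < s"
      proof (cases "0 \<le> r + low")
        case True
        then show ?thesis
          using rl by (simp add: s'_def less_ennreal.rep_eq enn2ereal_e2ennreal enn2ereal_ennreal)
      next
        case False
        then have "s' = 0"
          by (simp add: s'_def ennreal_neg)
        then show ?thesis
          using s by (simp add: zero_less_iff_neq_zero)
      qed
      moreover have "a < H z s'"
      proof -
        have "ereal (r + low) \<le> enn2ereal s'"
          by (cases "0 \<le> r + low") (auto simp: s'_def enn2ereal_ennreal ennreal_neg zero_ennreal.rep_eq)
        then have "ereal r \<le> enn2ereal s' - ereal low"
          by (cases "enn2ereal s'") auto
        then have "Gext P t z (ereal r) \<le> H z s'"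
          unfolding H_def using z t by (intro Gext_mono) auto
        then show ?thesis
          using r(2) by simp
      qed
      ultimately show ?thesis
        by blast
    qed
    show "H z s \<noteq> -\<infinity>" for z s
      unfolding H_def by (rule Gext_not_MInf[OF H_ne])
  qed
  \<comment> \<open>For couplings the domination holds because X is finite; conversely the
    constraints fix both marginals on generators.\<close>
  have \<Gamma>: "D.\<Gamma> z = admissible P t z" if z: "z \<in> space (B t)" for z
  proof
    show "admissible P t z \<subseteq> D.\<Gamma> z"
    proof
      fix \<gamma> assume \<gamma>: "\<gamma> \<in> admissible P t z"
      then have \<gamma>c: "\<gamma> \<in> couplings (TX P n) (TY P n) (kmu P t (fst z)) (knu P t (snd z))"
        by (simp add: admissible_def n_def)
      have \<gamma>p: "prob_space \<gamma>" "sets \<gamma> = sets (B n)"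
        using admissible_space[OF \<gamma>] by (auto simp: space_prob_algebra n_def)
      have "measure \<gamma> (U k) = c k z" for k
      proof (cases k)
        case 0
        then show ?thesis
          using prob_space.prob_space[OF \<gamma>p(1)] sets_eq_imp_space_eq[OF \<gamma>p(2)] by (simp add: U_def c_def)
      next
        case (Suc j)
        then show ?thesis
          using coupling_emeasure[OF n(1) \<gamma>c] AXs AYs
          by (simp add: U_def c_def measure_def X_def Y_def)
      qed
      moreover have "emeasure \<gamma> A' \<le> ennreal (real (card X)) * emeasure (\<rho> z) A'" if "A' \<in> sets (B n)" for A'
      proof -
        have "distr \<gamma> (borel_of (TY P n)) snd = knu P t (snd z)"
          using \<gamma>c by (simp add: couplings_def)
        then show ?thesis
          unfolding \<rho>_def uX_def using X(1,2) knu_prob(1,2)[OF z] \<gamma>p(2) setsN that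
          by (intro coupling_dominated) (auto simp: uX_def)
      qed
      ultimately show "\<gamma> \<in> D.\<Gamma> z"
        using \<gamma>p by (simp add: D.\<Gamma>_def)
    qed
    show "D.\<Gamma> z \<subseteq> admissible P t z"
    proof
      fix \<gamma> assume "\<gamma> \<in> D.\<Gamma> z"
      then have s: "sets \<gamma> = sets (B n)" and dom: "\<And>A'. A' \<in> sets (B n) \<Longrightarrow> emeasure \<gamma> A' \<le> ennreal (real (card X)) * emeasure (\<rho> z) A'"
        and U: "\<And>k. measure \<gamma> (U k) = c k z"
        by (auto simp: D.\<Gamma>_def)
      interpret \<gamma>: finite_measure \<gamma>
        using D.dominated_finite(1)[OF z s dom] .
      have "emeasure \<gamma> (space \<gamma>) = 1"
        using U[of 0] sets_eq_imp_space_eq[OF s] by (simp add: U_def c_def \<gamma>.emeasure_eq_measure)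
      then have "\<gamma> \<in> space (prob_algebra (B n))"
        using s by (auto simp: space_prob_algebra intro: prob_spaceI)
      moreover have "emeasure \<gamma> (A' \<times> topspace (TY P n)) = emeasure (kmu P t (fst z)) A'" if A': "A' \<in> FX" for A'
      proof -
        obtain j where "A' = AX j"
          using A' rA(2) by blast
        then show ?thesis
          using U[of "Suc (2 * j)"] prob_space.finite_measure[OF kmu_prob(1)[OF z]]
          by (simp add: U_def c_def \<gamma>.emeasure_eq_measure finite_measure.emeasure_eq_measure Y_def)
      qed
      moreover have "emeasure \<gamma> (topspace (TX P n) \<times> A') = emeasure (knu P t (snd z)) A'" if A': "A' \<in> FY" for A'
      proof -
        obtain j where "A' = AY j"
          using A' rA(3) by blast
        then show ?thesis
          using U[of "Suc (Suc (2 * j))"] prob_space.finite_measure[OF knu_prob(1)[OF z]]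
          by (simp add: U_def c_def \<gamma>.emeasure_eq_measure finite_measure.emeasure_eq_measure X_def)
      qed
      ultimately have "\<gamma> \<in> couplings (TX P n) (TY P n) (kmu P t (fst z)) (knu P t (snd z))"
        by (intro couplingI[OF n(1) _ kmu_prob(2)[OF z] knu_prob(2)[OF z] FX(5,2,3) FY(5,2,3)])
      then show "\<gamma> \<in> admissible P t z"
        by (simp add: admissible_def n_def)
    qed
  qed
  have ne: "D.\<Gamma> z \<noteq> {}" if z: "z \<in> space (B t)" for z
  proof -
    interpret nu: prob_space "knu P t (snd z)"
      by (rule knu_prob(1)[OF z])
    interpret mu: prob_space "kmu P t (fst z)"
      by (rule kmu_prob(1)[OF z])
    \<comment> \<open>The independent coupling shows that the constraint set is not empty.\<close>
    let ?\<gamma> = "kmu P t (fst z) \<Otimes>\<^sub>M knu P t (snd z)"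
    have s: "sets ?\<gamma> = sets (B n)"
      unfolding sets_B[OF n(1)] by (rule sets_pair_measure_cong[OF kmu_prob(2)[OF z] knu_prob(2)[OF z]])
    have "?\<gamma> \<in> space (prob_algebra (B n))"
      using prob_space_pair[OF mu.prob_space_axioms nu.prob_space_axioms] s by (simp add: space_prob_algebra)
    moreover have "emeasure ?\<gamma> (A' \<times> topspace (TY P n)) = emeasure (kmu P t (fst z)) A'" if A': "A' \<in> FX" for A'
    proof -
      have "A' \<in> sets (kmu P t (fst z))"
        using A' FX(4) openin_imp_borel kmu_prob(2)[OF z] by blast
      then show ?thesis
        using nu.emeasure_space_1 knu_prob(3)[OF z] Ys knu_prob(2)[OF z]
        by (simp add: nu.emeasure_pair_measure_Times Y_def)
    qed
    moreover have "emeasure ?\<gamma> (topspace (TX P n) \<times> A') = emeasure (knu P t (snd z)) A'" if A': "A' \<in> FY" for A'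
    proof -
      have "A' \<in> sets (knu P t (snd z))"
        using A' FY(4) openin_imp_borel knu_prob(2)[OF z] by blast
      then show ?thesis
        using mu.emeasure_space_1 kmu_prob(3)[OF z] Xs kmu_prob(2)[OF z]
        by (simp add: nu.emeasure_pair_measure_Times X_def)
    qed
    ultimately have "?\<gamma> \<in> couplings (TX P n) (TY P n) (kmu P t (fst z)) (knu P t (snd z))"
      by (intro couplingI[OF n(1) _ kmu_prob(2)[OF z] knu_prob(2)[OF z] FX(5,2,3) FY(5,2,3)])
    then show ?thesis
      unfolding \<Gamma>[OF z] by (auto simp: admissible_def n_def)
  qed
  obtain q where q: "q \<in> B t \<rightarrow>\<^sub>M prob_algebra (B n)"
    "\<And>z. z \<in> space (B t) \<Longrightarrow> q z \<in> D.\<Gamma> z \<and> (\<forall>\<gamma>\<in>D.\<Gamma> z. D.\<Phi> z (q z) \<le> D.\<Phi> z \<gamma>)"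
    using D.measurable_minimizer[OF ne] by blast
  have shift: "reduced_bracket P p t z \<gamma> + ereal L = D.\<Phi> z \<gamma>" if z: "z \<in> space (B t)" and \<gamma>: "\<gamma> \<in> admissible P t z" for z \<gamma>
  proof -
    have "z \<in> topspace (ZT P t)"
      using z by simp
    from reduced_bracket_shift[OF t p admissible_space[OF \<gamma>] this L_def] show ?thesis
      unfolding D.\<Phi>_def C_def g_def H_def .
  qed
  have "reduced_optimizer P p t q"
    unfolding reduced_optimizer_def
  proof (intro ballI conjI)
    fix z assume "z \<in> topspace (ZT P t)"
    then have z: "z \<in> space (B t)"
      by simp
    show qz: "q z \<in> admissible P t z"
      using q(2)[OF z] by (simp only: \<Gamma>[OF z])
    have "reduced_bracket P p t z (q z) \<le> reduced_bracket P p t z \<gamma>" if \<gamma>: "\<gamma> \<in> admissible P t z" for \<gamma>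
    proof -
      have "D.\<Phi> z (q z) \<le> D.\<Phi> z \<gamma>"
        using q(2)[OF z] \<gamma> by (simp only: \<Gamma>[OF z])
      then have "reduced_bracket P p t z (q z) + ereal L \<le> reduced_bracket P p t z \<gamma> + ereal L"
        by (simp only: shift[OF z qz] shift[OF z \<gamma>])
      then show ?thesis
        by (cases "reduced_bracket P p t z (q z)"; cases "reduced_bracket P p t z \<gamma>") auto
    qed
    then show "reduced_bracket P p t z (q z) = reduced_value P p t z"
      unfolding reduced_value_def using qz by (intro antisym INF_greatest INF_lower) auto
  qed
  then show ?thesis
    using q(1) by (auto simp: n_def)
qed

section \<open>The concatenated plan\<close>

lemma nn_integral_prepend:
  assumes t: "t < T" and \<gamma>: "\<gamma> \<in> space (prob_algebra (B (Suc t)))"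
    and K: "K \<in> B (Suc t) \<rightarrow>\<^sub>M prob_algebra (BP (Suc t) T)" and F: "F \<in> borel_measurable (BP t T)"
  shows "(\<integral>\<^sup>+\<omega>. F \<omega> \<partial>prepend P t \<gamma> K) = (\<integral>\<^sup>+w. \<integral>\<^sup>+\<omega>. F (upd t w \<omega>) \<partial>K w \<partial>\<gamma>)"
proof -
  have \<gamma>': "sets \<gamma> = sets (B (Suc t))"
    using \<gamma> by (auto simp: space_prob_algebra)
  have k: "(\<lambda>w. distr (K w) (BP t T) (upd t w)) \<in> \<gamma> \<rightarrow>\<^sub>M subprob_algebra (BP t T)"
    using measurable_prob_algebraD[OF distr_upd_kernel[OF t K]] by (simp cong: measurable_cong_sets add: \<gamma>')
  have "(\<integral>\<^sup>+\<omega>. F \<omega> \<partial>prepend P t \<gamma> K) = (\<integral>\<^sup>+w. \<integral>\<^sup>+\<omega>. F \<omega> \<partial>distr (K w) (BP t T) (upd t w) \<partial>\<gamma>)"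
    unfolding prepend_eq by (rule nn_integral_bind[OF F k])
  also have "\<dots> = (\<integral>\<^sup>+w. \<integral>\<^sup>+\<omega>. F (upd t w \<omega>) \<partial>K w \<partial>\<gamma>)"
  proof (rule nn_integral_cong)
    fix w assume "w \<in> space \<gamma>"
    then have w: "w \<in> topspace (ZT P (Suc t))"
      using sets_eq_imp_space_eq[OF \<gamma>'] by simp
    have "sets (K w) = sets (BP (Suc t) T)"
      using w by (intro measurable_prob_space_kernel(2)[OF K]) simp
    then have "upd t w \<in> K w \<rightarrow>\<^sub>M BP t T"
      using upd_measurable1[OF t w] by (simp cong: measurable_cong_sets)
    then show "(\<integral>\<^sup>+\<omega>. F \<omega> \<partial>distr (K w) (BP t T) (upd t w)) = (\<integral>\<^sup>+\<omega>. F (upd t w \<omega>) \<partial>K w)"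
      using F by (simp add: nn_integral_distr)
  qed
  finally show ?thesis .
qed

text \<open>Paths started at time s carry coordinates after s only, so the state at time s has to be
  supplied as \<open>z\<close>.\<close>

definition state_at :: "nat \<Rightarrow> 'd state \<Rightarrow> nat \<Rightarrow> 'd path \<times> 'd path \<Rightarrow> 'd state" where
  "state_at s z t \<omega> = (if t = s then z else (fst \<omega> t, snd \<omega> t))"

definition history :: "nat \<Rightarrow> nat \<Rightarrow> 'd path \<times> 'd path \<Rightarrow> 'd path \<times> 'd path" where
  "history s t \<omega> = (restrict (fst \<omega>) {s<..t}, restrict (snd \<omega>) {s<..t})"

lemma state_at_measurable:
  assumes "s \<le> t" "t \<le> u" "z \<in> topspace (ZT P s)"
  shows "state_at s z t \<in> BP s u \<rightarrow>\<^sub>M B t"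
proof (cases "t = s")
  case True
  then show ?thesis
    using assms(3) by (simp add: state_at_def[abs_def])
next
  case False
  then show ?thesis
    using state_measurable[of s t u] assms by (simp add: state_at_def[abs_def] case_prod_beta')
qed

lemma history_measurable:
  assumes "t \<le> u"
  shows "history s t \<in> BP s u \<rightarrow>\<^sub>M BP s t"
proof (rule continuous_map_imp_measurable)
  have X: "continuous_map (XP P s u) (XP P s t) (\<lambda>xs. restrict xs {s<..t})"
    using assms by (auto simp: continuous_map_componentwise intro!: continuous_map_product_projection)
  have Y: "continuous_map (YP P s u) (YP P s t) (\<lambda>xs. restrict xs {s<..t})"
    using assms by (auto simp: continuous_map_componentwise intro!: continuous_map_product_projection)
  show "continuous_map (ZP P s u) (ZP P s t) (history s t)"
    using continuous_map_compose[OF continuous_map_fst X, of "YP P s u"]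
      continuous_map_compose[OF continuous_map_snd Y, of "XP P s u"]
    by (simp add: history_def[abs_def] continuous_map_pairwise comp_def)
qed

lemma upd_measurable2:
  assumes "s < u" "w \<in> topspace (ZT P (Suc s))"
  shows "upd s w \<in> BP (Suc s) u \<rightarrow>\<^sub>M BP s u"
proof (rule continuous_map_imp_measurable)
  have "continuous_map (ZP P (Suc s) u) (prod_topology (ZT P (Suc s)) (ZP P (Suc s) u)) (\<lambda>\<omega>. (w, \<omega>))"
    using assms(2) by (simp add: continuous_map_pairwise comp_def del: topspace_prod_topology)
  from continuous_map_compose[OF this continuous_map_upd[OF assms(1)]]
  show "continuous_map (ZP P (Suc s) u) (ZP P s u) (upd s w)"
    by (simp add: comp_def)
qed

lemma history_upd: "s < t \<Longrightarrow> history s t (upd s w \<omega>) = upd s w (history (Suc s) t \<omega>)"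
  by (auto simp: history_def upd_def case_prod_beta' restrict_def fun_eq_iff)

lemma state_at_upd: "s < t \<Longrightarrow> state_at s z t (upd s w \<omega>) = state_at (Suc s) w t \<omega>"
  by (cases w) (auto simp: state_at_def upd_def case_prod_beta')

text \<open>The arbitrary weight \<phi> on histories is what the induction needs: removing the first
  step w replaces \<phi> by its composition with the update by w, which is again a weight on the
  shorter histories.\<close>

lemma kernel_disintegration:
  assumes "s \<le> t" "t < T" "kern p s" "z \<in> topspace (ZT P s)" "\<phi> \<in> borel_measurable (BP s t)"
    "A \<in> sets (B (Suc t))"
  shows "(\<integral>\<^sup>+\<omega>. \<phi> (history s t \<omega>) * indicator A (fst \<omega> (Suc t), snd \<omega> (Suc t)) \<partial>concat_kernels P p s z) =
    (\<integral>\<^sup>+\<omega>. \<phi> (history s t \<omega>) * emeasure (p t (state_at s z t \<omega>)) A \<partial>concat_kernels P p s z)"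
  using assms
proof (induction arbitrary: z \<phi> rule: inc_induct)
  case base
  have p': "kern p (Suc t)"
    using base(2) by (rule kern_mono) simp
  have z: "z \<in> space (B t)"
    using base(3) by simp
  have \<gamma>: "p t z \<in> space (prob_algebra (B (Suc t)))"
    by (rule measurable_space[OF kernD[OF base(2) order_refl base(1)] z])
  have s\<gamma>: "sets (p t z) = sets (B (Suc t))"
    using \<gamma> by (simp add: space_prob_algebra)
  have K: "concat_kernels P p (Suc t) \<in> B (Suc t) \<rightarrow>\<^sub>M prob_algebra (BP (Suc t) T)"
    using base(1) p' by (intro concat_kernel) auto
  define e where "e = ((\<lambda>_. undefined, \<lambda>_. undefined) :: 'd path \<times> 'd path)"
  \<comment> \<open>At t = s the history is the empty path, so the weight is a constant and only the
    first kernel is integrated.\<close>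
  have hist: "history t t \<omega> = e" for \<omega>
    by (simp add: history_def e_def restrict_def)
  have Q: "concat_kernels P p t z = prepend P t (p t z) (concat_kernels P p (Suc t))"
    using concat_less[OF base(1)] by (simp add: deviate_def)
  have Qp: "prob_space (concat_kernels P p t z)"
    unfolding Q using prepend_space[OF base(1) \<gamma> K] by (simp add: space_prob_algebra)
  have st: "(\<lambda>\<omega>. (fst \<omega> (Suc t), snd \<omega> (Suc t))) \<in> BP t T \<rightarrow>\<^sub>M B (Suc t)"
    using state_measurable[of t "Suc t" T] base(1) by (simp add: case_prod_beta')
  have m: "(\<lambda>\<omega>. \<phi> (history t t \<omega>) * indicator A (fst \<omega> (Suc t), snd \<omega> (Suc t))) \<in> borel_measurable (BP t T)"
    unfolding hist using measurable_compose[OF st borel_measurable_indicator[OF base(5)]]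
    by (intro borel_measurable_times_ennreal) auto
  have "(\<integral>\<^sup>+\<omega>. \<phi> (history t t \<omega>) * indicator A (fst \<omega> (Suc t), snd \<omega> (Suc t)) \<partial>concat_kernels P p t z) =
      (\<integral>\<^sup>+w. \<integral>\<^sup>+\<omega>. \<phi> e * indicator A w \<partial>concat_kernels P p (Suc t) w \<partial>p t z)"
    unfolding Q nn_integral_prepend[OF base(1) \<gamma> K m] by (simp add: hist upd_def case_prod_beta')
  also have "\<dots> = (\<integral>\<^sup>+w. \<phi> e * indicator A w \<partial>p t z)"
  proof (rule nn_integral_cong)
    fix w assume "w \<in> space (p t z)"
    then have "w \<in> space (B (Suc t))"
      using sets_eq_imp_space_eq[OF s\<gamma>] by simp
    then have "prob_space (concat_kernels P p (Suc t) w)"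
      by (rule measurable_prob_space_kernel(1)[OF K])
    then show "(\<integral>\<^sup>+\<omega>. \<phi> e * indicator A w \<partial>concat_kernels P p (Suc t) w) = \<phi> e * indicator A w"
      by (simp add: prob_space.emeasure_space_1)
  qed
  also have "\<dots> = \<phi> e * emeasure (p t z) A"
    using base(5) by (intro nn_integral_cmult_indicator) (simp add: s\<gamma>)
  also have "\<dots> = (\<integral>\<^sup>+\<omega>. \<phi> (history t t \<omega>) * emeasure (p t (state_at t z t \<omega>)) A \<partial>concat_kernels P p t z)"
    using Qp by (simp add: hist state_at_def prob_space.emeasure_space_1)
  finally show ?case .
next
  case (step s)
  have sT: "s < T"
    using step.hyps step.prems(1) by simp
  have p': "kern p (Suc s)"
    using step.prems(2) by (rule kern_mono) simp
  have z: "z \<in> space (B s)"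
    using step.prems(3) by simp
  have \<gamma>: "p s z \<in> space (prob_algebra (B (Suc s)))"
    by (rule measurable_space[OF kernD[OF step.prems(2) order_refl sT] z])
  have s\<gamma>: "sets (p s z) = sets (B (Suc s))"
    using \<gamma> by (simp add: space_prob_algebra)
  have K: "concat_kernels P p (Suc s) \<in> B (Suc s) \<rightarrow>\<^sub>M prob_algebra (BP (Suc s) T)"
    using sT p' by (intro concat_kernel) auto
  have Q: "concat_kernels P p s z = prepend P s (p s z) (concat_kernels P p (Suc s))"
    using concat_less[OF sT] by (simp add: deviate_def)
  have h: "(\<lambda>\<omega>. \<phi> (history s t \<omega>)) \<in> borel_measurable (BP s T)"
    using step.prems(1) by (intro measurable_compose[OF history_measurable step.prems(4)]) simp
  have st: "(\<lambda>\<omega>. (fst \<omega> (Suc t), snd \<omega> (Suc t))) \<in> BP s T \<rightarrow>\<^sub>M B (Suc t)"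
    using state_measurable[of s "Suc t" T] step.hyps step.prems(1) by (simp add: case_prod_beta')
  have m1: "(\<lambda>\<omega>. \<phi> (history s t \<omega>) * indicator A (fst \<omega> (Suc t), snd \<omega> (Suc t))) \<in> borel_measurable (BP s T)"
    using measurable_compose[OF st borel_measurable_indicator[OF step.prems(5)]] h
    by (intro borel_measurable_times_ennreal) auto
  have "state_at s z t \<in> BP s T \<rightarrow>\<^sub>M B t"
    using step.hyps step.prems(1,3) by (intro state_at_measurable) auto
  from measurable_compose[OF this kernD[OF step.prems(2) less_imp_le[OF step.hyps(2)] step.prems(1)]]
  have "(\<lambda>\<omega>. p t (state_at s z t \<omega>)) \<in> BP s T \<rightarrow>\<^sub>M prob_algebra (B (Suc t))" .
  from measurable_compose[OF measurable_prob_algebraD[OF this] measurable_emeasure_subprob_algebra[OF step.prems(5)]]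
  have m2: "(\<lambda>\<omega>. \<phi> (history s t \<omega>) * emeasure (p t (state_at s z t \<omega>)) A) \<in> borel_measurable (BP s T)"
    using h by (intro borel_measurable_times_ennreal) auto
  show ?case
    unfolding Q nn_integral_prepend[OF sT \<gamma> K m1] nn_integral_prepend[OF sT \<gamma> K m2]
  proof (rule nn_integral_cong)
    fix w assume "w \<in> space (p s z)"
    then have w: "w \<in> topspace (ZT P (Suc s))"
      using sets_eq_imp_space_eq[OF s\<gamma>] by simp
    have "(\<lambda>h. \<phi> (upd s w h)) \<in> borel_measurable (BP (Suc s) t)"
      by (rule measurable_compose[OF upd_measurable2[OF step.hyps(2) w] step.prems(4)])
    from step.IH[OF step.prems(1) p' w this step.prems(5)]
    show "(\<integral>\<^sup>+\<omega>. \<phi> (history s t (upd s w \<omega>)) * indicator A (fst (upd s w \<omega>) (Suc t), snd (upd s w \<omega>) (Suc t))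
        \<partial>concat_kernels P p (Suc s) w) =
      (\<integral>\<^sup>+\<omega>. \<phi> (history s t (upd s w \<omega>)) * emeasure (p t (state_at s z t (upd s w \<omega>))) A \<partial>concat_kernels P p (Suc s) w)"
      using step.hyps(2) by (simp add: history_upd state_at_upd) (simp add: upd_def case_prod_beta')
  qed
qed

section \<open>The plan started in the initial state\<close>

abbreviation Q0 :: "'d kernels \<Rightarrow> ('d path \<times> 'd path) measure" where
  "Q0 p \<equiv> concat_kernels P p 0 (x0 P, y0 P)"

abbreviation current :: "nat \<Rightarrow> 'd path \<times> 'd path \<Rightarrow> 'd state" where
  "current t \<equiv> (\<lambda>(xs, ys). (at_time (x0 P) xs t, at_time (y0 P) ys t))"

lemma z0: "(x0 P, y0 P) \<in> topspace (ZT P 0)"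
  using X.S0 Y.S0 by simp

lemma current_eq: "current t = state_at 0 (x0 P, y0 P) t"
  by (auto simp: fun_eq_iff state_at_def at_time_def)

lemma current_history: "current t (history 0 t \<omega>) = current t \<omega>"
  by (auto simp: history_def at_time_def case_prod_beta')

lemma current_measurable: "t \<le> u \<Longrightarrow> current t \<in> BP 0 u \<rightarrow>\<^sub>M B t"
  unfolding current_eq using z0 by (intro state_at_measurable) auto

lemma Q0_prob:
  assumes "kern p 0"
  shows "prob_space (Q0 p)" "sets (Q0 p) = sets (BP 0 T)" "space (Q0 p) = topspace (ZP P 0 T)"
proof -
  have "(x0 P, y0 P) \<in> space (B 0)"
    using z0 by simp
  from measurable_prob_space_kernel[OF concat_kernel[OF _ assms] this]
  show "prob_space (Q0 p)" "sets (Q0 p) = sets (BP 0 T)" "space (Q0 p) = topspace (ZP P 0 T)"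
    by simp_all
qed

lemma Q0_current:
  assumes "kern p 0" "t \<le> T" "\<omega> \<in> space (Q0 p)"
  shows "current t \<omega> \<in> topspace (ZT P t)"
  using measurable_space[OF current_measurable[OF assms(2)], of \<omega>] assms(3) unfolding Q0_prob(3)[OF assms(1)]
  by (simp del: topspace_prod_topology)

lemma Q0_emeasure:
  assumes p: "kern p 0" and t: "t < T" and A: "A \<in> sets (BP 0 t)" and C: "C \<in> sets (B (Suc t))"
  shows "emeasure (Q0 p) {\<omega> \<in> space (Q0 p). history 0 t \<omega> \<in> A \<and> (fst \<omega> (Suc t), snd \<omega> (Suc t)) \<in> C} =
    (\<integral>\<^sup>+\<omega>. emeasure (p t (current t \<omega>)) C * indicator A (history 0 t \<omega>) \<partial>Q0 p)"
proof -
  have hm: "history 0 t \<in> Q0 p \<rightarrow>\<^sub>M BP 0 t"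
    using history_measurable[of t T 0] t by (simp cong: measurable_cong_sets add: Q0_prob(2)[OF p])
  have sm: "(\<lambda>\<omega>. (fst \<omega> (Suc t), snd \<omega> (Suc t))) \<in> Q0 p \<rightarrow>\<^sub>M B (Suc t)"
    using state_measurable[of 0 "Suc t" T] t by (simp cong: measurable_cong_sets add: Q0_prob(2)[OF p] case_prod_beta')
  let ?S = "{\<omega> \<in> space (Q0 p). history 0 t \<omega> \<in> A \<and> (fst \<omega> (Suc t), snd \<omega> (Suc t)) \<in> C}"
  have "?S = (history 0 t -` A \<inter> space (Q0 p)) \<inter> ((\<lambda>\<omega>. (fst \<omega> (Suc t), snd \<omega> (Suc t))) -` C \<inter> space (Q0 p))"
    by auto
  also have "\<dots> \<in> sets (Q0 p)"
    by (intro sets.Int measurable_sets[OF hm A] measurable_sets[OF sm C])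
  finally have "emeasure (Q0 p) ?S = (\<integral>\<^sup>+\<omega>. indicator ?S \<omega> \<partial>Q0 p)"
    by simp
  also have "\<dots> = (\<integral>\<^sup>+\<omega>. indicator A (history 0 t \<omega>) * indicator C (fst \<omega> (Suc t), snd \<omega> (Suc t)) \<partial>Q0 p)"
    by (intro nn_integral_cong) (auto simp: indicator_def)
  also have "\<dots> = (\<integral>\<^sup>+\<omega>. indicator A (history 0 t \<omega>) * emeasure (p t (state_at 0 (x0 P, y0 P) t \<omega>)) C \<partial>Q0 p)"
    using A C by (intro kernel_disintegration[OF le0 t p z0]) auto
  finally show ?thesis
    by (simp only: current_eq mult.commute)
qed

text \<open>The current state is a function of the history, so the disintegration over paths passes
  to the law of the history by a change of variables.\<close>

lemma Q0_kernel:
  assumes p: "kern p 0" and t: "t < T"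
  shows "regular_cond_kernel (Q0 p) (BP 0 t) (B (Suc t)) (\<lambda>(xs, ys). (restrict xs {0<..t}, restrict ys {0<..t}))
    (\<lambda>(xs, ys). (xs (Suc t), ys (Suc t))) (\<lambda>(xs, ys). p t (at_time (x0 P) xs t, at_time (y0 P) ys t))"
proof -
  have eqs: "(\<lambda>(xs, ys). (restrict xs {0<..t}, restrict ys {0<..t})) = history 0 t"
    "(\<lambda>(xs, ys). (xs (Suc t), ys (Suc t))) = (\<lambda>\<omega>. (fst \<omega> (Suc t), snd \<omega> (Suc t)))"
    "(\<lambda>(xs, ys). p t (at_time (x0 P) xs t, at_time (y0 P) ys t)) = (\<lambda>\<omega>. p t (current t \<omega>))"
    by (auto simp: history_def fun_eq_iff)
  have k: "(\<lambda>\<omega>. p t (current t \<omega>)) \<in> BP 0 t \<rightarrow>\<^sub>M prob_algebra (B (Suc t))"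
    by (rule measurable_compose[OF current_measurable[OF order_refl] kernD[OF p le0 t]])
  have hm: "history 0 t \<in> Q0 p \<rightarrow>\<^sub>M BP 0 t"
    using history_measurable[of t T 0] t by (simp cong: measurable_cong_sets add: Q0_prob(2)[OF p])
  show ?thesis
    unfolding regular_cond_kernel_def eqs
  proof (intro conjI ballI k)
    fix A C assume A: "A \<in> sets (BP 0 t)" and C: "C \<in> sets (B (Suc t))"
    have "(\<integral>\<^sup>+\<omega>. emeasure (p t (current t (history 0 t \<omega>))) C * indicator A (history 0 t \<omega>) \<partial>Q0 p) =
        (\<integral>\<^sup>+u. emeasure (p t (current t u)) C * indicator A u \<partial>distr (Q0 p) (BP 0 t) (history 0 t))"
    proof (rule nn_integral_distr[OF hm, symmetric])
      show "(\<lambda>u. emeasure (p t (current t u)) C * indicator A u) \<in> borel_measurable (distr (Q0 p) (BP 0 t) (history 0 t))"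
        using measurable_compose[OF measurable_prob_algebraD[OF k] measurable_emeasure_subprob_algebra[OF C]] A
        by (intro borel_measurable_times_ennreal) auto
    qed
    with Q0_emeasure[OF p t A C] show "emeasure (Q0 p) {\<omega> \<in> space (Q0 p). history 0 t \<omega> \<in> A \<and> (fst \<omega> (Suc t), snd \<omega> (Suc t)) \<in> C} =
        (\<integral>\<^sup>+u. emeasure (p t (current t u)) C * indicator A u \<partial>distr (Q0 p) (BP 0 t) (history 0 t))"
      by (simp only: current_history)
  qed
qed

text \<open>Events that involve only one of the two components are cylinders, and on a cylinder the
  coupling \<open>p t\<close> has the mass given by the kernel of that marginal. Each component is
  therefore a Markov chain with the prescribed kernels, and uniqueness of its law identifies it with
  \<mu> or \<nu>.\<close>

lemma Q0_couplings:
  assumes p: "kern p 0" and adm: "\<And>t z. t < T \<Longrightarrow> z \<in> topspace (ZT P t) \<Longrightarrow> p t z \<in> admissible P t z"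
  shows "Q0 p \<in> couplings (XP P 0 T) (YP P 0 T) (mu P) (nu P)"
proof -
  note Q = Q0_prob[OF p]
  have sBP: "sets (BP 0 t) = sets (borel_of (XP P 0 t) \<Otimes>\<^sub>M borel_of (YP P 0 t))" if "t \<le> T" for t
    by (rule sets_borel_of_prod[OF X.second_countable_paths[OF that] Y.second_countable_paths[OF that]])
  have fs: "fst \<in> Q0 p \<rightarrow>\<^sub>M borel_of (XP P 0 T)" "snd \<in> Q0 p \<rightarrow>\<^sub>M borel_of (YP P 0 T)"
    by (simp_all cong: measurable_cong_sets add: Q(2) sBP)
  have marg: "C \<in> sets (borel_of (TX P (Suc t))) \<Longrightarrow>
      emeasure (p t (current t \<omega>)) (C \<times> topspace (TY P (Suc t))) = emeasure (kmu P t (at_time (x0 P) (fst \<omega>) t)) C"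
    "D \<in> sets (borel_of (TY P (Suc t))) \<Longrightarrow>
      emeasure (p t (current t \<omega>)) (topspace (TX P (Suc t)) \<times> D) = emeasure (knu P t (at_time (y0 P) (snd \<omega>) t)) D"
    if "t < T" "\<omega> \<in> space (Q0 p)" for t \<omega> C D
    using coupling_emeasure[of "Suc t" "p t (current t \<omega>)"] that
      adm[OF that(1) Q0_current[OF p less_imp_le[OF that(1)] that(2)]]
    by (auto simp: admissible_def case_prod_beta')
  have "distr (Q0 p) (borel_of (XP P 0 T)) fst = mu P"
  proof (rule X.law_of_projection[OF Q(1) fs(1)])
    fix t A C assume t: "t < T" and A: "A \<in> sets (borel_of (XP P 0 t))" and C: "C \<in> sets (borel_of (TX P (Suc t)))"
    let ?A = "A \<times> topspace (YP P 0 t)" and ?C = "C \<times> topspace (TY P (Suc t))"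
    have AC: "?A \<in> sets (BP 0 t)" "?C \<in> sets (B (Suc t))"
      using A C t sets.top[of "borel_of (YP P 0 t)"] sets.top[of "borel_of (TY P (Suc t))"]
      by (simp_all add: sBP sets_B del: topspace_product_topology)
    have set_eq: "{\<omega> \<in> space (Q0 p). restrict (fst \<omega>) {0<..t} \<in> A \<and> fst \<omega> (Suc t) \<in> C} =
        {\<omega> \<in> space (Q0 p). history 0 t \<omega> \<in> ?A \<and> (fst \<omega> (Suc t), snd \<omega> (Suc t)) \<in> ?C}" (is "?S = _")
      using t by (auto simp: Q(3) history_def)
    have "emeasure (Q0 p) ?S = (\<integral>\<^sup>+\<omega>. emeasure (p t (current t \<omega>)) ?C * indicator ?A (history 0 t \<omega>) \<partial>Q0 p)"
      unfolding set_eq by (rule Q0_emeasure[OF p t AC])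
    also have "\<dots> = (\<integral>\<^sup>+\<omega>. emeasure (kmu P t (at_time (x0 P) (fst \<omega>) t)) C * indicator A (restrict (fst \<omega>) {0<..t}) \<partial>Q0 p)"
    proof (rule nn_integral_cong)
      fix \<omega> assume \<omega>: "\<omega> \<in> space (Q0 p)"
      then have "indicator ?A (history 0 t \<omega>) = (indicator A (restrict (fst \<omega>) {0<..t}) :: ennreal)"
        using t by (auto simp: Q(3) history_def indicator_def)
      with marg(1)[OF t \<omega> C] show "emeasure (p t (current t \<omega>)) ?C * indicator ?A (history 0 t \<omega>) =
          emeasure (kmu P t (at_time (x0 P) (fst \<omega>) t)) C * indicator A (restrict (fst \<omega>) {0<..t})"
        by (simp only:)
    qed
    finally show "emeasure (Q0 p) {\<omega> \<in> space (Q0 p). restrict (fst \<omega>) {0<..t} \<in> A \<and> fst \<omega> (Suc t) \<in> C} =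
        (\<integral>\<^sup>+\<omega>. emeasure (kmu P t (at_time (x0 P) (fst \<omega>) t)) C * indicator A (restrict (fst \<omega>) {0<..t}) \<partial>Q0 p)" .
  qed
  moreover have "distr (Q0 p) (borel_of (YP P 0 T)) snd = nu P"
  proof (rule Y.law_of_projection[OF Q(1) fs(2)])
    fix t A C assume t: "t < T" and A: "A \<in> sets (borel_of (YP P 0 t))" and C: "C \<in> sets (borel_of (TY P (Suc t)))"
    let ?A = "topspace (XP P 0 t) \<times> A" and ?C = "topspace (TX P (Suc t)) \<times> C"
    have AC: "?A \<in> sets (BP 0 t)" "?C \<in> sets (B (Suc t))"
      using A C t sets.top[of "borel_of (XP P 0 t)"] sets.top[of "borel_of (TX P (Suc t))"]
      by (simp_all add: sBP sets_B del: topspace_product_topology)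
    have set_eq: "{\<omega> \<in> space (Q0 p). restrict (snd \<omega>) {0<..t} \<in> A \<and> snd \<omega> (Suc t) \<in> C} =
        {\<omega> \<in> space (Q0 p). history 0 t \<omega> \<in> ?A \<and> (fst \<omega> (Suc t), snd \<omega> (Suc t)) \<in> ?C}" (is "?S = _")
      using t by (auto simp: Q(3) history_def)
    have "emeasure (Q0 p) ?S = (\<integral>\<^sup>+\<omega>. emeasure (p t (current t \<omega>)) ?C * indicator ?A (history 0 t \<omega>) \<partial>Q0 p)"
      unfolding set_eq by (rule Q0_emeasure[OF p t AC])
    also have "\<dots> = (\<integral>\<^sup>+\<omega>. emeasure (knu P t (at_time (y0 P) (snd \<omega>) t)) C * indicator A (restrict (snd \<omega>) {0<..t}) \<partial>Q0 p)"
    proof (rule nn_integral_cong)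
      fix \<omega> assume \<omega>: "\<omega> \<in> space (Q0 p)"
      then have "indicator ?A (history 0 t \<omega>) = (indicator A (restrict (snd \<omega>) {0<..t}) :: ennreal)"
        using t by (auto simp: Q(3) history_def indicator_def)
      with marg(2)[OF t \<omega> C] show "emeasure (p t (current t \<omega>)) ?C * indicator ?A (history 0 t \<omega>) =
          emeasure (knu P t (at_time (y0 P) (snd \<omega>) t)) C * indicator A (restrict (snd \<omega>) {0<..t})"
        by (simp only:)
    qed
    finally show "emeasure (Q0 p) {\<omega> \<in> space (Q0 p). restrict (snd \<omega>) {0<..t} \<in> A \<and> snd \<omega> (Suc t) \<in> C} =
        (\<integral>\<^sup>+\<omega>. emeasure (knu P t (at_time (y0 P) (snd \<omega>) t)) C * indicator A (restrict (snd \<omega>) {0<..t}) \<partial>Q0 p)" .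
  qed
  ultimately show ?thesis
    using Q(1,2) by (simp add: couplings_def probs_def)
qed

text \<open>Optimality holds at every state in the carrier, and paths of the plan stay in the
  carriers; the almost sure statements follow without exceptional sets.\<close>

lemma Q0_equilibrium:
  assumes p: "kern p 0" and opt: "\<And>t. t < T \<Longrightarrow> dp_optimizer P p t (p t)"
  shows "equilibrium_transport P p (Q0 p)"
proof -
  have adm: "p t z \<in> admissible P t z" if "t < T" "z \<in> topspace (ZT P t)" for t z
    using opt[OF that(1)] that(2) by (auto simp: dp_optimizer_def)
  have "bicausal P (\<lambda>t xs. kmu P t (at_time (x0 P) xs t)) (\<lambda>t ys. knu P t (at_time (y0 P) ys t)) (Q0 p)"
    unfolding bicausal_def
  proof (intro conjI allI impI exI)
    show "Q0 p \<in> couplings (XP P 0 T) (YP P 0 T) (mu P) (nu P)"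
      by (rule Q0_couplings[OF p adm])
    fix t assume t: "t < T"
    show "regular_cond_kernel (Q0 p) (BP 0 t) (B (Suc t)) (\<lambda>(xs, ys). (restrict xs {0<..t}, restrict ys {0<..t}))
      (\<lambda>(xs, ys). (xs (Suc t), ys (Suc t))) (\<lambda>(xs, ys). p t (at_time (x0 P) xs t, at_time (y0 P) ys t))"
      by (rule Q0_kernel[OF p t])
    show "AE (xs, ys) in Q0 p. (\<lambda>(xs, ys). p t (at_time (x0 P) xs t, at_time (y0 P) ys t)) (restrict xs {0<..t}, restrict ys {0<..t})
        \<in> couplings (TX P (Suc t)) (TY P (Suc t)) (kmu P t (at_time (x0 P) (restrict xs {0<..t}) t))
            (knu P t (at_time (y0 P) (restrict ys {0<..t}) t))"
    proof (rule AE_I2, clarify)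
      fix xs ys assume \<omega>: "(xs, ys) \<in> space (Q0 p)"
      have at: "at_time (x0 P) (restrict xs {0<..t}) t = at_time (x0 P) xs t" "at_time (y0 P) (restrict ys {0<..t}) t = at_time (y0 P) ys t"
        by (auto simp: at_time_def)
      have "(at_time (x0 P) xs t, at_time (y0 P) ys t) \<in> topspace (ZT P t)"
        using Q0_current[OF p less_imp_le[OF t] \<omega>] by (simp del: topspace_prod_topology)
      from adm[OF t this]
      show "p t (at_time (x0 P) (restrict xs {0<..t}) t, at_time (y0 P) (restrict ys {0<..t}) t)
        \<in> couplings (TX P (Suc t)) (TY P (Suc t)) (kmu P t (at_time (x0 P) (restrict xs {0<..t}) t))
            (knu P t (at_time (y0 P) (restrict ys {0<..t}) t))"
        unfolding at by (simp add: admissible_def)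
    qed
  qed
  moreover have "(INF \<gamma>\<in>admissible P t z. objective P t z (deviate P p t \<gamma>)) = objective P t z (concat_kernels P p t z)"
    if t: "t < T" and z: "z \<in> topspace (ZT P t)" for t z
  proof -
    have p': "kern p (Suc t)" "kern p t"
      using p by (auto intro: kern_mono)
    have "reduced_optimizer P p t (p t)"
      using dp_optimizer_reduced[OF t p'(1), of "p t"] opt t by auto
    then have "reduced_bracket P p t z (p t z) = reduced_value P p t z"
      using z by (auto simp: reduced_optimizer_def)
    moreover have "(INF \<gamma>\<in>admissible P t z. objective P t z (deviate P p t \<gamma>)) = reduced_value P p t z"
      unfolding reduced_value_def
      by (intro INF_cong refl objective_deviate[OF t p'(1) admissible_space z])
    ultimately show ?thesis
      using objective_concat[OF t p'(2) z] by simp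
  qed
  then have "AE (xs, ys) in Q0 p.
        (let z = (at_time (x0 P) xs t, at_time (y0 P) ys t) in
           (INF \<gamma>\<in>admissible P t z. objective P t z (deviate P p t \<gamma>)) = objective P t z (concat_kernels P p t z))"
    if t: "t < T" for t
    using Q0_current[OF p less_imp_le[OF t]] t
    by (intro AE_I2) (auto simp: Let_def simp del: topspace_prod_topology)
  ultimately show ?thesis
    unfolding equilibrium_transport_def using Q0_kernel[OF p] by blast
qed

section \<open>Backward construction and regularity of the value function\<close>

lemma borel_kernel_iff:
  assumes "t < T"
  shows "borel_kernel P t q \<longleftrightarrow> q \<in> B t \<rightarrow>\<^sub>M prob_algebra (B (Suc t))"
proof -
  have "polish_topology (ZT P (Suc t))"
    using assms by (intro polish_Z) simp
  then have "metrizable_space (ZT P (Suc t))" "second_countable (ZT P (Suc t))"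
    by (auto simp: polish_topology_iff completely_metrizable_imp_metrizable_space)
  then show ?thesis
    unfolding borel_kernel_def by (metis measurable_weak_topology measurable_weak_topologyD)
qed

lemma kernI: "(\<And>s. t \<le> s \<Longrightarrow> s < T \<Longrightarrow> borel_kernel P s (p s)) \<Longrightarrow> kern p t"
  by (auto simp: kern_def borel_kernel_iff)

lemma dp_step:
  assumes t: "t < T" and p: "\<And>s. t < s \<Longrightarrow> s < T \<Longrightarrow> borel_kernel P s (p s) \<and> dp_optimizer P p s (p s)"
  shows "\<exists>q. borel_kernel P t q \<and> dp_optimizer P p t q"
    "dp_optimizer P p t q \<longleftrightarrow> reduced_optimizer P p t q"
    "dp_value P p t z = reduced_value P p t z"
proof -
  have k: "kern p (Suc t)"
    using p by (intro kernI) auto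
  show red: "dp_optimizer P p t q \<longleftrightarrow> reduced_optimizer P p t q" for q
    using p by (intro dp_optimizer_reduced[OF t k]) auto
  show "dp_value P p t z = reduced_value P p t z"
    using p by (intro dp_value_reduced[OF t k]) auto
  show "\<exists>q. borel_kernel P t q \<and> dp_optimizer P p t q"
    using ex_reduced_optimizer[OF t k] by (auto simp: red borel_kernel_iff[OF t])
qed

text \<open>This and the following congruences express that only later kernels matter, so a family
  may be changed at the current time without disturbing what was achieved for later times.\<close>

lemma concat_kernels_cong:
  assumes "\<And>s. t \<le> s \<Longrightarrow> s < T \<Longrightarrow> p s = p' s" "t \<le> T"
  shows "concat_kernels P p t = concat_kernels P p' t"
  using assms(2,1)
proof (induction rule: inc_induct)
  case base
  show ?case
    by (subst (1 2) concat_kernels.simps) simp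
next
  case (step t)
  have "concat_kernels P p (Suc t) = concat_kernels P p' (Suc t)"
    using step.prems by (intro step.IH) auto
  then show ?case
    using step.prems[of t] step.hyps by (subst (1 2) concat_kernels.simps) simp
qed

lemma dp_bracket_cong:
  assumes "\<And>s. t < s \<Longrightarrow> s < T \<Longrightarrow> p s = p' s" "t < T"
  shows "dp_bracket P p V t z \<gamma> = dp_bracket P p' V t z \<gamma>"
proof -
  have eq: "concat_kernels P p (Suc t) = concat_kernels P p' (Suc t)"
    using assms by (intro concat_kernels_cong) auto
  have "g_fun P p (Suc t) = g_fun P p' (Suc t)"
    by (simp add: fun_eq_iff g_fun_def eq)
  moreover have "b_fun P p k i v (Suc t) = b_fun P p' k i v (Suc t)" for k i v
    by (simp add: fun_eq_iff b_fun_def eq)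
  ultimately show ?thesis
    by (simp add: dp_bracket_def)
qed

lemma dp_value_cong:
  assumes "\<And>s. t < s \<Longrightarrow> s < T \<Longrightarrow> p s = p' s" "t \<le> T"
  shows "dp_value P p t = dp_value P p' t"
  using assms(2,1)
proof (induction rule: inc_induct)
  case base
  show ?case
    by (subst (1 2) dp_value.simps) simp
next
  case (step t)
  have "dp_value P p (Suc t) = dp_value P p' (Suc t)"
    using step.prems by (intro step.IH) auto
  moreover have "dp_bracket P p V t z \<gamma> = dp_bracket P p' V t z \<gamma>" for V z \<gamma>
    using step.prems by (intro dp_bracket_cong step.hyps) auto
  ultimately show ?case
    using step.hyps by (subst (1 2) dp_value.simps) simp
qed

lemma dp_optimizer_cong:
  assumes "\<And>s. t < s \<Longrightarrow> s < T \<Longrightarrow> p s = p' s" "t < T"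
  shows "dp_optimizer P p t q \<longleftrightarrow> dp_optimizer P p' t q"
proof -
  have "dp_value P p t = dp_value P p' t" "dp_value P p (Suc t) = dp_value P p' (Suc t)"
    using assms by (auto intro!: dp_value_cong)
  then show ?thesis
    unfolding dp_optimizer_def by (simp add: dp_bracket_cong[OF assms])
qed

text \<open>Recursion backward in time, overwriting the family at the current time by an optimizer;
  by the congruences its later members stay optimal.\<close>

lemma ex_optimal_kernels: "\<exists>p. \<forall>t<T. borel_kernel P t (p t) \<and> dp_optimizer P p t (p t)"
proof -
  have "\<exists>p. \<forall>s. t \<le> s \<and> s < T \<longrightarrow> borel_kernel P s (p s) \<and> dp_optimizer P p s (p s)" if "t \<le> T" for t
    using that
  proof (induction rule: inc_induct)
    case base
    show ?case
      by auto
  next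
    case (step t)
    then obtain p where p: "\<And>s. Suc t \<le> s \<Longrightarrow> s < T \<Longrightarrow> borel_kernel P s (p s) \<and> dp_optimizer P p s (p s)"
      by blast
    obtain q where q: "borel_kernel P t q" "dp_optimizer P p t q"
      using dp_step(1)[of t p] p step.hyps by auto
    have "borel_kernel P s ((p(t := q)) s) \<and> dp_optimizer P (p(t := q)) s ((p(t := q)) s)" if s: "t \<le> s" "s < T" for s
    proof -
      have "dp_optimizer P (p(t := q)) s ((p(t := q)) s) \<longleftrightarrow> dp_optimizer P p s ((p(t := q)) s)"
        using s by (intro dp_optimizer_cong) auto
      then show ?thesis
        using q p[of s] s by (cases "s = t") auto
    qed
    then show ?case
      by blast
  qed
  from this[of 0] show ?thesis
    by simp
qed

text \<open>An infimum over a set of couplings that varies with the state is not visibly measurable;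
  the attained value \<open>W\<close> is, and the two agree on the carrier.\<close>

lemma dp_value_measurable:
  assumes p: "\<And>s. s < T \<Longrightarrow> borel_kernel P s (p s) \<and> dp_optimizer P p s (p s)" and t: "t \<le> T"
  shows "dp_value P p t \<in> borel_measurable (B t)"
proof -
  have k: "kern p t"
    using p by (intro kernI) auto
  have "dp_value P p t z = W p t z" if "z \<in> space (B t)" for z
    using p that by (intro dp_value_eq_W[OF t k]) auto
  then show ?thesis
    using W_measurable[OF t k] by (subst measurable_cong[of _ _ "W p t"]) auto
qed

lemma ex_refinement:
  assumes p: "\<And>s. s < T \<Longrightarrow> borel_kernel P s (p s) \<and> dp_optimizer P p s (p s)" and t: "t \<le> T"
  shows "\<exists>S. polish_topology S \<and> finer_topology S (ZT P t) \<and>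
    (t < T \<longrightarrow> continuous_map S (weak_topology (ZT P (Suc t))) (p t)) \<and> lsc_on S (dp_value P p t)"
proof (cases "t < T")
  case True
  have q: "p t \<in> B t \<rightarrow>\<^sub>M prob_algebra (B (Suc t))"
    using p[OF True] borel_kernel_iff[OF True] by simp
  have "second_countable (ZT P (Suc t))"
    using True by (intro second_countable_Z) simp
  from polish_refinement_kernel[OF polish_Z[OF t] dp_value_measurable[OF p t] this q] show ?thesis
    by metis
next
  case False
  from polish_refinement_lsc[OF polish_Z[OF t] dp_value_measurable[OF p t], of "{}"] show ?thesis
    using False by (metis countable_empty empty_subsetI)
qed

end

text \<open>The first block starts from arbitrary optimizers at later times, so the backward
  construction can be continued whatever was chosen before; the last block likewise concerns every
  optimal Borel family. The refined topology may depend on the time and on the family, and at the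
  horizon, where no kernel is left, it concerns the value function alone.\<close>

theorem theorem3p5:
  fixes P :: "('d::finite) problem"
  assumes "setting P"
    and "asm_A1 P" and "asm_A2 P" and "asm_A3 P" and "asm_A4 P"
    and "asm_M1 P" and "asm_M2 P"
  shows
    "(\<forall>t<horizon P. \<forall>p.
        (\<forall>s. t < s \<and> s < horizon P \<longrightarrow> borel_kernel P s (p s) \<and> dp_optimizer P p s (p s)) \<longrightarrow>
        (\<exists>q. borel_kernel P t q \<and> dp_optimizer P p t q) \<and>
        (\<forall>q. dp_optimizer P p t q \<longleftrightarrow> reduced_optimizer P p t q) \<and>
        (\<forall>z\<in>topspace (ZT P t). dp_value P p t z = reduced_value P p t z)) \<and>
     (\<exists>p. \<forall>t<horizon P. borel_kernel P t (p t) \<and> dp_optimizer P p t (p t)) \<and>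
     (\<forall>p. (\<forall>t<horizon P. borel_kernel P t (p t) \<and> dp_optimizer P p t (p t)) \<longrightarrow>
        equilibrium_transport P p (concat_kernels P p 0 (x0 P, y0 P)) \<and>
        (\<forall>t\<le>horizon P. dp_value P p t \<in> borel_measurable (borel_of (ZT P t))) \<and>
        (\<forall>t\<le>horizon P. \<exists>S. polish_topology S \<and> finer_topology S (ZT P t) \<and>
           (t < horizon P \<longrightarrow> continuous_map S (weak_topology (ZT P (Suc t))) (p t)) \<and>
           lsc_on S (dp_value P p t)))"
proof -
  interpret transport P
    using assms(1-6) by unfold_locales
  show ?thesis
  proof (intro conjI allI impI)
    fix t p assume t: "t < horizon P"
      and p: "\<forall>s. t < s \<and> s < horizon P \<longrightarrow> borel_kernel P s (p s) \<and> dp_optimizer P p s (p s)"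
    show "\<exists>q. borel_kernel P t q \<and> dp_optimizer P p t q"
      using p by (intro dp_step(1)[OF t]) auto
    show "dp_optimizer P p t q \<longleftrightarrow> reduced_optimizer P p t q" for q
      using p by (intro dp_step(2)[OF t]) auto
    show "\<forall>z\<in>topspace (ZT P t). dp_value P p t z = reduced_value P p t z"
      using p by (intro ballI dp_step(3)[OF t]) auto
  next
    show "\<exists>p. \<forall>t<horizon P. borel_kernel P t (p t) \<and> dp_optimizer P p t (p t)"
      by (rule ex_optimal_kernels)
  next
    fix p assume p: "\<forall>t<horizon P. borel_kernel P t (p t) \<and> dp_optimizer P p t (p t)"
    show "equilibrium_transport P p (concat_kernels P p 0 (x0 P, y0 P))"
      using p by (intro Q0_equilibrium kernI) auto
    fix t assume t: "t \<le> horizon P"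
    show "dp_value P p t \<in> borel_measurable (borel_of (ZT P t))"
      using p t by (intro dp_value_measurable) auto
    show "\<exists>S. polish_topology S \<and> finer_topology S (ZT P t) \<and>
        (t < horizon P \<longrightarrow> continuous_map S (weak_topology (ZT P (Suc t))) (p t)) \<and> lsc_on S (dp_value P p t)"
      using p t by (intro ex_refinement) auto
  qed
qed

end
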